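(* Let $q>3$ be an odd prime power, $G=\mathbf{SL}(2,\mathbb{F}_q)$, $x\in\mathbb{F}_q^\times$ with $x\neq\pm1$, and for $y\in\mathbb{F}_q^\times$ put $c_7(y)=\begin{pmatrix}y&0\\0&y^{-1}\end{pmatrix}$. Let $g=c_7(x)$, whose centralizer in $G$ is the group of diagonal matrices, isomorphic to $\mathbb{F}_q^\times$, and let $\chi$ be a character of $\mathcal{Z}_g$ with values in $k^\times$. The elements $c_7(x)$ and $c_7(x^{-1})$ are conjugate in $G$; let $T=\{c_7(x),c_7(x^{-1})\}$. If $\dim\mathfrak{B}(V(g,\chi))<\infty$, then $\mathbf{q}_T=\begin{pmatrix}-1&-1\\-1&-1\end{pmatrix}$ and $x$ has even (multiplicative) order.
   Context: $k$ is an algebraically closed field of characteristic $0$. For a finite group $G$, a Yetter-Drinfeld module over $kG$ is a $G$-graded $k$-vector space $V=\bigoplus_{h\in G}V_h$ with a linear $G$-action such that $g\cdot V_h\subseteq V_{ghg^{-1}}$. It is a braided vector space with braiding $c(v\otimes w)=h\cdot w\otimes v$ for $v\in V_h$, $w\in V$. For $g\in G$, $\mathcal{Z}_g$ is the centralizer of $g$ in $G$. For a character $\chi$ of $\mathcal{Z}_g$, $V(g,\chi)=\mathrm{Ind}_{\mathcal{Z}_g}^G\chi=kG\otimes_{k\mathcal{Z}_g}k_\chi$, graded so that $h\otimes w$ has degree $hgh^{-1}$. If $T=\{g_i\}$ is a set of pairwise commuting elements of the conjugacy class of $g$ that contains $g$, with $g_i=x_igx_i^{-1}$, then $\mathbf{q}_T=(\mathbf{q}_{ij})$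 is the matrix with $\mathbf{q}_{ij}=\chi(x_j^{-1}g_ix_j)$ (independent of the choice of the $x_j$). On the span of the vectors $v_i=x_i\otimes1$ the braiding is $c(v_i\otimes v_j)=\mathbf{q}_{ij}v_j\otimes v_i$. The Nichols algebra of a braided vector space $(V,c)$ is $\mathfrak{B}(V)=T(V)/\bigoplus_{n\ge2}\ker(\mathfrak{S}_n)$, where $\mathfrak{S}_n=\sum_{\sigma\in\mathbb{S}_n}c_\sigma$ acts on $V^{\otimes n}$ and $c_\sigma$ is obtained from a reduced expression of $\sigma$ by replacing each transposition $(i\ i{+}1)$ with $c$ acting on the factors $i,i+1$. *)

theory Defs
  imports
    "HOL-Analysis.Determinants"
    "HOL-Algebra.Algebraic_Closure_Type"
    "HOL-Algebra.Multiplicative_Group"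
    "HOL-Algebra.QuotRing"
    "HOL-Library.Poly_Mapping"
    "HOL-Combinatorics.Permutations"
    "HOL-Number_Theory.Prime_Powers"
begin

section \<open>Linear algebra over a type-class field\<close>

text \<open>
  Vector spaces and associative algebras over \<open>'k\<close> are \<open>module\<close> records of HOL-Algebra with scalars
  in \<open>scalars\<close>; for a bare vector space the components \<open>mult\<close> and \<open>one\<close> are irrelevant.
\<close>

abbreviation scalars :: "'k::field ring"
  where "scalars \<equiv> ring_of_type_algebra"

lemma scalars_simps [simp]:
  "carrier (scalars :: 'k::field ring) = UNIV" "mult (scalars :: 'k ring) = (*)"
  "one (scalars :: 'k ring) = 1" "zero (scalars :: 'k ring) = 0" "add (scalars :: 'k ring) = (+)"
  by (auto simp: ring_of_type_algebra_def)

definition linear_map ::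
    "('k::field, 'v, 'm) module_scheme \<Rightarrow> ('k, 'w, 'n) module_scheme \<Rightarrow> ('v \<Rightarrow> 'w) \<Rightarrow> bool"
  where "linear_map V W f \<longleftrightarrow>
    f \<in> carrier V \<rightarrow> carrier W \<and>
    (\<forall>u\<in>carrier V. \<forall>v\<in>carrier V. f (u \<oplus>\<^bsub>V\<^esub> v) = f u \<oplus>\<^bsub>W\<^esub> f v) \<and>
    (\<forall>a. \<forall>v\<in>carrier V. f (a \<odot>\<^bsub>V\<^esub> v) = a \<odot>\<^bsub>W\<^esub> f v)"

definition lin_span :: "('k::field, 'v, 'm) module_scheme \<Rightarrow> 'v set \<Rightarrow> 'v set"
  where "lin_span V S = \<Inter>{U. submodule U scalars V \<and> S \<subseteq> U}"

definition finite_dimensional :: "('k::field, 'v, 'm) module_scheme \<Rightarrow> bool"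
  where "finite_dimensional V \<longleftrightarrow>
    (\<exists>S. finite S \<and> S \<subseteq> carrier V \<and> lin_span V S = carrier V)"

text \<open>
  The quotient \<open>A / U\<close>. It is an algebra if \<open>U\<close> is a two-sided ideal; for a mere subspace \<open>U\<close>
  only the vector space structure is meaningful.
\<close>
definition quot_module ::
    "('k::field, 'v, 'm) module_scheme \<Rightarrow> 'v set \<Rightarrow> ('k, 'v set) module"
  where "quot_module A U =
    \<lparr>carrier = carrier (A Quot U), mult = mult (A Quot U), one = one (A Quot U),
     zero = zero (A Quot U), add = add (A Quot U),
     module.smult = (\<lambda>a C. \<Union>u\<in>C. U +>\<^bsub>A\<^esub> (a \<odot>\<^bsub>A\<^esub> u))\<rparr>"

text \<open>The monoid algebra \<open>k[M]\<close>; the basis element \<open>m\<close> is \<open>single m 1\<close>.\<close>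
definition monoid_algebra ::
    "('m, 'b) monoid_scheme \<Rightarrow> ('k::field, 'm \<Rightarrow>\<^sub>0 'k) module"
  where "monoid_algebra M =
    \<lparr>carrier = {p. Poly_Mapping.keys p \<subseteq> carrier M},
     mult = (\<lambda>p q. \<Sum>a\<in>Poly_Mapping.keys p. \<Sum>b\<in>Poly_Mapping.keys q.
       Poly_Mapping.single (a \<otimes>\<^bsub>M\<^esub> b) (Poly_Mapping.lookup p a * Poly_Mapping.lookup q b)),
     one = Poly_Mapping.single \<one>\<^bsub>M\<^esub> 1,
     zero = 0, add = (+),
     module.smult = (\<lambda>a. Poly_Mapping.map ((*) a))\<rparr>"


section \<open>Tensor algebra\<close>

definition free_algebra :: "('k::field, 'v, 'm) module_scheme \<Rightarrow> ('k, 'v list \<Rightarrow>\<^sub>0 'k) module"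
  where "free_algebra V =
    monoid_algebra \<lparr>carrier = lists (carrier V), mult = (@), one = []\<rparr>"

definition tensor_ideal :: "('k::field, 'v, 'm) module_scheme \<Rightarrow> ('v list \<Rightarrow>\<^sub>0 'k) set"
  where "tensor_ideal V = genideal (free_algebra V)
    ({Poly_Mapping.single [u \<oplus>\<^bsub>V\<^esub> v] 1 - Poly_Mapping.single [u] 1 - Poly_Mapping.single [v] 1
       | u v. u \<in> carrier V \<and> v \<in> carrier V} \<union>
     {Poly_Mapping.single [a \<odot>\<^bsub>V\<^esub> v] 1 - Poly_Mapping.single [v] a
       | a v. v \<in> carrier V})"

text \<open>
  \<open>T(V)\<close> is the free algebra on the elements of \<open>V\<close> modulo the relations that make
  \<open>V \<rightarrow> T(V)\<close> linear.
\<close>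
definition tensor_algebra ::
    "('k::field, 'v, 'm) module_scheme \<Rightarrow> ('k, ('v list \<Rightarrow>\<^sub>0 'k) set) module"
  where "tensor_algebra V = quot_module (free_algebra V) (tensor_ideal V)"

text \<open>\<open>pure_tensor V [v\<^sub>1, \<dots>, v\<^sub>n]\<close> is \<open>v\<^sub>1 \<otimes> \<dots> \<otimes> v\<^sub>n\<close>.\<close>
definition pure_tensor ::
    "('k::field, 'v, 'm) module_scheme \<Rightarrow> 'v list \<Rightarrow> ('v list \<Rightarrow>\<^sub>0 'k) set"
  where "pure_tensor V vs = tensor_ideal V +>\<^bsub>free_algebra V\<^esub> Poly_Mapping.single vs 1"

definition tensor_power ::
    "('k::field, 'v, 'm) module_scheme \<Rightarrow> nat \<Rightarrow> ('k, ('v list \<Rightarrow>\<^sub>0 'k) set) module"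
  where "tensor_power V n = (tensor_algebra V)
    \<lparr>carrier := lin_span (tensor_algebra V)
       (pure_tensor V ` {vs \<in> lists (carrier V). length vs = n})\<rparr>"


section \<open>Nichols algebra of a braided vector space\<close>

text \<open>
  A braided vector space is a vector space \<open>V\<close> with a linear map \<open>c\<close> on \<open>tensor_power V 2\<close>.
  \<open>braid_at V c n i\<close> is \<open>id \<otimes> c \<otimes> id\<close> on \<open>tensor_power V n\<close>, with \<open>c\<close> in the (0-based) tensor
  factors \<open>i\<close> and \<open>i + 1\<close>. It is determined on \<open>tensor_power V n\<close>, which pure tensors span; the
  values elsewhere are irrelevant.
\<close>
definition braid_at ::
    "('k::field, 'v, 'm) module_scheme \<Rightarrow> (('v list \<Rightarrow>\<^sub>0 'k) set \<Rightarrow> ('v list \<Rightarrow>\<^sub>0 'k) set) \<Rightarrow>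
     nat \<Rightarrow> nat \<Rightarrow> ('v list \<Rightarrow>\<^sub>0 'k) set \<Rightarrow> ('v list \<Rightarrow>\<^sub>0 'k) set"
  where "braid_at V c n i = (SOME f. linear_map (tensor_power V n) (tensor_power V n) f \<and>
    (\<forall>vs\<in>lists (carrier V). length vs = n \<longrightarrow>
      f (pure_tensor V vs) =
        pure_tensor V (take i vs) \<otimes>\<^bsub>tensor_algebra V\<^esub>
        c (pure_tensor V [vs ! i, vs ! Suc i]) \<otimes>\<^bsub>tensor_algebra V\<^esub>
        pure_tensor V (drop (Suc (Suc i)) vs)))"

text \<open>
  The word \<open>[i\<^sub>1, \<dots>, i\<^sub>l]\<close> expresses \<open>\<sigma>\<close> as the product of the transpositions
  \<open>(i\<^sub>j  i\<^sub>j + 1)\<close> of \<open>{0, \<dots>, n - 1}\<close>.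
\<close>
definition expresses :: "nat \<Rightarrow> (nat \<Rightarrow> nat) \<Rightarrow> nat list \<Rightarrow> bool"
  where "expresses n \<sigma> ws \<longleftrightarrow>
    (\<forall>i\<in>set ws. Suc i < n) \<and> \<sigma> = foldr (\<lambda>i \<tau>. Transposition.transpose i (Suc i) \<circ> \<tau>) ws id"

text \<open>
  A reduced expression is one of minimal length. \<open>arg_min\<close> selects one; by the braid relation
  the map below does not depend on the selection.
\<close>
definition braid_perm ::
    "('k::field, 'v, 'm) module_scheme \<Rightarrow> (('v list \<Rightarrow>\<^sub>0 'k) set \<Rightarrow> ('v list \<Rightarrow>\<^sub>0 'k) set) \<Rightarrow>
     nat \<Rightarrow> (nat \<Rightarrow> nat) \<Rightarrow> ('v list \<Rightarrow>\<^sub>0 'k) set \<Rightarrow> ('v list \<Rightarrow>\<^sub>0 'k) set"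
  where "braid_perm V c n \<sigma> =
    foldr (\<lambda>i f. braid_at V c n i \<circ> f) (arg_min length (expresses n \<sigma>)) id"

definition quantum_symmetrizer ::
    "('k::field, 'v, 'm) module_scheme \<Rightarrow> (('v list \<Rightarrow>\<^sub>0 'k) set \<Rightarrow> ('v list \<Rightarrow>\<^sub>0 'k) set) \<Rightarrow>
     nat \<Rightarrow> ('v list \<Rightarrow>\<^sub>0 'k) set \<Rightarrow> ('v list \<Rightarrow>\<^sub>0 'k) set"
  where "quantum_symmetrizer V c n t =
    (\<Oplus>\<^bsub>tensor_algebra V\<^esub>\<sigma>\<in>{\<sigma>. \<sigma> permutes {..<n}}. braid_perm V c n \<sigma> t)"

text \<open>
  The kernels lie in distinct homogeneous components of \<open>T(V)\<close>, so their sum, which is what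
  the span of the union is, is direct.
\<close>
definition nichols_algebra ::
    "('k::field, 'v, 'm) module_scheme \<Rightarrow> (('v list \<Rightarrow>\<^sub>0 'k) set \<Rightarrow> ('v list \<Rightarrow>\<^sub>0 'k) set) \<Rightarrow>
     ('k, ('v list \<Rightarrow>\<^sub>0 'k) set set) module"
  where "nichols_algebra V c = quot_module (tensor_algebra V)
    (lin_span (tensor_algebra V)
      (\<Union>n\<in>{2..}. {t \<in> carrier (tensor_power V n).
         quantum_symmetrizer V c n t = \<zero>\<^bsub>tensor_algebra V\<^esub>}))"


section \<open>Yetter-Drinfeld modules over a finite group\<close>

record ('k, 'v, 'g) yd_module = "('k, 'v) module" +
  act :: "'g \<Rightarrow> 'v \<Rightarrow> 'v"
  homog :: "'g \<Rightarrow> 'v set"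

locale yetter_drinfeld =
  G: group G + V: Module.module scalars V
  for G :: "('g, 'b) monoid_scheme" and V :: "('k::field, 'v, 'g, 'm) yd_module_scheme" +
  assumes finite_G: "finite (carrier G)"
    and homog_submodule: "h \<in> carrier G \<Longrightarrow> submodule (homog V h) scalars V"
    and homog_decomposition: "v \<in> carrier V \<Longrightarrow>
      \<exists>!f. f \<in> (\<Pi>\<^sub>E h\<in>carrier G. homog V h) \<and> v = (\<Oplus>\<^bsub>V\<^esub>h\<in>carrier G. f h)"
    and act_linear: "a \<in> carrier G \<Longrightarrow> linear_map V V (act V a)"
    and act_one: "v \<in> carrier V \<Longrightarrow> act V \<one>\<^bsub>G\<^esub> v = v"
    and act_mult: "\<lbrakk>a \<in> carrier G; b \<in> carrier G; v \<in> carrier V\<rbrakk> \<Longrightarrow>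
      act V (a \<otimes>\<^bsub>G\<^esub> b) v = act V a (act V b v)"
    and act_homog: "\<lbrakk>a \<in> carrier G; h \<in> carrier G\<rbrakk> \<Longrightarrow>
      act V a ` homog V h \<subseteq> homog V (a \<otimes>\<^bsub>G\<^esub> h \<otimes>\<^bsub>G\<^esub> inv\<^bsub>G\<^esub> a)"

text \<open>Determined on \<open>tensor_power V 2\<close> because \<open>V\<close> is the sum of its homogeneous components.\<close>
definition yd_braiding ::
    "('g, 'b) monoid_scheme \<Rightarrow> ('k::field, 'v, 'g, 'm) yd_module_scheme \<Rightarrow>
     ('v list \<Rightarrow>\<^sub>0 'k) set \<Rightarrow> ('v list \<Rightarrow>\<^sub>0 'k) set"
  where "yd_braiding G V = (SOME c. linear_map (tensor_power V 2) (tensor_power V 2) c \<and>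
    (\<forall>h\<in>carrier G. \<forall>v\<in>homog V h. \<forall>w\<in>carrier V.
      c (pure_tensor V [v, w]) = pure_tensor V [act V h w, v]))"

definition centralizer :: "('g, 'b) monoid_scheme \<Rightarrow> 'g \<Rightarrow> 'g set"
  where "centralizer G g = {h \<in> carrier G. h \<otimes>\<^bsub>G\<^esub> g = g \<otimes>\<^bsub>G\<^esub> h}"

text \<open>
  \<open>kG \<otimes>\<^bsub>kH\<^esub> k\<^sub>\<chi>\<close> is the quotient of \<open>kG \<otimes>\<^sub>k k = kG\<close> by the relations
  \<open>h z \<otimes> 1 = h \<otimes> \<chi>(z)\<close>, for \<open>h \<in> G\<close> and \<open>z \<in> H\<close>.
\<close>
definition induced_relations :: "('g, 'b) monoid_scheme \<Rightarrow> 'g set \<Rightarrow> ('g \<Rightarrow> 'k::field) \<Rightarrow> ('g \<Rightarrow>\<^sub>0 'k) set"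
  where "induced_relations G H chi = lin_span (monoid_algebra G)
    {Poly_Mapping.single (h \<otimes>\<^bsub>G\<^esub> z) 1 - Poly_Mapping.single h (chi z)
       | h z. h \<in> carrier G \<and> z \<in> H}"

text \<open>The element \<open>h \<otimes> 1\<close> of \<open>kG \<otimes>\<^bsub>kH\<^esub> k\<^sub>\<chi>\<close>.\<close>
definition induced_elem :: "('g, 'b) monoid_scheme \<Rightarrow> 'g set \<Rightarrow> ('g \<Rightarrow> 'k::field) \<Rightarrow> 'g \<Rightarrow> ('g \<Rightarrow>\<^sub>0 'k) set"
  where "induced_elem G H chi h =
    induced_relations G H chi +>\<^bsub>monoid_algebra G\<^esub> Poly_Mapping.single h 1"

definition induced_module ::
    "('g, 'b) monoid_scheme \<Rightarrow> 'g set \<Rightarrow> ('g \<Rightarrow> 'k::field) \<Rightarrow> ('k, ('g \<Rightarrow>\<^sub>0 'k) set) module"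
  where "induced_module G H chi = quot_module (monoid_algebra G) (induced_relations G H chi)"

text \<open>\<open>V(g, \<chi>)\<close>, on which \<open>a \<in> G\<close> acts by left multiplication in \<open>kG\<close>.\<close>
definition yd_induced ::
    "('g, 'b) monoid_scheme \<Rightarrow> 'g \<Rightarrow> ('g \<Rightarrow> 'k::field) \<Rightarrow> ('k, ('g \<Rightarrow>\<^sub>0 'k) set, 'g) yd_module"
  where "yd_induced G g chi = (let Z = centralizer G g in
    module.extend (induced_module G Z chi)
    \<lparr>act = (\<lambda>a C. \<Union>p\<in>C. induced_relations G Z chi +>\<^bsub>monoid_algebra G\<^esub>
        (Poly_Mapping.single a 1 \<otimes>\<^bsub>monoid_algebra G\<^esub> p)),
     homog = (\<lambda>h. lin_span (induced_module G Z chi)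
        (induced_elem G Z chi ` {t \<in> carrier G. t \<otimes>\<^bsub>G\<^esub> g \<otimes>\<^bsub>G\<^esub> inv\<^bsub>G\<^esub> t = h}))\<rparr>)"

text \<open>
  The matrix \<open>q\<^bsub>T\<^esub>\<close> of a family \<open>gs\<close> of commuting conjugates \<open>gs i = xs i \<cdot> g \<cdot> (xs i)\<^sup>-\<^sup>1\<close> of \<open>g\<close>.
\<close>
definition braiding_matrix ::
    "('g, 'b) monoid_scheme \<Rightarrow> ('g \<Rightarrow> 'k::field) \<Rightarrow> ('i::finite \<Rightarrow> 'g) \<Rightarrow> ('i \<Rightarrow> 'g) \<Rightarrow> 'k ^ 'i ^ 'i"
  where "braiding_matrix G chi gs xs = (\<chi> i j. chi (inv\<^bsub>G\<^esub> (xs j) \<otimes>\<^bsub>G\<^esub> gs i \<otimes>\<^bsub>G\<^esub> xs j))"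


section \<open>The group\<close>

definition SL2 :: "('f::field ^ 2 ^ 2) monoid"
  where "SL2 = \<lparr>carrier = {A. det A = 1}, mult = (**), one = mat 1\<rparr>"

definition c7 :: "'f::field \<Rightarrow> 'f ^ 2 ^ 2"
  where "c7 y = vector [vector [y, 0], vector [0, inverse y]]"

lemma SL2_group: "group (SL2 :: ('f::field ^ 2 ^ 2) monoid)"
proof (rule groupI)
  fix A :: "'f ^ 2 ^ 2" assume "A \<in> carrier SL2"
  then have d: "det A = 1" by (simp add: SL2_def)
  then obtain B where B: "B ** A = mat 1" using invertible_det_nz[of A] by (auto simp: invertible_def)
  then have "det B = 1" using d det_mul[of B A] by simp
  then show "\<exists>B\<in>carrier SL2. B \<otimes>\<^bsub>SL2\<^esub> A = \<one>\<^bsub>SL2\<^esub>" using B by (auto simp: SL2_def)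
qed (auto simp: SL2_def det_mul matrix_mul_assoc)

lemma c7_iso: 
  fixes x :: "'f::field"
  assumes "x \<noteq> 0" "x \<noteq> 1" "x \<noteq> - 1"
  shows "c7 \<in> iso (units_of (scalars :: 'f ring)) (SL2\<lparr>carrier := centralizer SL2 (c7 x)\<rparr>)"
proof -
  have U: "carrier (units_of (scalars :: 'f ring)) = {y. y \<noteq> 0}"
    by (auto simp: units_of_def Units_def) (metis field_class.field_inverse mult.commute)
  have ne: "x \<noteq> inverse x"
    using assms by (metis field_class.field_inverse left_inverse power2_eq_1_iff power2_eq_square)
  have hom: "c7 (y * z) = c7 y ** c7 z" for y z :: 'f
    by (simp add: c7_def vec_eq_iff forall_2 matrix_matrix_mult_def sum_2)
  have mem: "c7 y \<in> centralizer SL2 (c7 x)" if "y \<noteq> 0" for y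
    using that assms by (simp add: centralizer_def SL2_def hom[symmetric] mult.commute) (simp add: c7_def det_2)
  have inj: "c7 y = c7 z \<Longrightarrow> y = z" for y z :: 'f
    by (simp add: c7_def vec_eq_iff forall_2)
  have surj: "\<exists>y. y \<noteq> 0 \<and> A = c7 y" if A: "A \<in> centralizer SL2 (c7 x)" for A
  proof -
    have d: "A$1$1 * A$2$2 - A$1$2 * A$2$1 = 1" and c: "A ** c7 x = c7 x ** A"
      using A by (auto simp: centralizer_def SL2_def det_2)
    have c: "A$1$2 * inverse x = x * A$1$2" "A$2$1 * x = inverse x * A$2$1"
      using c by (auto simp: c7_def vec_eq_iff forall_2 matrix_matrix_mult_def sum_2)
    have z: "A$1$2 = 0" "A$2$1 = 0" using c ne by (auto simp: mult.commute)
    then have "A$1$1 * A$2$2 = 1" using d by simp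
    then have "A$1$1 \<noteq> 0" "A$2$2 = inverse (A$1$1)" using inverse_unique by fastforce+
    then show ?thesis using z by (intro exI[of _ "A$1$1"]) (auto simp: c7_def vec_eq_iff forall_2)
  qed
  have "bij_betw c7 {y. y \<noteq> 0} (centralizer SL2 (c7 x))"
    unfolding bij_betw_def inj_on_def using mem inj surj by blast
  moreover have "c7 \<in> hom (units_of (scalars :: 'f ring)) (SL2\<lparr>carrier := centralizer SL2 (c7 x)\<rparr>)"
    unfolding hom_def U using mem hom by (auto simp: units_of_mult SL2_def)
  ultimately show ?thesis unfolding iso_def by (simp add: U)
qed

lemma c7_inverse_conjugate:
  fixes x :: "'f::field"
  assumes "x \<noteq> 0"
  shows "\<exists>A\<in>carrier SL2. c7 (inverse x) = A \<otimes>\<^bsub>SL2\<^esub> c7 x \<otimes>\<^bsub>SL2\<^esub> inv\<^bsub>SL2\<^esub> A"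
proof -
  interpret group "SL2 :: ('f ^ 2 ^ 2) monoid" by (rule SL2_group)
  let ?A = "vector [vector [0, 1], vector [- 1, 0]] :: 'f ^ 2 ^ 2"
  let ?B = "vector [vector [0, - 1], vector [1, 0]] :: 'f ^ 2 ^ 2"
  have A: "?A \<in> carrier SL2" "?B \<in> carrier SL2" by (auto simp: SL2_def det_2)
  have "?A ** ?B = mat 1" by (simp add: vec_eq_iff forall_2 matrix_matrix_mult_def sum_2 mat_def)
  then have i: "inv\<^bsub>SL2\<^esub> ?A = ?B" using inv_unique'[OF A] by (auto simp: SL2_def matrix_left_right_inverse)
  have "c7 (inverse x) = ?A ** c7 x ** ?B"
    by (simp add: c7_def vec_eq_iff forall_2 matrix_matrix_mult_def sum_2)
  then show ?thesis using A(1) i by (intro bexI[of _ ?A]) (simp_all add: SL2_def)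
qed


section \<open>\<open>V(g, \<chi>)\<close> is a Yetter-Drinfeld module\<close>

lemma lookup_smult: "Poly_Mapping.lookup (Poly_Mapping.map ((*) (a::'k::field)) p) m = a * Poly_Mapping.lookup p m"
  by (simp add: Poly_Mapping.map.rep_eq when_def)

lemma module_monoid_algebra: "Module.module scalars (monoid_algebra M :: ('k::field, 'm \<Rightarrow>\<^sub>0 'k) Module.module)"
proof (rule moduleI)
  let ?A = "monoid_algebra M :: ('k, 'm \<Rightarrow>\<^sub>0 'k) Module.module"
  show "cring (scalars :: 'k ring)" by (rule cring_from_type_algebra)
  show "abelian_group ?A"
  proof (rule abelian_groupI)
    fix u v assume "u \<in> carrier ?A" "v \<in> carrier ?A"
    then show "u \<oplus>\<^bsub>?A\<^esub> v \<in> carrier ?A"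
      using Poly_Mapping.keys_add[of u v] by (auto simp: monoid_algebra_def)
  next
    fix u assume "u \<in> carrier ?A"
    then show "\<exists>v\<in>carrier ?A. v \<oplus>\<^bsub>?A\<^esub> u = \<zero>\<^bsub>?A\<^esub>"
      by (intro bexI[of _ "- u"]) (auto simp: monoid_algebra_def)
  qed (auto simp: monoid_algebra_def add_ac)
qed (auto simp: monoid_algebra_def in_keys_iff lookup_smult lookup_add subset_iff distrib_left distrib_right mult.assoc
      intro!: poly_mapping_eqI)

lemma lin_span_submodule:
  assumes "Module.module scalars V" "S \<subseteq> carrier V"
  shows "submodule (lin_span V S) scalars V" "S \<subseteq> lin_span V S"
proof -
  interpret Module.module scalars V by fact
  let ?F = "{U. submodule U scalars V \<and> S \<subseteq> U}"
  have c: "carrier V \<in> ?F" using carrier_is_submodule assms by auto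
  show "submodule (lin_span V S) scalars V" unfolding lin_span_def
  proof (rule submoduleI)
    show "\<Inter> ?F \<subseteq> carrier V" using c by blast
    show "\<zero>\<^bsub>V\<^esub> \<in> \<Inter> ?F" 
      by (auto simp: submodule_def dest!: subgroup.one_closed)
    show "\<ominus>\<^bsub>V\<^esub> a \<in> \<Inter> ?F" if "a \<in> \<Inter> ?F" for a
      using that submoduleE(3) by blast
    show "a \<oplus>\<^bsub>V\<^esub> b \<in> \<Inter> ?F" if "a \<in> \<Inter> ?F" "b \<in> \<Inter> ?F" for a b
      using that submoduleE(5) by blast
    show "a \<odot>\<^bsub>V\<^esub> b \<in> \<Inter> ?F" if "a \<in> carrier scalars" "b \<in> \<Inter> ?F" for a b
      using that submoduleE(4) by blast
  qed
  show "S \<subseteq> lin_span V S" by (auto simp: lin_span_def)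
qed

lemma lin_span_minimal: "submodule U scalars V \<Longrightarrow> S \<subseteq> U \<Longrightarrow> lin_span V S \<subseteq> U"
  by (auto simp: lin_span_def)

locale quotient_space = Module.module scalars A for A :: "('k::field, 'v, 'm) module_scheme" +
  fixes U assumes sub: "submodule U scalars A"
begin

abbreviation (input) "Q \<equiv> quot_module A U"

lemma ab: "abelian_subgroup U A"
  using sub by (auto intro!: abelian_subgroupI3 additive_subgroup.intro abelian_group_axioms simp: submodule_def)

sublocale U: abelian_subgroup U A by (rule ab)

lemma quot_carrier: "carrier Q = (\<lambda>p. U +>\<^bsub>A\<^esub> p) ` carrier A"
  by (auto simp: quot_module_def FactRing_simps)

lemma quot_add: "p \<in> carrier A \<Longrightarrow> r \<in> carrier A \<Longrightarrow> (U +>\<^bsub>A\<^esub> p) \<oplus>\<^bsub>Q\<^esub> (U +>\<^bsub>A\<^esub> r) = U +>\<^bsub>A\<^esub> (p \<oplus>\<^bsub>A\<^esub> r)"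
  by (simp add: quot_module_def FactRing_def U.a_rcos_sum)

lemma coset_eq: "p \<in> carrier A \<Longrightarrow> r \<in> carrier A \<Longrightarrow> (U +>\<^bsub>A\<^esub> p) = (U +>\<^bsub>A\<^esub> r) \<longleftrightarrow> p \<ominus>\<^bsub>A\<^esub> r \<in> U"
proof -
  assume pr: "p \<in> carrier A" "r \<in> carrier A"
  have sg: "subgroup U (add_monoid A)" using sub by (simp add: submodule_def)
  show ?thesis
  proof
    assume "U +>\<^bsub>A\<^esub> p = U +>\<^bsub>A\<^esub> r"
    then have "p \<in> U +>\<^bsub>A\<^esub> r" using U.a_rcos_self pr by blast
    then obtain h where h: "h \<in> U" "p = h \<oplus>\<^bsub>A\<^esub> r" by (auto simp: a_r_coset_defs)
    then have "h \<in> carrier A" using U.a_subset by auto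
    then show "p \<ominus>\<^bsub>A\<^esub> r \<in> U" using h pr by (simp add: a_minus_def M.a_assoc M.r_neg)
  next
    assume a: "p \<ominus>\<^bsub>A\<^esub> r \<in> U"
    have "p = (p \<ominus>\<^bsub>A\<^esub> r) \<oplus>\<^bsub>A\<^esub> r" using pr by (simp add: a_minus_def M.a_assoc M.l_neg)
    then have "p \<in> U +>\<^bsub>A\<^esub> r" using a by (auto simp: a_r_coset_defs)
    then show "U +>\<^bsub>A\<^esub> p = U +>\<^bsub>A\<^esub> r" using M.a_repr_independence pr sg by blast
  qed
qed

lemma coset_mem: "p \<in> carrier A \<Longrightarrow> r \<in> (U +>\<^bsub>A\<^esub> p) \<Longrightarrow> r \<in> carrier A \<and> (U +>\<^bsub>A\<^esub> r) = (U +>\<^bsub>A\<^esub> p)"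
proof -
  assume pr: "p \<in> carrier A" "r \<in> (U +>\<^bsub>A\<^esub> p)"
  have sg: "subgroup U (add_monoid A)" using sub by (simp add: submodule_def)
  have "r \<in> carrier A" using pr U.a_subset by (auto simp: a_r_coset_defs)
  then show ?thesis using M.a_repr_independence[OF pr(2,1) sg] by auto
qed

lemma quot_zero: "\<zero>\<^bsub>Q\<^esub> = U +>\<^bsub>A\<^esub> \<zero>\<^bsub>A\<^esub>"
  by (simp add: quot_module_def FactRing_def U.a_subset)

lemma lift_coset:
  assumes "\<And>p. p \<in> carrier A \<Longrightarrow> f p \<in> carrier A"
    and "\<And>p r. p \<in> carrier A \<Longrightarrow> r \<in> carrier A \<Longrightarrow> p \<ominus>\<^bsub>A\<^esub> r \<in> U \<Longrightarrow> f p \<ominus>\<^bsub>A\<^esub> f r \<in> U"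
    and "p \<in> carrier A"
  shows "(\<Union>u\<in>U +>\<^bsub>A\<^esub> p. U +>\<^bsub>A\<^esub> f u) = U +>\<^bsub>A\<^esub> f p"
proof -
  have "U +>\<^bsub>A\<^esub> f u = U +>\<^bsub>A\<^esub> f p" if "u \<in> U +>\<^bsub>A\<^esub> p" for u
  proof -
    from coset_mem[OF assms(3) that] have u: "u \<in> carrier A" "U +>\<^bsub>A\<^esub> u = U +>\<^bsub>A\<^esub> p" by auto
    then have "u \<ominus>\<^bsub>A\<^esub> p \<in> U" using coset_eq[OF u(1) assms(3)] by blast
    then have "f u \<ominus>\<^bsub>A\<^esub> f p \<in> U" using assms(2)[OF u(1) assms(3)] by blast
    then show ?thesis using coset_eq[OF assms(1)[OF u(1)] assms(1)[OF assms(3)]] by blast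
  qed
  moreover have "p \<in> U +>\<^bsub>A\<^esub> p" using assms U.a_rcos_self by auto
  ultimately show ?thesis by blast
qed

lemma quot_smult: "p \<in> carrier A \<Longrightarrow> a \<odot>\<^bsub>Q\<^esub> (U +>\<^bsub>A\<^esub> p) = U +>\<^bsub>A\<^esub> (a \<odot>\<^bsub>A\<^esub> p)"
proof -
  have "a \<odot>\<^bsub>A\<^esub> p \<ominus>\<^bsub>A\<^esub> a \<odot>\<^bsub>A\<^esub> r = a \<odot>\<^bsub>A\<^esub> (p \<ominus>\<^bsub>A\<^esub> r)" if "p \<in> carrier A" "r \<in> carrier A" for p r
  proof -
    have "a \<odot>\<^bsub>A\<^esub> (p \<oplus>\<^bsub>A\<^esub> \<ominus>\<^bsub>A\<^esub> r) = a \<odot>\<^bsub>A\<^esub> p \<oplus>\<^bsub>A\<^esub> a \<odot>\<^bsub>A\<^esub> (\<ominus>\<^bsub>A\<^esub> r)"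
      by (rule smult_r_distr) (use that in auto)
    also have "a \<odot>\<^bsub>A\<^esub> (\<ominus>\<^bsub>A\<^esub> r) = \<ominus>\<^bsub>A\<^esub> (a \<odot>\<^bsub>A\<^esub> r)" by (rule smult_r_minus) (use that in auto)
    finally show ?thesis unfolding a_minus_def by (rule sym)
  qed
  note d = this
  assume p: "p \<in> carrier A"
  have c: "a \<odot>\<^bsub>A\<^esub> s \<in> carrier A" if "s \<in> carrier A" for s
    using that smult_closed[of a s] by simp
  have "(\<Union>u\<in>U +>\<^bsub>A\<^esub> p. U +>\<^bsub>A\<^esub> (a \<odot>\<^bsub>A\<^esub> u)) = U +>\<^bsub>A\<^esub> (a \<odot>\<^bsub>A\<^esub> p)"
  proof (rule lift_coset[OF c _ p])
    fix p r assume "p \<in> carrier A" "r \<in> carrier A" "p \<ominus>\<^bsub>A\<^esub> r \<in> U"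
    then show "a \<odot>\<^bsub>A\<^esub> p \<ominus>\<^bsub>A\<^esub> a \<odot>\<^bsub>A\<^esub> r \<in> U"
      using d submodule.smult_closed[OF sub, of a] by (metis UNIV_I scalars_simps(1))
  qed
  then show "a \<odot>\<^bsub>Q\<^esub> (U +>\<^bsub>A\<^esub> p) = U +>\<^bsub>A\<^esub> (a \<odot>\<^bsub>A\<^esub> p)" by (simp add: quot_module_def)
qed

lemma quot_cases: "C \<in> carrier Q \<Longrightarrow> (\<And>p. p \<in> carrier A \<Longrightarrow> C = U +>\<^bsub>A\<^esub> p \<Longrightarrow> P) \<Longrightarrow> P"
  using quot_carrier by blast

lemma quot_mem: "p \<in> carrier A \<Longrightarrow> U +>\<^bsub>A\<^esub> p \<in> carrier Q"
  using quot_carrier by blast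

lemma quot_ex: "C \<in> carrier Q \<Longrightarrow> \<exists>p. p \<in> carrier A \<and> C = U +>\<^bsub>A\<^esub> p"
  using quot_carrier by blast

lemma abelian_quot: "abelian_group Q"
proof (rule abelian_groupI)
  show "\<zero>\<^bsub>Q\<^esub> \<in> carrier Q" unfolding quot_zero by (rule quot_mem) (rule M.zero_closed)
next
  fix x assume "x \<in> carrier Q"
  then obtain p where p: "p \<in> carrier A" "x = U +>\<^bsub>A\<^esub> p" using quot_ex by blast
  have "(U +>\<^bsub>A\<^esub> (\<ominus>\<^bsub>A\<^esub> p)) \<oplus>\<^bsub>Q\<^esub> x = \<zero>\<^bsub>Q\<^esub>"
    unfolding p(2) quot_zero using quot_add[of "\<ominus>\<^bsub>A\<^esub> p" p] p(1) M.l_neg[OF p(1)] M.a_inv_closed by simp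
  then show "\<exists>y\<in>carrier Q. y \<oplus>\<^bsub>Q\<^esub> x = \<zero>\<^bsub>Q\<^esub>" using quot_mem p(1) M.a_inv_closed by blast
next
  fix x y assume "x \<in> carrier Q" "y \<in> carrier Q"
  then obtain p r where p: "p \<in> carrier A" "x = U +>\<^bsub>A\<^esub> p" and r: "r \<in> carrier A" "y = U +>\<^bsub>A\<^esub> r"
    using quot_ex by meson
  show "x \<oplus>\<^bsub>Q\<^esub> y \<in> carrier Q" using p r quot_add quot_mem M.a_closed by metis
  show "x \<oplus>\<^bsub>Q\<^esub> y = y \<oplus>\<^bsub>Q\<^esub> x" using p r quot_add M.a_comm by metis
  fix z assume "z \<in> carrier Q"
  then obtain t where t: "t \<in> carrier A" "z = U +>\<^bsub>A\<^esub> t" using quot_ex by meson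
  show "x \<oplus>\<^bsub>Q\<^esub> y \<oplus>\<^bsub>Q\<^esub> z = x \<oplus>\<^bsub>Q\<^esub> (y \<oplus>\<^bsub>Q\<^esub> z)"
    unfolding p(2) r(2) t(2) using p(1) r(1) t(1) by (simp only: quot_add M.a_closed M.a_assoc)
next
  fix x assume "x \<in> carrier Q"
  then obtain p where p: "p \<in> carrier A" "x = U +>\<^bsub>A\<^esub> p" using quot_ex by blast
  show "\<zero>\<^bsub>Q\<^esub> \<oplus>\<^bsub>Q\<^esub> x = x"
    unfolding p(2) quot_zero using p(1) by (simp only: quot_add M.zero_closed M.l_zero)
qed

lemma module_quot: "Module.module scalars Q"
proof (rule moduleI)
  show "cring (scalars :: 'k ring)" by (rule cring_from_type_algebra)
  show "abelian_group Q" by (rule abelian_quot)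
next
  fix a b :: 'k and x y assume "x \<in> carrier Q" "y \<in> carrier Q"
  then obtain p r where p: "p \<in> carrier A" "x = U +>\<^bsub>A\<^esub> p" and r: "r \<in> carrier A" "y = U +>\<^bsub>A\<^esub> r"
    using quot_ex by meson
  have c: "c \<odot>\<^bsub>A\<^esub> s \<in> carrier A" if "s \<in> carrier A" for c s
    using that smult_closed[of c s] by simp
  show "a \<odot>\<^bsub>Q\<^esub> x \<in> carrier Q"
    unfolding p(2) quot_smult[OF p(1)] by (rule quot_mem[OF c[OF p(1)]])
  show "(a \<oplus>\<^bsub>scalars\<^esub> b) \<odot>\<^bsub>Q\<^esub> x = a \<odot>\<^bsub>Q\<^esub> x \<oplus>\<^bsub>Q\<^esub> b \<odot>\<^bsub>Q\<^esub> x"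
    unfolding p(2) quot_smult[OF p(1)] quot_add[OF c[OF p(1)] c[OF p(1)]]
    using smult_l_distr[of a b p] p(1) by simp
  show "a \<odot>\<^bsub>Q\<^esub> (x \<oplus>\<^bsub>Q\<^esub> y) = a \<odot>\<^bsub>Q\<^esub> x \<oplus>\<^bsub>Q\<^esub> a \<odot>\<^bsub>Q\<^esub> y"
    unfolding p(2) r(2) quot_smult[OF p(1)] quot_smult[OF r(1)] quot_add[OF c[OF p(1)] c[OF r(1)]]
      quot_add[OF p(1) r(1)] quot_smult[OF M.a_closed[OF p(1) r(1)]]
    using smult_r_distr[of a p r] p(1) r(1) by simp
  show "(a \<otimes>\<^bsub>scalars\<^esub> b) \<odot>\<^bsub>Q\<^esub> x = a \<odot>\<^bsub>Q\<^esub> (b \<odot>\<^bsub>Q\<^esub> x)"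
    unfolding p(2) quot_smult[OF p(1)] quot_smult[OF c[OF p(1)]]
    using smult_assoc1[of a b p] p(1) by simp
next
  fix x assume "x \<in> carrier Q"
  then obtain p where p: "p \<in> carrier A" "x = U +>\<^bsub>A\<^esub> p" using quot_ex by blast
  show "\<one>\<^bsub>scalars\<^esub> \<odot>\<^bsub>Q\<^esub> x = x"
    unfolding p(2) quot_smult[OF p(1)] using smult_one[OF p(1)] by simp
qed

definition "descend f = (\<lambda>C. \<Union>u\<in>C. U +>\<^bsub>A\<^esub> f u)"

lemma linear_minus:
  assumes "linear_map A A f" "p \<in> carrier A" "r \<in> carrier A"
  shows "f (p \<ominus>\<^bsub>A\<^esub> r) = f p \<ominus>\<^bsub>A\<^esub> f r" "f p \<in> carrier A"
proof -
  show c: "f p \<in> carrier A" using assms by (auto simp: linear_map_def)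
  have c': "f r \<in> carrier A" using assms by (auto simp: linear_map_def)
  have m: "\<ominus>\<^bsub>A\<^esub> s = (- 1) \<odot>\<^bsub>A\<^esub> s" if s: "s \<in> carrier A" for s
  proof -
    have cl: "(- 1) \<odot>\<^bsub>A\<^esub> s \<in> carrier A" using smult_closed[of "-1" s] s by simp
    have "(- 1) \<odot>\<^bsub>A\<^esub> s \<oplus>\<^bsub>A\<^esub> s = (- 1 + 1) \<odot>\<^bsub>A\<^esub> s"
      using smult_l_distr[of "- 1" 1 s] s smult_one[OF s] by simp
    also have "\<dots> = \<zero>\<^bsub>A\<^esub>" using smult_l_null[OF s] by simp
    finally show ?thesis using M.minus_equality[OF _ s cl] by simp
  qed
  have "f (\<ominus>\<^bsub>A\<^esub> r) = \<ominus>\<^bsub>A\<^esub> (f r)"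
    using assms m[OF assms(3)] m[OF c'] by (auto simp: linear_map_def)
  then show "f (p \<ominus>\<^bsub>A\<^esub> r) = f p \<ominus>\<^bsub>A\<^esub> f r"
    unfolding a_minus_def using assms M.a_inv_closed[OF assms(3)] by (auto simp: linear_map_def)
qed

lemma descend:
  assumes f: "linear_map A A f" and fU: "f ` U \<subseteq> U"
  shows "\<And>p. p \<in> carrier A \<Longrightarrow> descend f (U +>\<^bsub>A\<^esub> p) = U +>\<^bsub>A\<^esub> f p"
    and "linear_map Q Q (descend f)"
proof -
  note fc = linear_minus(2)[OF f _ M.zero_closed]
  show d: "descend f (U +>\<^bsub>A\<^esub> p) = U +>\<^bsub>A\<^esub> f p" if p: "p \<in> carrier A" for p
    unfolding descend_def
  proof (rule lift_coset[OF fc _ p])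
    fix p r assume "p \<in> carrier A" "r \<in> carrier A" "p \<ominus>\<^bsub>A\<^esub> r \<in> U"
    then show "f p \<ominus>\<^bsub>A\<^esub> f r \<in> U" using linear_minus(1)[OF f, symmetric] fU by fastforce
  qed
  show "linear_map Q Q (descend f)"
    unfolding linear_map_def
  proof (intro conjI ballI allI funcsetI)
    fix x assume "x \<in> carrier Q"
    then obtain p where p: "p \<in> carrier A" "x = U +>\<^bsub>A\<^esub> p" using quot_ex by blast
    show "descend f x \<in> carrier Q" unfolding p(2) d[OF p(1)] by (rule quot_mem[OF fc[OF p(1)]])
    { fix y assume "y \<in> carrier Q"
      then obtain r where r: "r \<in> carrier A" "y = U +>\<^bsub>A\<^esub> r" using quot_ex by blast
      show "descend f (x \<oplus>\<^bsub>Q\<^esub> y) = descend f x \<oplus>\<^bsub>Q\<^esub> descend f y"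
        unfolding p(2) r(2) quot_add[OF p(1) r(1)] d[OF p(1)] d[OF r(1)] d[OF M.a_closed[OF p(1) r(1)]]
          quot_add[OF fc[OF p(1)] fc[OF r(1)]] using f p(1) r(1) by (simp add: linear_map_def) }
    fix a :: 'k
    have c: "a \<odot>\<^bsub>A\<^esub> p \<in> carrier A" using p(1) smult_closed[of a p] by simp
    show "descend f (a \<odot>\<^bsub>Q\<^esub> x) = a \<odot>\<^bsub>Q\<^esub> descend f x"
      unfolding p(2) quot_smult[OF p(1)] d[OF p(1)] d[OF c] quot_smult[OF fc[OF p(1)]]
      using f p(1) by (simp add: linear_map_def)
  qed
qed

end

lemma linear_map_span:
  assumes V: "Module.module scalars V" and W: "Module.module scalars W" and f: "linear_map V W f"
    and S: "S \<subseteq> carrier V" and U: "submodule U scalars W" and fS: "f ` S \<subseteq> U"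
  shows "f ` lin_span V S \<subseteq> U"
proof -
  interpret V: Module.module scalars V by fact
  interpret W: Module.module scalars W by fact
  let ?P = "{v \<in> carrier V. f v \<in> U}"
  have z: "f \<zero>\<^bsub>V\<^esub> = \<zero>\<^bsub>W\<^esub>"
  proof -
    have "f (0 \<odot>\<^bsub>V\<^esub> \<zero>\<^bsub>V\<^esub>) = 0 \<odot>\<^bsub>W\<^esub> f \<zero>\<^bsub>V\<^esub>" using f V.M.zero_closed unfolding linear_map_def by blast
    moreover have "f \<zero>\<^bsub>V\<^esub> \<in> carrier W" using f by (auto simp: linear_map_def)
    ultimately show ?thesis using V.smult_l_null[of "\<zero>\<^bsub>V\<^esub>"] W.smult_l_null[of "f \<zero>\<^bsub>V\<^esub>"] by simp
  qed
  note UE = W.submoduleE[OF U]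
  have "submodule ?P scalars V"
  proof (rule V.submoduleI)
    show "\<zero>\<^bsub>V\<^esub> \<in> ?P" using z submodule.axioms(1)[OF U] subgroup.one_closed by fastforce
    fix a assume a: "a \<in> ?P"
    have sm: "c \<odot>\<^bsub>V\<^esub> a \<in> ?P" for c
      using a V.smult_closed[of c a] UE(4)[of c "f a"] f by (auto simp: linear_map_def)
    then show "c \<odot>\<^bsub>V\<^esub> a \<in> ?P" for c .
    have "\<ominus>\<^bsub>V\<^esub> a = (- 1) \<odot>\<^bsub>V\<^esub> a"
    proof -
      have ac: "a \<in> carrier V" using a by auto
      have cl: "(- 1) \<odot>\<^bsub>V\<^esub> a \<in> carrier V" using V.smult_closed[of "-1" a] ac by simp
      have "(- 1) \<odot>\<^bsub>V\<^esub> a \<oplus>\<^bsub>V\<^esub> a = (- 1 + 1) \<odot>\<^bsub>V\<^esub> a"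
        using V.smult_l_distr[of "- 1" 1 a] ac V.smult_one[OF ac] by simp
      also have "\<dots> = \<zero>\<^bsub>V\<^esub>" using V.smult_l_null[OF ac] by simp
      finally show ?thesis using V.M.minus_equality[OF _ ac cl] by simp
    qed
    then show "\<ominus>\<^bsub>V\<^esub> a \<in> ?P" using sm by simp
    show "a \<oplus>\<^bsub>V\<^esub> b \<in> ?P" if "b \<in> ?P" for b
      using a that UE(5)[of "f a" "f b"] f by (auto simp: linear_map_def)
  qed auto
  then show ?thesis using lin_span_minimal[of ?P V S] S fS by auto
qed

lemma linear_map_finsum:
  assumes V: "Module.module scalars V" and W: "Module.module scalars W" and f: "linear_map V W f"
    and "finite I" "s \<in> I \<rightarrow> carrier V"
  shows "f (\<Oplus>\<^bsub>V\<^esub>i\<in>I. s i) = (\<Oplus>\<^bsub>W\<^esub>i\<in>I. f (s i))"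
proof -
  interpret V: Module.module scalars V by fact
  interpret W: Module.module scalars W by fact
  have z: "f \<zero>\<^bsub>V\<^esub> = \<zero>\<^bsub>W\<^esub>"
  proof -
    have "f (0 \<odot>\<^bsub>V\<^esub> \<zero>\<^bsub>V\<^esub>) = 0 \<odot>\<^bsub>W\<^esub> f \<zero>\<^bsub>V\<^esub>" using f V.M.zero_closed unfolding linear_map_def by blast
    moreover have "f \<zero>\<^bsub>V\<^esub> \<in> carrier W" using f by (auto simp: linear_map_def)
    ultimately show ?thesis using V.smult_l_null[of "\<zero>\<^bsub>V\<^esub>"] W.smult_l_null[of "f \<zero>\<^bsub>V\<^esub>"] by simp
  qed
  have fc: "f v \<in> carrier W" if "v \<in> carrier V" for v using f that by (auto simp: linear_map_def)
  show ?thesis using assms(4,5)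
  proof (induction I rule: finite_induct)
    case empty
    then show ?case using z by simp
  next
    case (insert i I)
    have s: "s \<in> I \<rightarrow> carrier V" "s i \<in> carrier V" using insert by auto
    have "f (\<Oplus>\<^bsub>V\<^esub>i\<in>insert i I. s i) = f (s i \<oplus>\<^bsub>V\<^esub> (\<Oplus>\<^bsub>V\<^esub>i\<in>I. s i))"
      using V.M.finsum_insert[OF insert(1,2) s] by simp
    also have "\<dots> = f (s i) \<oplus>\<^bsub>W\<^esub> f (\<Oplus>\<^bsub>V\<^esub>i\<in>I. s i)"
      using f s V.M.finsum_closed[OF s(1)] unfolding linear_map_def by blast
    also have "\<dots> = (\<Oplus>\<^bsub>W\<^esub>i\<in>insert i I. f (s i))"
    proof -
      have "(\<lambda>i. f (s i)) \<in> I \<rightarrow> carrier W" using s fc by auto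
      then show ?thesis
        using insert.IH[OF s(1)] W.M.finsum_insert[OF insert(1,2), of "\<lambda>i. f (s i)"] s fc by simp
    qed
    finally show ?case .
  qed
qed

definition "same_vs V W \<longleftrightarrow> carrier V = carrier W \<and> add V = add W \<and> zero V = zero W \<and>
   Module.smult V = Module.smult W"

lemma same_module: assumes "same_vs V W" "Module.module scalars W" shows "Module.module scalars V"
proof -
  interpret W: Module.module scalars W by fact
  note s = assms(1)[unfolded same_vs_def]
  show ?thesis
  proof (rule moduleI)
    show "cring scalars" by (rule cring_from_type_algebra)
    show "abelian_group V"
    proof (rule abelian_groupI)
      fix v assume "v \<in> carrier V"
      then show "\<exists>w\<in>carrier V. w \<oplus>\<^bsub>V\<^esub> v = \<zero>\<^bsub>V\<^esub>" using s W.M.l_neg[of v] W.M.a_inv_closed[of v] by auto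
    qed (use s W.M.a_comm W.M.a_assoc in auto)
  qed (use s W.smult_l_distr W.smult_r_distr W.smult_assoc1 W.smult_one W.smult_closed in auto)
qed

lemma same_submodule: assumes "same_vs V W" "Module.module scalars W" "submodule U scalars W" 
  shows "submodule U scalars V"
proof -
  interpret W: Module.module scalars W by fact
  interpret V: Module.module scalars V using same_module assms by blast
  note s = assms(1)[unfolded same_vs_def]
  note E = W.submoduleE[OF assms(3)]
  show ?thesis
  proof (rule V.submoduleI)
    show "\<zero>\<^bsub>V\<^esub> \<in> U" using s submodule.axioms(1)[OF assms(3)] subgroup.one_closed by fastforce
    fix a assume a: "a \<in> U"
    have "\<ominus>\<^bsub>V\<^esub> a = \<ominus>\<^bsub>W\<^esub> a" using a s E(1) W.M.l_neg[of a] W.M.a_inv_closed[of a]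
      V.M.minus_equality[of "\<ominus>\<^bsub>W\<^esub> a" a] by auto
    then show "\<ominus>\<^bsub>V\<^esub> a \<in> U" using E(3) a by simp
  qed (use s E in auto)
qed

lemma same_finsum: assumes "same_vs V W" shows "finsum V f I = finsum W f I"
  using assms by (simp add: finsum_def finprod_def same_vs_def)

lemma same_linear: assumes "same_vs V W" shows "linear_map V V f = linear_map W W f"
  using assms by (simp add: linear_map_def same_vs_def)


locale yd_setup = G: group G for G :: "('g, 'b) monoid_scheme" (structure) +
  fixes g :: 'g and chi :: "'g \<Rightarrow> 'k::field"
  assumes fin: "finite (carrier G)" and g: "g \<in> carrier G"
begin

abbreviation (input) "A \<equiv> monoid_algebra G :: ('k, 'g \<Rightarrow>\<^sub>0 'k) Module.module"
abbreviation (input) "Z \<equiv> centralizer G g"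
abbreviation (input) "R \<equiv> induced_relations G Z chi"
abbreviation (input) "Q \<equiv> induced_module G Z chi"
abbreviation (input) "V \<equiv> yd_induced G g chi"
abbreviation (input) "cls h \<equiv> {t \<in> carrier G. t \<otimes> g \<otimes> inv t = h}"
abbreviation (input) "sg \<equiv> Poly_Mapping.single"
abbreviation (input) "lk \<equiv> Poly_Mapping.lookup"

lemma Asimps: "carrier A = {p. Poly_Mapping.keys p \<subseteq> carrier G}" "zero A = 0" "add A = (+)"
  "Module.smult A a = Poly_Mapping.map ((*) a)"
  by (auto simp: monoid_algebra_def)

sublocale A: Module.module scalars A by (rule module_monoid_algebra)

lemma sgA: "t \<in> carrier G \<Longrightarrow> sg t c \<in> carrier A"
  by (auto simp: Asimps)

lemma Aminus: "p \<in> carrier A \<Longrightarrow> r \<in> carrier A \<Longrightarrow> p - r \<in> carrier A"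
  using keys_diff[of p r] by (auto simp: Asimps)

definition reix :: "'g set \<Rightarrow> ('g \<Rightarrow> 'g) \<Rightarrow> ('g \<Rightarrow>\<^sub>0 'k) \<Rightarrow> ('g \<Rightarrow>\<^sub>0 'k)"
  where "reix I \<phi> p = (\<Sum>b\<in>I. sg (\<phi> b) (lk p b))"

lemma reix_linear:
  assumes I: "I \<subseteq> carrier G" "\<phi> ` I \<subseteq> carrier G"
  shows "linear_map A A (reix I \<phi>)"
proof -
  have fI: "finite I" using I fin finite_subset by blast
  have "lk (reix I \<phi> (Poly_Mapping.map ((*) a) p)) m = lk (Poly_Mapping.map ((*) a) (reix I \<phi> p)) m" for a p m
    by (simp add: reix_def lookup_sum lookup_smult lookup_single when_def sum_distrib_left if_distrib cong: if_cong)
  then have sm: "reix I \<phi> (Poly_Mapping.map ((*) a) p) = Poly_Mapping.map ((*) a) (reix I \<phi> p)" for a p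
    by (intro poly_mapping_eqI)
  have "Poly_Mapping.keys (reix I \<phi> p) \<subseteq> carrier G" for p
  proof -
    have "Poly_Mapping.keys (reix I \<phi> p) \<subseteq> (\<Union>b\<in>I. Poly_Mapping.keys (sg (\<phi> b) (lk p b)))"
      unfolding reix_def by (rule keys_sum)
    also have "\<dots> \<subseteq> carrier G" using I by (auto split: if_splits)
    finally show ?thesis .
  qed
  then show ?thesis using sm
    by (auto simp: linear_map_def Asimps) (simp add: reix_def lookup_add single_add sum.distrib)
qed

lemma reix_single:
  assumes "finite I" shows "reix I \<phi> (sg m c) = (if m \<in> I then sg (\<phi> m) c else 0)"
proof -
  have "reix I \<phi> (sg m c) = (\<Sum>b\<in>I. if m = b then sg (\<phi> b) c else 0)"
    unfolding reix_def by (intro sum.cong) (auto simp: lookup_single when_def)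
  also have "\<dots> = (if m \<in> I then sg (\<phi> m) c else 0)" using assms by (simp add: sum.delta)
  finally show ?thesis .
qed

lemma reix_diff: "reix I \<phi> (p - r) = reix I \<phi> p - reix I \<phi> r"
  by (simp add: reix_def lookup_minus single_diff sum_subtractf)

abbreviation (input) "gens \<equiv> {sg (h \<otimes> z) 1 - sg h (chi z) | h z. h \<in> carrier G \<and> z \<in> Z}"

lemma gensA: "gens \<subseteq> carrier A"
  using sgA Aminus by (auto simp: centralizer_def)

lemma R_sub: "submodule R scalars A" and gensR: "gens \<subseteq> R"
  unfolding induced_relations_def using lin_span_submodule[OF module_monoid_algebra gensA] by auto

sublocale q: quotient_space A R by (intro quotient_space.intro quotient_space_axioms.intro module_monoid_algebra R_sub)

lemma Q_eq: "Q = q.Q" by (simp add: induced_module_def)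

definition "lm a = reix (carrier G) (\<lambda>b. a \<otimes> b)"
definition "pr h = reix (cls h) (\<lambda>b. b)"

lemma lm_linear: "a \<in> carrier G \<Longrightarrow> linear_map A A (lm a)"
  unfolding lm_def by (rule reix_linear) auto

lemma pr_linear: "linear_map A A (pr h)"
  unfolding pr_def by (rule reix_linear) auto

lemma lm_single: "t \<in> carrier G \<Longrightarrow> lm a (sg t c) = sg (a \<otimes> t) c"
  by (simp add: lm_def reix_single fin)

lemma fcls: "finite (cls h)" using fin by auto

lemma pr_single: "t \<in> carrier G \<Longrightarrow> pr h (sg t c) = (if t \<otimes> g \<otimes> inv t = h then sg t c else 0)"
  by (simp add: pr_def reix_single fcls)

lemma lmR: assumes a: "a \<in> carrier G" shows "lm a ` R \<subseteq> R"
proof -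
  have "lm a ` gens \<subseteq> R"
  proof safe
    fix h z assume h: "h \<in> carrier G" "z \<in> Z"
    then have z: "z \<in> carrier G" by (simp add: centralizer_def)
    have "lm a (sg (h \<otimes> z) 1 - sg h (chi z)) = sg ((a \<otimes> h) \<otimes> z) 1 - sg (a \<otimes> h) (chi z)"
      using a h z lm_single[of "h \<otimes> z" a 1] lm_single[of h a "chi z"] by (simp add: lm_def reix_diff G.m_assoc)
    then show "lm a (sg (h \<otimes> z) 1 - sg h (chi z)) \<in> R" using gensR a h by blast
  qed
  then show ?thesis
    using linear_map_span[OF module_monoid_algebra module_monoid_algebra lm_linear[OF a] gensA R_sub]
    unfolding induced_relations_def by blast
qed

lemma prR: shows "pr k ` R \<subseteq> R"
proof -
  have R0: "0 \<in> R" using submodule.axioms(1)[OF R_sub] subgroup.one_closed by (fastforce simp: Asimps)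
  have "pr k ` gens \<subseteq> R"
  proof safe
    fix h z assume h: "h \<in> carrier G" "z \<in> Z"
    then have z: "z \<in> carrier G" "z \<otimes> g = g \<otimes> z" by (auto simp: centralizer_def)
    have "(h \<otimes> z) \<otimes> g \<otimes> inv (h \<otimes> z) = h \<otimes> (z \<otimes> g \<otimes> inv z) \<otimes> inv h"
      using h z(1) g by (simp add: G.inv_mult_group G.m_assoc)
    also have "z \<otimes> g \<otimes> inv z = g" using z g by (simp add: G.m_assoc)
    finally have e: "(h \<otimes> z) \<otimes> g \<otimes> inv (h \<otimes> z) = h \<otimes> g \<otimes> inv h" .
    have "pr k (sg (h \<otimes> z) 1 - sg h (chi z)) = pr k (sg (h \<otimes> z) 1) - pr k (sg h (chi z))"
      by (simp add: pr_def reix_diff)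
    then show "pr k (sg (h \<otimes> z) 1 - sg h (chi z)) \<in> R"
      using gensR R0 h z(1) e by (auto simp: pr_single)
  qed
  then show ?thesis
    using linear_map_span[OF module_monoid_algebra module_monoid_algebra pr_linear gensA R_sub]
    unfolding induced_relations_def by blast
qed

lemma Vsame: "same_vs V q.Q"
  by (simp add: same_vs_def yd_induced_def Let_def induced_module_def quot_module_def module.defs)


lemma Vmod: "Module.module scalars V"
  by (rule same_module[OF Vsame q.module_quot])

abbreviation (input) "el t \<equiv> R +>\<^bsub>A\<^esub> sg t 1"

lemma lm_eq: assumes "p \<in> carrier A" shows "sg a 1 \<otimes>\<^bsub>A\<^esub> p = lm a p"
proof -
  have "sg a 1 \<otimes>\<^bsub>A\<^esub> p = (\<Sum>b\<in>Poly_Mapping.keys p. sg (a \<otimes> b) (lk p b))"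
    by (simp add: monoid_algebra_def)
  also have "\<dots> = lm a p" unfolding lm_def reix_def
    using assms fin by (intro sum.mono_neutral_left) (auto simp: Asimps in_keys_iff)
  finally show ?thesis .
qed

lemma act_eq: "C \<in> carrier q.Q \<Longrightarrow> act V a C = q.descend (lm a) C"
proof -
  assume "C \<in> carrier q.Q"
  then obtain p where p: "p \<in> carrier A" "C = R +>\<^bsub>A\<^esub> p" using q.quot_ex by blast
  have "u \<in> carrier A" if "u \<in> C" for u using q.coset_mem that p by blast
  then have "(\<Union>p\<in>C. R +>\<^bsub>A\<^esub> (sg a 1 \<otimes>\<^bsub>A\<^esub> p)) = (\<Union>p\<in>C. R +>\<^bsub>A\<^esub> lm a p)"
    using lm_eq by (intro SUP_cong) auto
  then show ?thesis
    by (simp add: yd_induced_def Let_def q.descend_def module.defs)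
qed

lemma act_coset: "a \<in> carrier G \<Longrightarrow> p \<in> carrier A \<Longrightarrow> act V a (R +>\<^bsub>A\<^esub> p) = R +>\<^bsub>A\<^esub> lm a p"
  using act_eq q.descend(1)[OF lm_linear lmR] q.quot_mem by metis

lemma act_linear: "a \<in> carrier G \<Longrightarrow> linear_map V V (act V a)"
proof -
  assume a: "a \<in> carrier G"
  note l = q.descend(2)[OF lm_linear lmR, OF a a]
  interpret m: Module.module scalars q.Q by (rule q.module_quot)
  have "linear_map q.Q q.Q (act V a)"
    unfolding linear_map_def
  proof (intro conjI ballI allI funcsetI)
    fix u assume u: "u \<in> carrier q.Q"
    show "act V a u \<in> carrier q.Q" using l u act_eq[OF u] by (auto simp: linear_map_def)
    show "act V a (u \<oplus>\<^bsub>q.Q\<^esub> v) = act V a u \<oplus>\<^bsub>q.Q\<^esub> act V a v" if v: "v \<in> carrier q.Q" for v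
      using l u v act_eq[OF u] act_eq[OF v] act_eq[OF m.M.a_closed[OF u v]] by (auto simp: linear_map_def)
    fix c
    have "c \<odot>\<^bsub>q.Q\<^esub> u \<in> carrier q.Q" using m.smult_closed[of c u] u by simp
    then show "act V a (c \<odot>\<^bsub>q.Q\<^esub> u) = c \<odot>\<^bsub>q.Q\<^esub> act V a u"
      using l u act_eq[OF u] act_eq by (auto simp: linear_map_def)
  qed
  then show ?thesis using same_linear[OF Vsame] by blast
qed

lemma lk0: "p \<in> carrier A \<Longrightarrow> b \<notin> carrier G \<Longrightarrow> lk p b = 0"
  by (auto simp: Asimps in_keys_iff)

lemma A_induct: "p \<in> carrier A \<Longrightarrow> p = (\<Sum>b\<in>carrier G. sg b (lk p b))"
  by (intro poly_mapping_eqI) (auto simp: lookup_sum lookup_single when_def fin sum.delta' lk0)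

lemma reix_sum: "reix I \<phi> (sum s J) = (\<Sum>j\<in>J. reix I \<phi> (s j))"
proof (induction J rule: infinite_finite_induct)
  case (insert x F)
  have "reix I \<phi> (u + v) = reix I \<phi> u + reix I \<phi> v" for u v
    by (simp add: reix_def lookup_add single_add sum.distrib)
  then show ?case using insert by simp
qed (auto simp: reix_def)

lemma lm_one: "p \<in> carrier A \<Longrightarrow> lm \<one> p = p"
  using A_induct[of p] by (simp add: lm_def reix_def)

lemma lm_mult: "a \<in> carrier G \<Longrightarrow> b \<in> carrier G \<Longrightarrow> lm a (lm b p) = lm (a \<otimes> b) p"
proof -
  assume a: "a \<in> carrier G" "b \<in> carrier G"
  have "lm a (lm b p) = (\<Sum>c\<in>carrier G. lm a (sg (b \<otimes> c) (lk p c)))"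
    by (simp only: lm_def reix_sum reix_def[of _ "\<lambda>c. b \<otimes> c"])
  also have "\<dots> = lm (a \<otimes> b) p" unfolding lm_def[of "a \<otimes> b"] reix_def[of _ "\<lambda>c. (a \<otimes> b) \<otimes> c"]
    using a by (intro sum.cong) (auto simp: lm_single G.m_assoc)
  finally show ?thesis .
qed

lemma homog_eq: "homog V h = lin_span q.Q (el ` cls h)"
  by (simp add: yd_induced_def Let_def induced_module_def induced_elem_def module.defs)

lemma elQ: "el ` cls h \<subseteq> carrier q.Q" using q.quot_mem sgA by auto

lemma homog_sub: "submodule (homog V h) scalars q.Q"
  unfolding homog_eq by (rule lin_span_submodule(1)[OF q.module_quot elQ])

lemma homog_el: "t \<in> cls h \<Longrightarrow> el t \<in> homog V h"
  unfolding homog_eq using lin_span_submodule(2)[OF q.module_quot elQ] by blast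

lemma homogQ: "homog V h \<subseteq> carrier q.Q"
proof -
  interpret m: Module.module scalars q.Q by (rule q.module_quot)
  show ?thesis using m.submoduleE(1)[OF homog_sub] .
qed

abbreviation (input) "P h \<equiv> q.descend (pr h)"
lemmas P = q.descend[OF pr_linear prR]

lemma pr_closed: "p \<in> carrier A \<Longrightarrow> pr h p \<in> carrier A" using pr_linear[of h] unfolding linear_map_def by blast

lemma P_homog: assumes v: "v \<in> carrier q.Q" shows "P h v \<in> homog V h"
proof -
  interpret m: Module.module scalars q.Q by (rule q.module_quot)
  obtain p where p: "p \<in> carrier A" "v = R +>\<^bsub>A\<^esub> p" using q.quot_ex v by blast
  have "(R +>\<^bsub>A\<^esub> (\<Sum>b\<in>I. sg b (lk p b))) \<in> homog V h \<and> (\<Sum>b\<in>I. sg b (lk p b)) \<in> carrier A"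
    if "finite I" "I \<subseteq> cls h" for I
    using that
  proof (induction I rule: finite_induct)
    case empty
    have "\<zero>\<^bsub>q.Q\<^esub> \<in> homog V h" using submodule.axioms(1)[OF homog_sub] subgroup.one_closed by fastforce
    then show ?case using q.quot_zero by (simp add: Asimps)
  next
    case (insert x F)
    then have x: "x \<in> cls h" "x \<in> carrier G" by auto
    let ?s = "\<Sum>b\<in>F. sg b (lk p b)"
    have IH: "R +>\<^bsub>A\<^esub> ?s \<in> homog V h" "?s \<in> carrier A" using insert by auto
    have "Poly_Mapping.map ((*) (lk p x)) (sg x 1) = sg x (lk p x)"
      by (intro poly_mapping_eqI) (simp add: lookup_smult lookup_single when_def)
    then have "lk p x \<odot>\<^bsub>q.Q\<^esub> el x = R +>\<^bsub>A\<^esub> sg x (lk p x)"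
      using q.quot_smult[OF sgA[OF x(2)], of "lk p x" 1] by (simp add: Asimps)
    then have 1: "R +>\<^bsub>A\<^esub> sg x (lk p x) \<in> homog V h"
      using m.submoduleE(4)[OF homog_sub, of "lk p x" "el x"] homog_el[OF x(1)] by simp
    have "(R +>\<^bsub>A\<^esub> sg x (lk p x)) \<oplus>\<^bsub>q.Q\<^esub> (R +>\<^bsub>A\<^esub> ?s) = R +>\<^bsub>A\<^esub> (sg x (lk p x) + ?s)"
      using q.quot_add[OF sgA[OF x(2)] IH(2)] by (simp add: Asimps)
    then have "R +>\<^bsub>A\<^esub> (sg x (lk p x) + ?s) \<in> homog V h"
      using m.submoduleE(5)[OF homog_sub 1 IH(1)] by simp
    moreover have "sg x (lk p x) + ?s \<in> carrier A"
      using A.M.a_closed[OF sgA[OF x(2)] IH(2)] by (simp add: Asimps)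
    ultimately show ?case using insert by simp
  qed
  from this[OF fcls, of h] have "R +>\<^bsub>A\<^esub> pr h p \<in> homog V h" by (simp add: pr_def reix_def)
  then show ?thesis using P(1)[OF p(1)] p(2) by simp
qed

lemma pr_total: "p \<in> carrier A \<Longrightarrow> (\<Sum>h\<in>carrier G. pr h p) = p"
proof -
  assume p: "p \<in> carrier A"
  have "(\<Sum>h\<in>carrier G. pr h p) = (\<Sum>b\<in>carrier G. sg b (lk p b))"
    unfolding pr_def reix_def using fin g by (intro sum.group) auto
  then show ?thesis using A_induct[OF p] by simp
qed

lemma decomp: assumes v: "v \<in> carrier q.Q" shows "(\<Oplus>\<^bsub>q.Q\<^esub>h\<in>carrier G. P h v) = v"
proof -
  interpret m: Module.module scalars q.Q by (rule q.module_quot)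
  obtain p where p: "p \<in> carrier A" "v = R +>\<^bsub>A\<^esub> p" using q.quot_ex v by blast
  have Pc: "P h v \<in> carrier q.Q" for h using P_homog[OF v] homogQ by blast
  have "(\<Oplus>\<^bsub>q.Q\<^esub>h\<in>I. P h v) = R +>\<^bsub>A\<^esub> (\<Sum>h\<in>I. pr h p) \<and> (\<Sum>h\<in>I. pr h p) \<in> carrier A" if "finite I" for I
    using that
  proof (induction I rule: finite_induct)
    case empty
    then show ?case using q.quot_zero by (simp add: Asimps)
  next
    case (insert x F)
    have "(\<Oplus>\<^bsub>q.Q\<^esub>h\<in>insert x F. P h v) = P x v \<oplus>\<^bsub>q.Q\<^esub> (\<Oplus>\<^bsub>q.Q\<^esub>h\<in>F. P h v)"
      using m.M.finsum_insert[OF insert(1,2), of "\<lambda>h. P h v"] Pc by simp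
    also have "\<dots> = R +>\<^bsub>A\<^esub> (pr x p + (\<Sum>h\<in>F. pr h p))"
      using insert q.quot_add[OF pr_closed[OF p(1)]] P(1)[OF p(1)] p(2) by (simp add: Asimps(3))
    moreover have "pr x p + (\<Sum>h\<in>F. pr h p) \<in> carrier A"
      using A.M.a_closed[OF pr_closed[OF p(1)]] insert by (simp add: Asimps(3))
    ultimately show ?case using insert by simp
  qed
  from this[OF fin] show ?thesis using pr_total[OF p(1)] p(2) by simp
qed

lemma P_on: assumes "v \<in> homog V h" shows "P k v = (if k = h then v else \<zero>\<^bsub>q.Q\<^esub>)"
proof -
  interpret m: Module.module scalars q.Q by (rule q.module_quot)
  have Pel: "P k (el t) = (if k = h then el t else \<zero>\<^bsub>q.Q\<^esub>)" if "t \<in> cls h" for t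
    using that P(1)[OF sgA, of t k 1] pr_single[of t k 1] q.quot_zero by (auto simp: Asimps(2))
  have l: "linear_map q.Q q.Q (P k)" by (rule P(2))
  have Pc: "P k u \<in> carrier q.Q" if "u \<in> carrier q.Q" for u using P_homog[OF that] homogQ by blast
  let ?U = "{v \<in> carrier q.Q. P k v = (if k = h then v else \<zero>\<^bsub>q.Q\<^esub>)}"
  have z: "P k \<zero>\<^bsub>q.Q\<^esub> = \<zero>\<^bsub>q.Q\<^esub>"
    using linear_map_finsum[OF q.module_quot q.module_quot l, of "{}"] by simp
  have sm: "c \<odot>\<^bsub>q.Q\<^esub> a \<in> ?U" if "a \<in> ?U" for c a
    using that m.smult_closed[of c a] m.smult_r_null[of c] l by (auto simp: linear_map_def)
  have "submodule ?U scalars q.Q"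
  proof (rule m.submoduleI)
    fix a assume a: "a \<in> ?U"
    have ac: "a \<in> carrier q.Q" using a by auto
    have cl: "(- 1) \<odot>\<^bsub>q.Q\<^esub> a \<in> carrier q.Q" using m.smult_closed[of "-1" a] ac by simp
    have "(- 1) \<odot>\<^bsub>q.Q\<^esub> a \<oplus>\<^bsub>q.Q\<^esub> a = (- 1 + 1) \<odot>\<^bsub>q.Q\<^esub> a"
      using m.smult_l_distr[of "- 1" 1 a] ac m.smult_one[OF ac] by simp
    also have "\<dots> = \<zero>\<^bsub>q.Q\<^esub>" using m.smult_l_null[OF ac] by simp
    finally have "\<ominus>\<^bsub>q.Q\<^esub> a = (- 1) \<odot>\<^bsub>q.Q\<^esub> a" using m.M.minus_equality[OF _ ac cl] by simp
    then show "\<ominus>\<^bsub>q.Q\<^esub> a \<in> ?U" using sm[OF a] by simp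
    show "a \<oplus>\<^bsub>q.Q\<^esub> b \<in> ?U" if "b \<in> ?U" for b
      using a that l by (auto simp: linear_map_def)
  qed (use z sm in auto)
  moreover have "el ` cls h \<subseteq> ?U" using Pel elQ[of h] by blast
  ultimately have "homog V h \<subseteq> ?U"
    unfolding homog_eq by (rule lin_span_minimal)
  then show ?thesis using assms by auto
qed

theorem yd: "yetter_drinfeld G V"
proof (intro yetter_drinfeld.intro yetter_drinfeld_axioms.intro G.group_axioms Vmod fin act_linear)
  interpret m: Module.module scalars q.Q by (rule q.module_quot)
  have cV: "carrier V = carrier q.Q" using Vsame by (simp add: same_vs_def)
  show "submodule (homog V h) scalars V" for h
    by (rule same_submodule[OF Vsame q.module_quot homog_sub])
  show "\<exists>!f. f \<in> (\<Pi>\<^sub>E h\<in>carrier G. homog V h) \<and> v = (\<Oplus>\<^bsub>V\<^esub>h\<in>carrier G. f h)"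
    if "v \<in> carrier V" for v
  proof -
    have v: "v \<in> carrier q.Q" using that cV by simp
    let ?f = "\<lambda>h\<in>carrier G. P h v"
    show ?thesis unfolding same_finsum[OF Vsame]
    proof (rule ex1I[of _ ?f])
      have "(\<Oplus>\<^bsub>q.Q\<^esub>h\<in>carrier G. ?f h) = (\<Oplus>\<^bsub>q.Q\<^esub>h\<in>carrier G. P h v)"
        using P_homog[OF v] homogQ by (intro m.M.finsum_cong') auto
      then show "?f \<in> (\<Pi>\<^sub>E h\<in>carrier G. homog V h) \<and> v = (\<Oplus>\<^bsub>q.Q\<^esub>h\<in>carrier G. ?f h)"
        using decomp[OF v] P_homog[OF v] by simp
    next
      fix f assume f: "f \<in> (\<Pi>\<^sub>E h\<in>carrier G. homog V h) \<and> v = (\<Oplus>\<^bsub>q.Q\<^esub>h\<in>carrier G. f h)"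
      then have fh: "f h \<in> homog V h" "f h \<in> carrier q.Q" if "h \<in> carrier G" for h
        using that homogQ by (auto simp: PiE_iff)
      have "P k v = f k" if k: "k \<in> carrier G" for k
      proof -
        have "P k v = (\<Oplus>\<^bsub>q.Q\<^esub>h\<in>carrier G. P k (f h))"
          using f linear_map_finsum[OF q.module_quot q.module_quot P(2) fin, of f k] fh by auto
        also have "\<dots> = (\<Oplus>\<^bsub>q.Q\<^esub>h\<in>carrier G. if k = h then f h else \<zero>\<^bsub>q.Q\<^esub>)"
          using P_on[OF fh(1)] fh(2) by (intro m.M.finsum_cong') auto
        also have "\<dots> = f k" using m.M.finsum_singleton[OF k fin, of f] fh by auto
        finally show ?thesis .
      qed
      moreover have "f k = undefined" if "k \<notin> carrier G" for k by (rule PiE_arb[OF conjunct1[OF f] that])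
      ultimately have "f k = ?f k" for k by (cases "k \<in> carrier G") (simp_all only: restrict_apply if_True if_False)
      then show "f = ?f" by (rule ext)
    qed
  qed
  show "act V \<one> v = v" if vV: "v \<in> carrier V" for v
  proof -
    obtain p where p: "p \<in> carrier A" "v = R +>\<^bsub>A\<^esub> p" using q.quot_ex[OF vV[unfolded cV]] by blast
    show ?thesis unfolding p(2) act_coset[OF G.one_closed p(1)] lm_one[OF p(1)] by (rule refl)
  qed
  show "act V (a \<otimes> b) v = act V a (act V b v)" if abV: "a \<in> carrier G" "b \<in> carrier G" "v \<in> carrier V" for a b v
  proof -
    obtain p where p: "p \<in> carrier A" "v = R +>\<^bsub>A\<^esub> p" using q.quot_ex[OF abV(3)[unfolded cV]] by blast
    have c: "lm b p \<in> carrier A" using lm_linear[OF that(2)] p(1) unfolding linear_map_def by blast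
    show ?thesis
      unfolding p(2) act_coset[OF that(2) p(1)] act_coset[OF that(1) c] lm_mult[OF that(1,2)]
        act_coset[OF G.m_closed[OF that(1,2)] p(1)] by (rule refl)
  qed
  show "act V a ` homog V h \<subseteq> homog V (a \<otimes> h \<otimes> inv a)" if ah: "a \<in> carrier G" "h \<in> carrier G" for a h
  proof -
    have "act V a ` el ` cls h \<subseteq> homog V (a \<otimes> h \<otimes> inv a)"
    proof safe
      fix t assume t: "t \<in> carrier G" "h = t \<otimes> g \<otimes> inv t"
      have "act V a (el t) = el (a \<otimes> t)" using act_coset[OF ah(1) sgA[OF t(1)]] lm_single[OF t(1)] by simp
      moreover have "(a \<otimes> t) \<otimes> g \<otimes> inv (a \<otimes> t) = a \<otimes> (t \<otimes> g \<otimes> inv t) \<otimes> inv a"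
        using t(1) ah(1) g by (simp add: G.inv_mult_group G.m_assoc)
      then have "a \<otimes> t \<in> cls (a \<otimes> (t \<otimes> g \<otimes> inv t) \<otimes> inv a)"
        using t(1) ah(1) by blast
      note homog_el[OF this]
      ultimately show "act V a (el t) \<in> homog V (a \<otimes> (t \<otimes> g \<otimes> inv t) \<otimes> inv a)" by simp
    qed
    then have im: "act V a ` (el ` cls h) \<subseteq> homog V (a \<otimes> h \<otimes> inv a)" by simp
    have l: "linear_map q.Q q.Q (act V a)" using act_linear[OF ah(1)] same_linear[OF Vsame] by blast
    show ?thesis unfolding homog_eq[of h]
      by (rule linear_map_span[OF q.module_quot q.module_quot l elQ homog_sub im])
  qed
qed

end

theorem (in group) yd_induced_yetter_drinfeld:
  "finite (carrier G) \<Longrightarrow> g \<in> carrier G \<Longrightarrow> yetter_drinfeld G (yd_induced G g (chi :: 'a \<Rightarrow> 'k::field))"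
  by (intro yd_setup.yd yd_setup.intro yd_setup_axioms.intro group_axioms)

end

theory Submission
  imports Defs
begin

text \<open>
  Put \<open>a = \<chi>(g)\<close>. Since \<open>T = {g, g\<^sup>-\<^sup>1}\<close>, the matrix \<open>q\<^sub>T\<close> has \<open>a\<close> on and \<open>a\<^sup>-\<^sup>1\<close> off the diagonal, so
  everything follows from \<open>a = -1\<close>: the order of \<open>x\<close> is then even because \<open>\<chi>\<close> is a character.

  Suppose \<open>a \<noteq> -1\<close>. The coordinates on the span of \<open>v\<^sub>1, v\<^sub>2\<close>, extended by zero to the other homogeneous
  components, give functionals \<open>f\<^sub>w\<close> on \<open>T(V)\<close>, one for each word \<open>w\<close>, with
  \<open>f\<^sub>w \<circ> c\<^sub>\<sigma>\<close> a multiple of \<open>f\<close> at the permuted word; the factor is a product over the inversions of \<open>\<sigma>\<close>.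
  Hence \<open>f\<^sub>w \<circ> \<SS>\<^sub>n\<close> descends to the Nichols algebra, and if the latter has finite dimension, it vanishes for
  all long \<open>w\<close>. On the free algebra in \<open>v\<^sub>1, v\<^sub>2\<close> this functional is an iterated skew derivative. For
  \<open>a = 1\<close> it takes the value \<open>n!\<close> on \<open>v\<^sub>1\<^sup>n\<close>. Otherwise let \<open>D = v\<^sub>1 v\<^sub>2 - a\<^sup>-\<^sup>1 v\<^sub>2 v\<^sub>1\<close>, \<open>E\<^sub>0 = v\<^sub>1\<close> and
  \<open>E\<^bsub>k+1\<^esub> = D E\<^sub>k - E\<^sub>k D\<close>; then \<open>\<partial>\<^sub>1 \<partial>\<^sub>2 E\<^bsub>k+1\<^esub> = (1 - a\<^sup>-\<^sup>2)(a\<^sup>-\<^sup>1 - a) E\<^sub>k\<close>, and the scalar is not zero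
  because \<open>a\<^sup>2 \<noteq> 1\<close>.
\<close>

section \<open>Monoid algebras\<close>

text \<open>The braiding of v_1, v_2 satisfies q_12 q_21 = q_11^(-2): Cartan type with the matrix of
  affine sl_2, whose root system is infinite. The obstacle is that \<open>a\<close> may be a root of
  unity: then the powers of v_1 and v_2 vanish in the Nichols algebra from some degree on, and
  nonzero elements of unbounded degree must be found elsewhere. The real roots alpha_1 + k delta
  supply them. Every letter crosses D with total factor \<open>a * b = 1\<close>, so the commutator
  with D needs no twist, and the scalar -a^(-3) (a^2 - 1)^2 picked up at each step does not depend
  on k. No quantum integers arise, and all \<open>a\<close> with a^2 different from 1 are treated
  alike. At a = 1 the scalar degenerates and the characteristic of k enters instead. At a = -1 it
  degenerates as well; this is the surviving case. Functionals make finite dimension easy to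
  exploit: one that factors through the quotient is determined by its values on a finite spanning
  set, whose representatives have bounded degree.\<close>

lemma monoid_algebra_simps:
  "carrier (monoid_algebra M) = {p. Poly_Mapping.keys p \<subseteq> carrier M}"
  "zero (monoid_algebra M) = 0" "add (monoid_algebra M) = (+)"
  "one (monoid_algebra M) = Poly_Mapping.single \<one>\<^bsub>M\<^esub> 1"
  "Module.smult (monoid_algebra M) a = Poly_Mapping.map ((*) a)"
  by (auto simp: monoid_algebra_def)

text \<open>The support of a sum can be smaller than the union of the supports. Summing over any
  finite superset gives both sides of a distributive law the same index set.\<close>

lemma monoid_algebra_mult_superset:
  assumes "finite S" "finite S'" "Poly_Mapping.keys p \<subseteq> S" "Poly_Mapping.keys r \<subseteq> S'"
  shows "p \<otimes>\<^bsub>monoid_algebra M\<^esub> r = (\<Sum>a\<in>S. \<Sum>b\<in>S'.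
    Poly_Mapping.single (a \<otimes>\<^bsub>M\<^esub> b) (Poly_Mapping.lookup p a * Poly_Mapping.lookup r b))"
proof -
  have "p \<otimes>\<^bsub>monoid_algebra M\<^esub> r = (\<Sum>a\<in>Poly_Mapping.keys p. \<Sum>b\<in>S'.
    Poly_Mapping.single (a \<otimes>\<^bsub>M\<^esub> b) (Poly_Mapping.lookup p a * Poly_Mapping.lookup r b))"
    unfolding monoid_algebra_def using assms
    by (simp, intro sum.cong sum.mono_neutral_left) (auto simp: in_keys_iff)
  also have "\<dots> = (\<Sum>a\<in>S. \<Sum>b\<in>S'.
    Poly_Mapping.single (a \<otimes>\<^bsub>M\<^esub> b) (Poly_Mapping.lookup p a * Poly_Mapping.lookup r b))"
    using assms by (intro sum.mono_neutral_left) (auto simp: in_keys_iff)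
  finally show ?thesis .
qed

lemma monoid_algebra_mult_single:
  "Poly_Mapping.single a c \<otimes>\<^bsub>monoid_algebra M\<^esub> Poly_Mapping.single b d =
    Poly_Mapping.single (a \<otimes>\<^bsub>M\<^esub> b) (c * d :: 'k::field)"
  by (subst monoid_algebra_mult_superset[of "{a}" "{b}"]) auto

lemma monoid_algebra_mult_add:
  fixes p r s :: "'m \<Rightarrow>\<^sub>0 'k::field"
  shows "(p + r) \<otimes>\<^bsub>monoid_algebra M\<^esub> s = p \<otimes>\<^bsub>monoid_algebra M\<^esub> s + r \<otimes>\<^bsub>monoid_algebra M\<^esub> s"
    and "s \<otimes>\<^bsub>monoid_algebra M\<^esub> (p + r) = s \<otimes>\<^bsub>monoid_algebra M\<^esub> p + s \<otimes>\<^bsub>monoid_algebra M\<^esub> r"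
proof -
  let ?S = "Poly_Mapping.keys p \<union> Poly_Mapping.keys r" and ?T = "Poly_Mapping.keys s"
  have f: "finite ?S" "finite ?T" by auto
  have k: "Poly_Mapping.keys (p + r) \<subseteq> ?S" by (rule Poly_Mapping.keys_add)
  note e = monoid_algebra_mult_superset[where M=M, OF f _ subset_refl]
    monoid_algebra_mult_superset[where M=M, OF f(2,1) subset_refl]
  show "(p + r) \<otimes>\<^bsub>monoid_algebra M\<^esub> s = p \<otimes>\<^bsub>monoid_algebra M\<^esub> s + r \<otimes>\<^bsub>monoid_algebra M\<^esub> s"
    using k by (simp add: e lookup_add distrib_right single_add sum.distrib)
  show "s \<otimes>\<^bsub>monoid_algebra M\<^esub> (p + r) = s \<otimes>\<^bsub>monoid_algebra M\<^esub> p + s \<otimes>\<^bsub>monoid_algebra M\<^esub> r"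
    using k by (simp add: e lookup_add distrib_left single_add sum.distrib)
qed

lemma monoid_algebra_mult_diff:
  fixes p r s :: "'m \<Rightarrow>\<^sub>0 'k::field"
  shows "(p - r) \<otimes>\<^bsub>monoid_algebra M\<^esub> s = p \<otimes>\<^bsub>monoid_algebra M\<^esub> s - r \<otimes>\<^bsub>monoid_algebra M\<^esub> s"
    and "s \<otimes>\<^bsub>monoid_algebra M\<^esub> (p - r) = s \<otimes>\<^bsub>monoid_algebra M\<^esub> p - s \<otimes>\<^bsub>monoid_algebra M\<^esub> r"
  using monoid_algebra_mult_add[where p="p - r" and r=r and s=s and M=M] by (simp_all add: algebra_simps)

lemma monoid_algebra_mult_zero:
  "0 \<otimes>\<^bsub>monoid_algebra M\<^esub> s = 0" "s \<otimes>\<^bsub>monoid_algebra M\<^esub> 0 = 0"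
  by (simp_all add: monoid_algebra_def)

text \<open>Serves as extension by linearity. Applied once per factor, it reduces the ring axioms of
  the algebra to the monoid axioms of \<open>M\<close>.\<close>

lemma monoid_algebra_induct [consumes 1, case_names zero add single]:
  fixes p :: "'m \<Rightarrow>\<^sub>0 'k::field"
  assumes p: "p \<in> carrier (monoid_algebra M)" and zero: "P 0"
    and add: "\<And>p r. p \<in> carrier (monoid_algebra M) \<Longrightarrow> r \<in> carrier (monoid_algebra M) \<Longrightarrow> P p \<Longrightarrow> P r \<Longrightarrow> P (p + r)"
    and single: "\<And>a c. a \<in> carrier M \<Longrightarrow> P (Poly_Mapping.single a c)"
  shows "P p"
proof -
  let ?s = "\<lambda>a. Poly_Mapping.single a (Poly_Mapping.lookup p a)"
  have "(\<Sum>a\<in>K. ?s a) \<in> carrier (monoid_algebra M) \<and> P (\<Sum>a\<in>K. ?s a)"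
    if "finite K" "K \<subseteq> carrier M" for K using that
  proof (induction K rule: finite_induct)
    case empty
    then show ?case using zero by (simp add: monoid_algebra_simps)
  next
    case (insert a K)
    have a: "?s a \<in> carrier (monoid_algebra M)" using insert.prems by (simp add: monoid_algebra_simps)
    have "Poly_Mapping.keys (?s a + (\<Sum>a\<in>K. ?s a)) \<subseteq> carrier M"
      using insert a Poly_Mapping.keys_add[of "?s a" "\<Sum>a\<in>K. ?s a"] by (auto simp: monoid_algebra_simps)
    then show ?case
      using insert add[OF a, of "\<Sum>a\<in>K. ?s a"] single[of a "Poly_Mapping.lookup p a"]
      by (simp add: monoid_algebra_simps)
  qed
  from this[of "Poly_Mapping.keys p"] p
  have "P (\<Sum>a\<in>Poly_Mapping.keys p. ?s a)" by (simp add: monoid_algebra_simps)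
  also have "(\<Sum>a\<in>Poly_Mapping.keys p. ?s a) = p"
    by (intro poly_mapping_eqI) (auto simp: lookup_sum lookup_single when_def sum.delta' in_keys_iff)
  finally show ?thesis .
qed

lemma monoid_algebra_mult_closed:
  assumes "monoid M" "p \<in> carrier (monoid_algebra M)" "r \<in> carrier (monoid_algebra M)"
  shows "p \<otimes>\<^bsub>monoid_algebra M\<^esub> r \<in> carrier (monoid_algebra M :: ('k::field, 'm \<Rightarrow>\<^sub>0 'k) Module.module)"
proof -
  interpret M: monoid M by fact
  interpret A: Module.module scalars "monoid_algebra M :: ('k, 'm \<Rightarrow>\<^sub>0 'k) Module.module"
    by (rule module_monoid_algebra)
  have a: "u + v \<in> carrier (monoid_algebra M)"
    if "u \<in> carrier (monoid_algebra M)" "v \<in> carrier (monoid_algebra M)" for u v :: "'m \<Rightarrow>\<^sub>0 'k"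
    using A.M.a_closed[OF that] by (simp add: monoid_algebra_simps(3))
  have z: "0 \<in> carrier (monoid_algebra M :: ('k, 'm \<Rightarrow>\<^sub>0 'k) Module.module)" by (simp add: monoid_algebra_simps)
  have s: "Poly_Mapping.single m c \<in> carrier (monoid_algebra M)" if "m \<in> carrier M" for m and c :: 'k
    using that by (simp add: monoid_algebra_simps)
  have 1: "Poly_Mapping.single m c \<otimes>\<^bsub>monoid_algebra M\<^esub> r \<in> carrier (monoid_algebra M)"
    if "m \<in> carrier M" for m and c :: 'k
    using assms(3) by (induction rule: monoid_algebra_induct)
      (auto simp: monoid_algebra_mult_zero monoid_algebra_mult_add monoid_algebra_mult_single that intro!: a z s)
  show ?thesis
    using assms(2) by (induction rule: monoid_algebra_induct)
      (auto simp: monoid_algebra_mult_zero monoid_algebra_mult_add intro!: a z 1)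
qed

lemma ring_monoid_algebra:
  assumes "monoid M"
  shows "ring (monoid_algebra M :: ('k::field, 'm \<Rightarrow>\<^sub>0 'k) Module.module)"
proof -
  interpret M: monoid M by fact
  let ?A = "monoid_algebra M :: ('k, 'm \<Rightarrow>\<^sub>0 'k) Module.module"
  interpret A: Module.module scalars ?A by (rule module_monoid_algebra)
  note ad = monoid_algebra_mult_zero monoid_algebra_mult_add monoid_algebra_mult_single
  have 1: "(Poly_Mapping.single m c \<otimes>\<^bsub>?A\<^esub> Poly_Mapping.single n d) \<otimes>\<^bsub>?A\<^esub> t =
      Poly_Mapping.single m c \<otimes>\<^bsub>?A\<^esub> (Poly_Mapping.single n d \<otimes>\<^bsub>?A\<^esub> t)"
    if "m \<in> carrier M" "n \<in> carrier M" "t \<in> carrier ?A" for m n c d t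
    using that(3) by (induction rule: monoid_algebra_induct) (use that in \<open>simp_all add: ad M.m_assoc mult.assoc\<close>)
  have 2: "(Poly_Mapping.single m c \<otimes>\<^bsub>?A\<^esub> s) \<otimes>\<^bsub>?A\<^esub> t = Poly_Mapping.single m c \<otimes>\<^bsub>?A\<^esub> (s \<otimes>\<^bsub>?A\<^esub> t)"
    if "m \<in> carrier M" "s \<in> carrier ?A" "t \<in> carrier ?A" for m c s t
    using that(2) by (induction rule: monoid_algebra_induct) (use that 1 in \<open>simp_all add: ad(1-4)\<close>)
  show ?thesis
  proof (rule ringI)
    show "abelian_group ?A" by (rule A.abelian_group_axioms)
    show "monoid ?A"
    proof (rule monoidI)
      show "\<one>\<^bsub>?A\<^esub> \<in> carrier ?A" by (simp add: monoid_algebra_simps)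
      show "p \<otimes>\<^bsub>?A\<^esub> r \<in> carrier ?A" if "p \<in> carrier ?A" "r \<in> carrier ?A" for p r
        by (rule monoid_algebra_mult_closed[OF assms that])
      show "p \<otimes>\<^bsub>?A\<^esub> s \<otimes>\<^bsub>?A\<^esub> t = p \<otimes>\<^bsub>?A\<^esub> (s \<otimes>\<^bsub>?A\<^esub> t)"
        if "p \<in> carrier ?A" "s \<in> carrier ?A" "t \<in> carrier ?A" for p s t
        using that(1) by (induction rule: monoid_algebra_induct) (use that 2 in \<open>simp_all add: ad(1-4)\<close>)
      show "\<one>\<^bsub>?A\<^esub> \<otimes>\<^bsub>?A\<^esub> p = p" "p \<otimes>\<^bsub>?A\<^esub> \<one>\<^bsub>?A\<^esub> = p" if "p \<in> carrier ?A" for p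
        using that unfolding monoid_algebra_simps(4)
        by (induction rule: monoid_algebra_induct) (simp_all add: ad)
    qed
  qed (simp_all add: monoid_algebra_simps(3) ad)
qed


section \<open>Linear maps\<close>

lemma linear_map_zero:
  assumes "Module.module scalars V" "Module.module scalars W" "linear_map V W f"
  shows "f \<zero>\<^bsub>V\<^esub> = \<zero>\<^bsub>W\<^esub>"
proof -
  interpret V: Module.module scalars V by fact
  interpret W: Module.module scalars W by fact
  show ?thesis using linear_map_finsum[OF assms, of "{}" undefined] by simp
qed

lemma linear_map_closed: "linear_map V W f \<Longrightarrow> v \<in> carrier V \<Longrightarrow> f v \<in> carrier W"
  by (auto simp: linear_map_def)

lemma linear_map_minus:
  assumes V: "Module.module scalars V" and W: "Module.module scalars W" and f: "linear_map V W f"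
    and u: "u \<in> carrier V" and v: "v \<in> carrier V"
  shows "f (u \<ominus>\<^bsub>V\<^esub> v) = f u \<ominus>\<^bsub>W\<^esub> f v"
proof -
  interpret V: Module.module scalars V by fact
  interpret W: Module.module scalars W by fact
  have c: "f u \<in> carrier W" "f v \<in> carrier W" "f (u \<ominus>\<^bsub>V\<^esub> v) \<in> carrier W"
    using u v linear_map_closed[OF f] by auto
  have "u = (u \<ominus>\<^bsub>V\<^esub> v) \<oplus>\<^bsub>V\<^esub> v" using u v by (simp add: a_minus_def V.M.a_assoc V.M.l_neg)
  then have "f u = f (u \<ominus>\<^bsub>V\<^esub> v) \<oplus>\<^bsub>W\<^esub> f v"
    using f u v V.M.minus_closed[OF u v] unfolding linear_map_def by metis
  then show ?thesis using c by (simp add: a_minus_def W.M.a_assoc W.M.r_neg)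
qed

context quotient_space
begin

text \<open>The target is not a space of cosets, so the union used in \<open>descend\<close> makes
  no sense here; a representative is chosen instead, and the choice is immaterial once
  \<open>f\<close> vanishes on \<open>U\<close>.\<close>

definition factor :: "('v \<Rightarrow> 'w) \<Rightarrow> 'v set \<Rightarrow> 'w"
  where "factor f C = f (SOME p. p \<in> C)"

lemma factor:
  assumes M: "Module.module scalars M" and f: "linear_map A M f" and fU: "\<And>u. u \<in> U \<Longrightarrow> f u = \<zero>\<^bsub>M\<^esub>"
  shows factor_coset: "\<And>p. p \<in> carrier A \<Longrightarrow> factor f (U +>\<^bsub>A\<^esub> p) = f p"
    and factor_linear: "linear_map Q M (factor f)"
proof -
  interpret W: Module.module scalars M by fact
  show d: "factor f (U +>\<^bsub>A\<^esub> p) = f p" if p: "p \<in> carrier A" for p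
  proof -
    define r where "r = (SOME r. r \<in> U +>\<^bsub>A\<^esub> p)"
    have "r \<in> U +>\<^bsub>A\<^esub> p" unfolding r_def using U.a_rcos_self[OF p] by (rule someI)
    then have r: "r \<in> carrier A" "U +>\<^bsub>A\<^esub> r = U +>\<^bsub>A\<^esub> p" using coset_mem[OF p] by auto
    then have "f (r \<ominus>\<^bsub>A\<^esub> p) = \<zero>\<^bsub>M\<^esub>" using coset_eq[OF r(1) p] fU by simp
    then have "f r \<ominus>\<^bsub>M\<^esub> f p = \<zero>\<^bsub>M\<^esub>" using linear_map_minus[OF module_axioms M f r(1) p] by simp
    then have "f r = f p"
      using W.M.minus_equality[of "f r" "\<ominus>\<^bsub>M\<^esub> f p"] linear_map_closed[OF f r(1)] linear_map_closed[OF f p]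
      by (simp add: a_minus_def)
    then show ?thesis by (simp add: factor_def r_def)
  qed
  show "linear_map Q M (factor f)"
    unfolding linear_map_def
  proof (intro conjI ballI allI funcsetI)
    fix x assume "x \<in> carrier Q"
    then obtain p where p: "p \<in> carrier A" "x = U +>\<^bsub>A\<^esub> p" using quot_ex by blast
    show "factor f x \<in> carrier M" unfolding p(2) d[OF p(1)] by (rule linear_map_closed[OF f p(1)])
    { fix y assume "y \<in> carrier Q"
      then obtain r where r: "r \<in> carrier A" "y = U +>\<^bsub>A\<^esub> r" using quot_ex by blast
      show "factor f (x \<oplus>\<^bsub>Q\<^esub> y) = factor f x \<oplus>\<^bsub>M\<^esub> factor f y"
        unfolding p(2) r(2) quot_add[OF p(1) r(1)] d[OF p(1)] d[OF r(1)] d[OF M.a_closed[OF p(1) r(1)]]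
        using f p(1) r(1) by (simp add: linear_map_def) }
    fix a :: 'k
    have c: "a \<odot>\<^bsub>A\<^esub> p \<in> carrier A" using p(1) smult_closed[of a p] by simp
    show "factor f (a \<odot>\<^bsub>Q\<^esub> x) = a \<odot>\<^bsub>M\<^esub> factor f x"
      unfolding p(2) quot_smult[OF p(1)] d[OF p(1)] d[OF c]
      using f p(1) by (simp add: linear_map_def)
  qed
qed

end


section \<open>The universal property of the tensor algebra\<close>

locale tensor_setup = V: Module.module scalars V for V :: "('k::field, 'v, 'm) module_scheme"
begin

abbreviation "F \<equiv> free_algebra V"
abbreviation "J \<equiv> tensor_ideal V"
abbreviation "T \<equiv> tensor_algebra V"
abbreviation "words \<equiv> lists (carrier V)"
abbreviation (input) "sg \<equiv> Poly_Mapping.single"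
abbreviation (input) "gens \<equiv>
  {sg [u \<oplus>\<^bsub>V\<^esub> v] 1 - sg [u] 1 - sg [v] 1 | u v. u \<in> carrier V \<and> v \<in> carrier V} \<union>
  {sg [a \<odot>\<^bsub>V\<^esub> v] 1 - sg [v] a | a v. v \<in> carrier V}"

lemma monoid_words: "monoid \<lparr>carrier = words, mult = (@), one = []\<rparr>"
  by (auto intro!: monoidI)

sublocale F: ring F
  unfolding free_algebra_def by (rule ring_monoid_algebra[OF monoid_words])

lemma free_simps:
  "carrier F = {p. Poly_Mapping.keys p \<subseteq> words}" "zero F = 0" "add F = (+)" "one F = sg [] 1"
  "Module.smult F a = Poly_Mapping.map ((*) a)"
  "sg v c \<otimes>\<^bsub>F\<^esub> sg w d = sg (v @ w) (c * d)"
  by (auto simp: free_algebra_def monoid_algebra_simps monoid_algebra_mult_single)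

sublocale Fm: Module.module scalars F
  unfolding free_algebra_def by (rule module_monoid_algebra)

lemma free_minus: assumes "p \<in> carrier F" "r \<in> carrier F" shows "p \<ominus>\<^bsub>F\<^esub> r = p - r" "p - r \<in> carrier F"
proof -
  have r: "- r \<in> carrier F" using assms(2) by (simp add: free_simps)
  then have "\<ominus>\<^bsub>F\<^esub> r = - r"
    using F.minus_equality[of "- r" r] assms(2) by (simp add: free_simps)
  then show e: "p \<ominus>\<^bsub>F\<^esub> r = p - r" by (simp add: a_minus_def free_simps)
  show "p - r \<in> carrier F" unfolding e[symmetric] by (rule F.minus_closed[OF assms])
qed

lemma single_closed [simp]: "w \<in> words \<Longrightarrow> sg w c \<in> carrier F"
  by (simp add: free_simps)

lemma free_induct [consumes 1, case_names zero add single]: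
  assumes "p \<in> carrier F" and "P 0"
    and "\<And>p r. p \<in> carrier F \<Longrightarrow> r \<in> carrier F \<Longrightarrow> P p \<Longrightarrow> P r \<Longrightarrow> P (p + r)"
    and "\<And>w c. w \<in> words \<Longrightarrow> P (sg w c)"
  shows "P p"
  using monoid_algebra_induct[of p "\<lparr>carrier = words, mult = (@), one = []\<rparr>" P] assms
  by (simp add: free_algebra_def)

lemma gens_closed: "gens \<subseteq> carrier F"
  by (auto intro!: free_minus(2) single_closed simp: V.smult_closed[simplified])

lemma ideal_J: "ideal J F"
  unfolding tensor_ideal_def by (rule F.genideal_ideal[OF gens_closed])

lemma gens_J: "gens \<subseteq> J"
  unfolding tensor_ideal_def by (rule F.genideal_self[OF gens_closed])

sublocale J: ideal J F by (rule ideal_J)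

lemma F_mult_zero: "0 \<otimes>\<^bsub>F\<^esub> p = 0" "p \<otimes>\<^bsub>F\<^esub> 0 = 0"
  by (simp_all add: free_algebra_def monoid_algebra_mult_zero)

text \<open>Scalars sit in \<open>F\<close> as multiples of the empty word. Hence the ring ideal
  \<open>J\<close> is also a subspace, and the quotient carries both structures.\<close>

lemma smult_eq_mult: "p \<in> carrier F \<Longrightarrow> a \<odot>\<^bsub>F\<^esub> p = sg [] a \<otimes>\<^bsub>F\<^esub> p"
proof (induction rule: free_induct)
  case (add p r)
  then show ?case
    using Fm.smult_r_distr[of a p r] F.r_distr[of p r "sg [] a"] by (simp add: free_simps(3))
qed (simp_all add: free_algebra_def monoid_algebra_mult_zero monoid_algebra_mult_single monoid_algebra_simps(5)
    poly_mapping_eqI lookup_smult)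

lemma submodule_J: "submodule J scalars F"
proof (rule Fm.submoduleI)
  show "\<zero>\<^bsub>F\<^esub> \<in> J" by (rule J.zero_closed)
  show "\<ominus>\<^bsub>F\<^esub> a \<in> J" if "a \<in> J" for a using that by (rule J.a_inv_closed)
  show "a \<odot>\<^bsub>F\<^esub> x \<in> J" if "x \<in> J" for a x
    using J.I_l_closed[OF that, of "sg [] a"] that J.Icarr by (simp add: smult_eq_mult)
qed (auto intro: J.a_closed J.Icarr)

sublocale q: quotient_space F J
  by (intro quotient_space.intro quotient_space_axioms.intro Fm.module_axioms submodule_J)

lemma T_eq: "T = q.Q" by (simp add: tensor_algebra_def)

sublocale Tm: Module.module scalars T
  unfolding T_eq by (rule q.module_quot)

sublocale T: ring T
proof -
  interpret R: ring "F Quot J" by (rule J.quotient_is_ring)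
  have s: "carrier T = carrier (F Quot J)" "mult T = mult (F Quot J)" "one T = one (F Quot J)"
    "add T = add (F Quot J)"
    by (simp_all add: tensor_algebra_def quot_module_def)
  show "ring T"
    by (rule ringI[OF Tm.abelian_group_axioms]) (auto intro!: monoidI simp: s R.m_assoc R.l_distr R.r_distr)
qed

lemma pure_closed [simp]: "w \<in> words \<Longrightarrow> pure_tensor V w \<in> carrier T"
  unfolding T_eq pure_tensor_def by (rule q.quot_mem) simp

lemma pure_mult: "v \<in> words \<Longrightarrow> w \<in> words \<Longrightarrow>
    pure_tensor V v \<otimes>\<^bsub>T\<^esub> pure_tensor V w = pure_tensor V (v @ w)"
  using J.rcoset_mult_add[of "sg v 1" "sg w 1"]
  by (simp add: tensor_algebra_def quot_module_def pure_tensor_def FactRing_def free_simps(6))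

text \<open>Covers all tensor degrees at once: linearity is imposed slot by slot through list
  updates, so a linear map out of the whole tensor algebra is given by a single function on
  lists.\<close>

definition multilinear :: "('k, 'w, 'n) module_scheme \<Rightarrow> ('v list \<Rightarrow> 'w) \<Rightarrow> bool"
  where "multilinear M f \<longleftrightarrow> f \<in> words \<rightarrow> carrier M \<and>
    (\<forall>w\<in>words. \<forall>i<length w. \<forall>u\<in>carrier V.
      (\<forall>v\<in>carrier V. f (w[i := u \<oplus>\<^bsub>V\<^esub> v]) = f (w[i := u]) \<oplus>\<^bsub>M\<^esub> f (w[i := v])) \<and>
      (\<forall>a. f (w[i := a \<odot>\<^bsub>V\<^esub> u]) = a \<odot>\<^bsub>M\<^esub> f (w[i := u])))"

definition free_ext :: "('k, 'w, 'n) module_scheme \<Rightarrow> ('v list \<Rightarrow> 'w) \<Rightarrow> ('v list \<Rightarrow>\<^sub>0 'k) \<Rightarrow> 'w"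
  where "free_ext M f p = (\<Oplus>\<^bsub>M\<^esub>w\<in>Poly_Mapping.keys p. Poly_Mapping.lookup p w \<odot>\<^bsub>M\<^esub> f w)"

context
  fixes M :: "('k, 'w, 'n) module_scheme" and f
  assumes M: "Module.module scalars M" and f: "f \<in> words \<rightarrow> carrier M"
begin

interpretation M: Module.module scalars M by (rule M)

lemma f_closed: "w \<in> words \<Longrightarrow> f w \<in> carrier M" "w \<in> words \<Longrightarrow> a \<odot>\<^bsub>M\<^esub> f w \<in> carrier M"
  using f M.smult_closed[of a "f w"] by auto

lemma free_ext_superset:
  assumes "finite S" "Poly_Mapping.keys p \<subseteq> S" "S \<subseteq> words"
  shows "free_ext M f p = (\<Oplus>\<^bsub>M\<^esub>w\<in>S. Poly_Mapping.lookup p w \<odot>\<^bsub>M\<^esub> f w)"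
  unfolding free_ext_def using assms f_closed
  by (intro M.M.add.finprod_mono_neutral_cong_left)
    (auto simp: in_keys_iff subset_iff intro!: M.smult_l_null[simplified])

lemma free_ext_single: assumes w: "w \<in> words" shows "free_ext M f (sg w c) = c \<odot>\<^bsub>M\<^esub> f w"
  using f_closed w free_ext_superset[of "{w}" "sg w c"]
  by (simp add: M.M.finsum_insert[of "{}" w, simplified])

lemma free_ext_linear: "linear_map F M (free_ext M f)"
  unfolding linear_map_def
proof (intro conjI ballI allI funcsetI)
  fix p assume p: "p \<in> carrier F"
  let ?K = "Poly_Mapping.keys p"
  have K: "?K \<subseteq> words" using p by (simp add: free_simps)
  show "free_ext M f p \<in> carrier M"
    unfolding free_ext_def using K by (intro M.M.finsum_closed) (auto simp: f_closed subset_iff)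
  show "free_ext M f (p \<oplus>\<^bsub>F\<^esub> r) = free_ext M f p \<oplus>\<^bsub>M\<^esub> free_ext M f r" if r: "r \<in> carrier F" for r
  proof -
    let ?S = "?K \<union> Poly_Mapping.keys r"
    have S: "finite ?S" "?S \<subseteq> words" using p r by (auto simp: free_simps)
    have e: "free_ext M f s = (\<Oplus>\<^bsub>M\<^esub>w\<in>?S. Poly_Mapping.lookup s w \<odot>\<^bsub>M\<^esub> f w)"
      if "Poly_Mapping.keys s \<subseteq> ?S" for s
      by (rule free_ext_superset[OF S(1) that S(2)])
    have "free_ext M f (p + r) = (\<Oplus>\<^bsub>M\<^esub>w\<in>?S. Poly_Mapping.lookup p w \<odot>\<^bsub>M\<^esub> f w \<oplus>\<^bsub>M\<^esub> Poly_Mapping.lookup r w \<odot>\<^bsub>M\<^esub> f w)"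
      unfolding e[OF Poly_Mapping.keys_add] using S
      by (intro M.M.finsum_cong') (auto simp: f_closed lookup_add M.smult_l_distr[simplified] subset_iff)
    also have "\<dots> = free_ext M f p \<oplus>\<^bsub>M\<^esub> free_ext M f r"
    proof -
      have "(\<lambda>w. Poly_Mapping.lookup s w \<odot>\<^bsub>M\<^esub> f w) \<in> ?S \<rightarrow> carrier M" for s
        using S(2) f_closed(2) by blast
      then show ?thesis by (simp only: e Un_upper1 Un_upper2 M.M.finsum_addf)
    qed
    finally show ?thesis by (simp add: free_simps)
  qed
  fix a
  have "Poly_Mapping.keys (Poly_Mapping.map ((*) a) p) \<subseteq> ?K" by (auto simp: in_keys_iff lookup_smult)
  then have "free_ext M f (a \<odot>\<^bsub>F\<^esub> p) = (\<Oplus>\<^bsub>M\<^esub>w\<in>?K. a \<odot>\<^bsub>M\<^esub> (Poly_Mapping.lookup p w \<odot>\<^bsub>M\<^esub> f w))"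
    unfolding free_simps(5) using free_ext_superset[OF finite_keys _ K] K
    by (simp, intro M.M.finsum_cong')
      (auto simp: f_closed lookup_smult M.smult_assoc1[simplified] subset_iff intro!: M.smult_closed[simplified])
  also have "\<dots> = a \<odot>\<^bsub>M\<^esub> free_ext M f p"
    unfolding free_ext_def using K
    by (intro M.finsum_smult_ldistr[symmetric]) (auto simp: f_closed subset_iff)
  finally show "free_ext M f (a \<odot>\<^bsub>F\<^esub> p) = a \<odot>\<^bsub>M\<^esub> free_ext M f p" .
qed

end

definition tensor_lift :: "('k, 'w, 'n) module_scheme \<Rightarrow> ('v list \<Rightarrow> 'w) \<Rightarrow> ('v list \<Rightarrow>\<^sub>0 'k) set \<Rightarrow> 'w"
  where "tensor_lift M f = q.factor (free_ext M f)"

lemma list_update_middle: "length v = i \<Longrightarrow> (v @ [x] @ w)[i := y] = v @ [y] @ w"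
  by (auto simp: list_update_append)

text \<open>The extension is linear but not multiplicative, so vanishing on the generators does not
  by itself pass to the ideal they generate. Multilinearity kills a relation in any slot, that is,
  with arbitrary words on both sides of it.\<close>

lemma free_ext_J:
  assumes M: "Module.module scalars M" and f: "multilinear M f" and p: "p \<in> J"
  shows "free_ext M f p = \<zero>\<^bsub>M\<^esub>"
proof -
  interpret M: Module.module scalars M by (rule M)
  have fc: "f \<in> words \<rightarrow> carrier M" using f by (simp add: multilinear_def)
  let ?e = "free_ext M f"
  note lin = free_ext_linear[OF M fc] and single = free_ext_single[OF M fc]
  have ec: "?e p \<in> carrier M" if "p \<in> carrier F" for p using linear_map_closed[OF lin that] .
  have e0: "?e 0 = \<zero>\<^bsub>M\<^esub>" using linear_map_zero[OF Fm.module_axioms M lin] by (simp add: free_simps)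
  have ea: "?e (p + r) = ?e p \<oplus>\<^bsub>M\<^esub> ?e r" if "p \<in> carrier F" "r \<in> carrier F" for p r
    using lin that by (simp add: linear_map_def free_simps)
  have em: "?e (p - r) = ?e p \<ominus>\<^bsub>M\<^esub> ?e r" if "p \<in> carrier F" "r \<in> carrier F" for p r
    using linear_map_minus[OF Fm.module_axioms M lin that] free_minus[OF that] by simp
  \<comment> \<open>The elements all of whose two-sided multiples are killed: the largest ideal
    inside the kernel.\<close>
  define K where "K = {p \<in> carrier F. \<forall>r\<in>carrier F. \<forall>s\<in>carrier F. ?e (r \<otimes>\<^bsub>F\<^esub> p \<otimes>\<^bsub>F\<^esub> s) = \<zero>\<^bsub>M\<^esub>}"
  \<comment> \<open>By linearity both outer factors may be taken to be monomials.\<close>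
  have KI: "p \<in> K" if p: "p \<in> carrier F"
    and w: "\<And>v w c d. v \<in> words \<Longrightarrow> w \<in> words \<Longrightarrow> ?e (sg v c \<otimes>\<^bsub>F\<^esub> p \<otimes>\<^bsub>F\<^esub> sg w d) = \<zero>\<^bsub>M\<^esub>" for p
  proof -
    have 1: "?e (r \<otimes>\<^bsub>F\<^esub> p \<otimes>\<^bsub>F\<^esub> sg w d) = \<zero>\<^bsub>M\<^esub>" if "r \<in> carrier F" "w \<in> words" for r w d
      using that(1)
    proof (induction rule: free_induct)
      case zero
      then show ?case using p that by (simp add: e0 F_mult_zero)
    next
      case (add r r')
      then show ?case using p that ea[of "r \<otimes>\<^bsub>F\<^esub> p \<otimes>\<^bsub>F\<^esub> sg w d" "r' \<otimes>\<^bsub>F\<^esub> p \<otimes>\<^bsub>F\<^esub> sg w d"]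
        by (simp add: F.l_distr flip: free_simps(3))
    qed (use w that in simp)
    have "?e (r \<otimes>\<^bsub>F\<^esub> p \<otimes>\<^bsub>F\<^esub> s) = \<zero>\<^bsub>M\<^esub>" if "r \<in> carrier F" "s \<in> carrier F" for r s
      using that(2)
    proof (induction rule: free_induct)
      case zero
      then show ?case using p that by (simp add: e0 F_mult_zero)
    next
      case (add s s')
      then show ?case using p that ea[of "r \<otimes>\<^bsub>F\<^esub> p \<otimes>\<^bsub>F\<^esub> s" "r \<otimes>\<^bsub>F\<^esub> p \<otimes>\<^bsub>F\<^esub> s'"]
        by (simp add: F.r_distr flip: free_simps(3))
    qed (use 1 that in simp)
    then show ?thesis using p by (simp add: K_def)
  qed
  have "ideal K F"
  proof (rule idealI[OF F.ring_axioms])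
    have Kc: "K \<subseteq> carrier F" by (auto simp: K_def)
    show "subgroup K (add_monoid F)"
    proof (rule F.add.subgroupI)
      show "K \<noteq> {}" using e0 by (auto simp: K_def free_simps(2)[symmetric] intro!: exI[of _ "\<zero>\<^bsub>F\<^esub>"])
      show "p \<oplus>\<^bsub>F\<^esub> r \<in> K" if "p \<in> K" "r \<in> K" for p r
        using that ea by (simp add: K_def F.l_distr F.r_distr flip: free_simps(3))
      show "\<ominus>\<^bsub>F\<^esub> p \<in> K" if "p \<in> K" for p
      proof -
        have p: "p \<in> carrier F" using that Kc by blast
        have "?e (\<ominus>\<^bsub>F\<^esub> x) = \<zero>\<^bsub>M\<^esub>" if "x \<in> carrier F" "?e x = \<zero>\<^bsub>M\<^esub>" for x
          using that ea[of "\<ominus>\<^bsub>F\<^esub> x" x] F.l_neg[of x] ec[of "\<ominus>\<^bsub>F\<^esub> x"] e0 by (simp add: free_simps(2,3))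
        then show ?thesis using that p by (simp add: K_def F.l_minus F.r_minus)
      qed
    qed (use Kc in auto)
    fix p x assume p: "p \<in> K" and x: "x \<in> carrier F"
    have pc: "p \<in> carrier F" using p Kc by blast
    show "x \<otimes>\<^bsub>F\<^esub> p \<in> K" using p pc x by (auto simp: K_def simp flip: F.m_assoc)
    have "r \<otimes>\<^bsub>F\<^esub> (p \<otimes>\<^bsub>F\<^esub> x) \<otimes>\<^bsub>F\<^esub> s = r \<otimes>\<^bsub>F\<^esub> p \<otimes>\<^bsub>F\<^esub> (x \<otimes>\<^bsub>F\<^esub> s)" if "r \<in> carrier F" "s \<in> carrier F" for r s
      using that pc x by (simp add: F.m_assoc)
    then show "p \<otimes>\<^bsub>F\<^esub> x \<in> K" using p pc x by (auto simp: K_def)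
  qed
  moreover have "gens \<subseteq> K"
  proof -
    have mdist: "sg v c \<otimes>\<^bsub>F\<^esub> (p - r) \<otimes>\<^bsub>F\<^esub> sg w d =
        sg v c \<otimes>\<^bsub>F\<^esub> p \<otimes>\<^bsub>F\<^esub> sg w d - sg v c \<otimes>\<^bsub>F\<^esub> r \<otimes>\<^bsub>F\<^esub> sg w d" for v c p r w d
      unfolding free_algebra_def by (simp only: monoid_algebra_mult_diff)
    note m = f[unfolded multilinear_def, THEN conjunct2, rule_format]
    have A: "f (v @ [x \<oplus>\<^bsub>V\<^esub> y] @ w) = f (v @ [x] @ w) \<oplus>\<^bsub>M\<^esub> f (v @ [y] @ w)"
      "f (v @ [a \<odot>\<^bsub>V\<^esub> x] @ w) = a \<odot>\<^bsub>M\<^esub> f (v @ [x] @ w)"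
      if "v \<in> words" "w \<in> words" "x \<in> carrier V" "y \<in> carrier V" for v w x y a
      using m[of "v @ [x] @ w" "length v" x] that list_update_middle[OF refl, of v x w] by auto
    have c: "f (v @ [x] @ w) \<in> carrier M" "a \<odot>\<^bsub>M\<^esub> f (v @ [x] @ w) \<in> carrier M"
      if "v \<in> words" "w \<in> words" "x \<in> carrier V" for v w x a
      using funcset_mem[OF fc, of "v @ [x] @ w"] that M.smult_closed[of a "f (v @ [x] @ w)"] by auto
    note ac = V.smult_closed[simplified]
    have cancel: "((u \<oplus>\<^bsub>M\<^esub> v) \<ominus>\<^bsub>M\<^esub> u) \<ominus>\<^bsub>M\<^esub> v = \<zero>\<^bsub>M\<^esub>"
      if "u \<in> carrier M" "v \<in> carrier M" for u v
      using that M.M.a_comm[of u v] by (simp add: a_minus_def M.M.a_assoc M.M.r_neg M.M.r_neg2)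
    show ?thesis
    proof safe
      fix x y assume "x \<in> carrier V" "y \<in> carrier V"
      then show "sg [x \<oplus>\<^bsub>V\<^esub> y] 1 - sg [x] 1 - sg [y] 1 \<in> K"
        using A(1)[of _ _ x y] c[of _ _ x] c[of _ _ y]
        by (intro KI)
          (auto simp: mdist free_simps(6) em free_minus(2) single M.smult_r_distr[simplified] cancel
            M.smult_closed[simplified])
    next
      fix a x assume "x \<in> carrier V"
      then show "sg [a \<odot>\<^bsub>V\<^esub> x] 1 - sg [x] a \<in> K"
        using A(2)[of _ _ x x a] c[of _ _ x]
        by (intro KI)
          (auto simp: mdist free_simps(6) em single ac free_minus(2) M.smult_assoc1[simplified, symmetric]
            a_minus_def M.M.r_neg mult.commute mult.left_commute)
    qed
  qed
  ultimately have "J \<subseteq> K" unfolding tensor_ideal_def by (rule F.genideal_minimal)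
  then have "p \<in> K" using p by blast
  then have "?e (\<one>\<^bsub>F\<^esub> \<otimes>\<^bsub>F\<^esub> p \<otimes>\<^bsub>F\<^esub> \<one>\<^bsub>F\<^esub>) = \<zero>\<^bsub>M\<^esub>" "p \<in> carrier F" unfolding K_def by blast+
  then show ?thesis by simp
qed

lemma tensor_lift:
  assumes M: "Module.module scalars M" and f: "multilinear M f"
  shows "linear_map T M (tensor_lift M f)"
    and tensor_lift_pure: "\<And>w. w \<in> words \<Longrightarrow> tensor_lift M f (pure_tensor V w) = f w"
proof -
  have fc: "f \<in> words \<rightarrow> carrier M" using f by (simp add: multilinear_def)
  note q = q.factor_linear[OF M free_ext_linear[OF M fc] free_ext_J[OF M f]]
    q.factor_coset[OF M free_ext_linear[OF M fc] free_ext_J[OF M f]]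
  show "linear_map T M (tensor_lift M f)" unfolding tensor_lift_def T_eq by (rule q(1))
  interpret M: Module.module scalars M by (rule M)
  show "tensor_lift M f (pure_tensor V w) = f w" if "w \<in> words" for w
  proof -
    have "f w \<in> carrier M" using fc that by blast
    then show ?thesis
      unfolding tensor_lift_def pure_tensor_def using that
      by (simp add: q(2) free_ext_single[OF M fc] M.smult_one[simplified])
  qed
qed

end


section \<open>Quantum symmetrizers on words\<close>

text \<open>
  Functions on words are elements of the free algebra: \<open>p\<close> stands for the sum of \<open>p w \<cdot> w\<close>. With the
  diagonal braiding \<open>q\<close>, \<open>skew_deriv q i\<close> strips a letter \<open>i\<close> after braiding it to the right end.
\<close>
definition skew_deriv :: "('i \<Rightarrow> 'i \<Rightarrow> 'k::comm_ring_1) \<Rightarrow> 'i \<Rightarrow> ('i list \<Rightarrow> 'k) \<Rightarrow> 'i list \<Rightarrow> 'k"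
  where "skew_deriv q i p u =
    (\<Sum>j\<le>length u. (\<Prod>y\<leftarrow>drop j u. q i y) * p (take j u @ i # drop j u))"

text \<open>Coefficients of the product of the letter \<open>j\<close> with \<open>p\<close> in the
  free algebra; \<open>rmul\<close> has the letter on the right.\<close>

definition lmul :: "'i \<Rightarrow> ('i list \<Rightarrow> 'k::comm_ring_1) \<Rightarrow> 'i list \<Rightarrow> 'k"
  where "lmul j p w = (case w of [] \<Rightarrow> 0 | x # u \<Rightarrow> if x = j then p u else 0)"

definition rmul :: "'i \<Rightarrow> ('i list \<Rightarrow> 'k::comm_ring_1) \<Rightarrow> 'i list \<Rightarrow> 'k"
  where "rmul j p w = (if w \<noteq> [] \<and> last w = j then p (butlast w) else 0)"

text \<open>The diagonal action of the group-like element attached to \<open>i\<close>: the cost of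
  moving \<open>i\<close> across a whole word from left to right.\<close>

definition twist :: "('i \<Rightarrow> 'i \<Rightarrow> 'k::comm_ring_1) \<Rightarrow> 'i \<Rightarrow> ('i list \<Rightarrow> 'k) \<Rightarrow> 'i list \<Rightarrow> 'k"
  where "twist q i p w = (\<Prod>y\<leftarrow>w. q i y) * p w"

lemma skew_deriv_Nil: "skew_deriv q i p [] = p [i]"
  by (simp add: skew_deriv_def)

lemma skew_deriv_Cons:
  "skew_deriv q i p (x # u) = (\<Prod>y\<leftarrow>x # u. q i y) * p (i # x # u) + skew_deriv q i (\<lambda>w. p (x # w)) u"
  by (simp only: skew_deriv_def length_Cons sum.atMost_Suc_shift) simp

lemma skew_deriv_snoc:
  "skew_deriv q i p (u @ [x]) = p (u @ [x, i]) + q i x * skew_deriv q i (\<lambda>w. p (w @ [x])) u"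
proof -
  have "skew_deriv q i p (u @ [x]) = p (u @ [x, i]) +
      (\<Sum>j\<le>length u. (\<Prod>y\<leftarrow>drop j (u @ [x]). q i y) * p (take j (u @ [x]) @ i # drop j (u @ [x])))"
    by (simp add: skew_deriv_def)
  also have "(\<Sum>j\<le>length u. (\<Prod>y\<leftarrow>drop j (u @ [x]). q i y) * p (take j (u @ [x]) @ i # drop j (u @ [x])))
      = q i x * skew_deriv q i (\<lambda>w. p (w @ [x])) u"
    unfolding skew_deriv_def sum_distrib_left by (intro sum.cong) (auto simp: mult_ac)
  finally show ?thesis .
qed

lemma skew_deriv_add: "skew_deriv q i (\<lambda>w. p w + r w) = (\<lambda>w. skew_deriv q i p w + skew_deriv q i r w)"
  by (intro ext) (simp add: skew_deriv_def distrib_left sum.distrib)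

lemma skew_deriv_diff: "skew_deriv q i (\<lambda>w. p w - r w) = (\<lambda>w. skew_deriv q i p w - skew_deriv q i r w)"
  by (intro ext) (simp add: skew_deriv_def right_diff_distrib sum_subtractf)

lemma skew_deriv_scale: "skew_deriv q i (\<lambda>w. c * p w) = (\<lambda>w. c * skew_deriv q i p w)"
  by (intro ext) (simp add: skew_deriv_def sum_distrib_left mult.left_commute)

lemma skew_deriv_zero: "skew_deriv q i (\<lambda>w. 0) = (\<lambda>w. 0)"
  by (intro ext) (simp add: skew_deriv_def)

lemma lmul_linear:
  "lmul j (\<lambda>w. p w + r w) = (\<lambda>w. lmul j p w + lmul j r w)"
  "lmul j (\<lambda>w. p w - r w) = (\<lambda>w. lmul j p w - lmul j r w)"
  "lmul j (\<lambda>w. c * p w) = (\<lambda>w. c * lmul j p w)"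
  "lmul j (\<lambda>w. 0) = (\<lambda>w. 0)"
  by (auto simp: lmul_def fun_eq_iff split: list.split)

lemma rmul_linear:
  "rmul j (\<lambda>w. p w + r w) = (\<lambda>w. rmul j p w + rmul j r w)"
  "rmul j (\<lambda>w. p w - r w) = (\<lambda>w. rmul j p w - rmul j r w)"
  "rmul j (\<lambda>w. c * p w) = (\<lambda>w. c * rmul j p w)"
  "rmul j (\<lambda>w. 0) = (\<lambda>w. 0)"
  by (auto simp: rmul_def fun_eq_iff)

lemma twist_lmul: "twist q i (lmul j p) = (\<lambda>w. q i j * lmul j (twist q i p) w)"
  by (auto simp: lmul_def twist_def fun_eq_iff mult_ac split: list.split)

lemma twist_rmul: "twist q i (rmul j p) = (\<lambda>w. q i j * rmul j (twist q i p) w)"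
proof
  fix w show "twist q i (rmul j p) w = q i j * rmul j (twist q i p) w"
    by (cases w rule: rev_cases) (auto simp: rmul_def twist_def mult_ac)
qed

lemma twist_zero: "twist q i (\<lambda>w. 0) = (\<lambda>w. 0)"
  by (simp add: twist_def fun_eq_iff)

text \<open>Inserting \<open>i\<close> into a word multiplies its weight for \<open>j\<close> by the
  one factor \<open>q j i\<close>, at whatever position.\<close>

lemma skew_deriv_twist: "skew_deriv q i (twist q j p) = (\<lambda>w. q j i * twist q j (skew_deriv q i p) w)"
proof
  fix u
  have "(\<Prod>y\<leftarrow>take k u. q j y) * (\<Prod>y\<leftarrow>drop k u. q j y) = (\<Prod>y\<leftarrow>u. q j y)" for k
    by (metis append_take_drop_id map_append prod_list.append)
  then have "(\<Prod>y\<leftarrow>take k u @ i # drop k u. q j y) = q j i * (\<Prod>y\<leftarrow>u. q j y)" for k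
    by (simp add: mult.left_commute)
  then show "skew_deriv q i (twist q j p) u = q j i * twist q j (skew_deriv q i p) u"
    unfolding skew_deriv_def twist_def sum_distrib_left by (intro sum.cong) (simp_all add: mult_ac)
qed

text \<open>Twisted Leibniz rule. The stripped letter is either one of \<open>p\<close> or the new
  first letter, and the latter must cross all of \<open>p\<close> to reach the right end.\<close>

lemma skew_deriv_lmul:
  "skew_deriv q i (lmul j p) = (\<lambda>w. lmul j (skew_deriv q i p) w + (if i = j then twist q i p w else 0))"
proof
  fix u show "skew_deriv q i (lmul j p) u = lmul j (skew_deriv q i p) u + (if i = j then twist q i p u else 0)"
    by (cases u) (auto simp: skew_deriv_Nil skew_deriv_Cons lmul_def twist_def skew_deriv_zero cong: if_cong)
qed

text \<open>The mirror image of the Leibniz rule: a new last letter is already at the right end,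
  while a letter stripped from \<open>p\<close> must cross it.\<close>

lemma skew_deriv_rmul:
  "skew_deriv q i (rmul j p) = (\<lambda>w. (if i = j then p w else 0) + q i j * rmul j (skew_deriv q i p) w)"
proof
  fix u show "skew_deriv q i (rmul j p) u = (if i = j then p u else 0) + q i j * rmul j (skew_deriv q i p) u"
    by (cases u rule: rev_cases)
      (auto simp: skew_deriv_Nil skew_deriv_snoc rmul_def skew_deriv_zero butlast_append)
qed

definition word_delta :: "'i list \<Rightarrow> 'i list \<Rightarrow> 'k::comm_ring_1"
  where "word_delta u w = (if w = u then 1 else 0)"

lemma lmul_delta: "lmul j (word_delta u) = word_delta (j # u)"
  by (auto simp: fun_eq_iff lmul_def word_delta_def split: list.split)

lemma rmul_delta: "rmul j (word_delta u) = word_delta (u @ [j])"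
proof
  fix w show "rmul j (word_delta u) w = word_delta (u @ [j]) w"
    by (cases w rule: rev_cases) (auto simp: rmul_def word_delta_def)
qed

lemma lmul_delta_Nil: "lmul j (word_delta []) = word_delta [j]"
  by (rule lmul_delta)

lemma skew_deriv_delta_Nil: "skew_deriv q i (word_delta []) = (\<lambda>w. 0)"
  by (simp add: fun_eq_iff skew_deriv_def word_delta_def)

lemma twist_delta_Nil: "twist q i (word_delta []) = word_delta []"
  by (simp add: fun_eq_iff twist_def word_delta_def)

text \<open>\<open>True\<close> stands for v_1 and \<open>False\<close> for v_2. The relation
  \<open>a * b = 1\<close> says that any letter crosses v_1 v_2 with total factor 1.\<close>

locale affine_rank_two =
  fixes a b :: "'k::field" and q :: "bool \<Rightarrow> bool \<Rightarrow> 'k"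
  assumes ab: "a * b = 1" and q: "\<And>i j. q i j = (if i = j then a else b)"
begin

text \<open>
  The commutator with the imaginary root vector \<open>v\<^sub>1 v\<^sub>2 - b v\<^sub>2 v\<^sub>1\<close> of affine \<open>sl\<^sub>2\<close>. Its iterates on
  \<open>v\<^sub>1\<close> are the real root vectors, whose skew derivatives do not degenerate at roots of unity.
\<close>
definition comm_delta :: "(bool list \<Rightarrow> 'k) \<Rightarrow> bool list \<Rightarrow> 'k"
  where "comm_delta p = (\<lambda>w. lmul True (lmul False p) w - b * lmul False (lmul True p) w
    - (rmul False (rmul True p) w - b * rmul True (rmul False p) w))"

definition real_root :: "nat \<Rightarrow> bool list \<Rightarrow> 'k"
  where "real_root k = (comm_delta ^^ k) (word_delta [True])"

lemma q_simps: "q True True = a" "q False False = a" "q True False = b" "q False True = b"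
  by (simp_all add: q)

lemma ab': "b * a = 1" "a * (b * c) = c" "b * (a * c) = c"
  using ab by (simp_all add: mult.commute mult.left_commute flip: mult.assoc)

lemmas operator_simps = skew_deriv_add skew_deriv_diff skew_deriv_scale skew_deriv_lmul skew_deriv_rmul
  lmul_linear rmul_linear twist_lmul twist_rmul q_simps

text \<open>The derivative in v_1 kills D, because both terms give \<open>b\<close> times v_2. A
  letter stripped across D costs \<open>a * b = 1\<close>, so left and right multiplication by D
  behave alike.\<close>

lemma deriv1_comm: "skew_deriv q True (comm_delta p) = comm_delta (skew_deriv q True p)"
  by (simp add: comm_delta_def operator_simps fun_eq_iff algebra_simps ab')

text \<open>The derivative of D in v_2 is \<open>1 - b * b\<close> times v_1: the first term gives
  v_1, the second \<open>b * b\<close> times v_1. This v_1 is left over on either side of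
  \<open>p\<close>; on the left the stripped letter has also crossed \<open>p\<close>, hence the
  twist.\<close>

lemma deriv2_comm: "skew_deriv q False (comm_delta p) = (\<lambda>w. comm_delta (skew_deriv q False p) w +
    (1 - b * b) * (lmul True (twist q False p) w - rmul True p w))"
  by (simp add: comm_delta_def operator_simps fun_eq_iff algebra_simps ab')

lemma twist_twist: "twist q True (twist q False p) = p"
proof
  fix w
  have "(\<Prod>y\<leftarrow>w. q True y) * (\<Prod>y\<leftarrow>w. q False y) = 1"
  proof (induction w)
    case (Cons x w)
    have "q True x * q False x = 1" using ab by (cases x) (simp_all add: q mult.commute)
    then show ?case using Cons by (simp add: mult_ac)
  qed simp
  then show "twist q True (twist q False p) w = p w"
    by (simp add: twist_def flip: mult.assoc)
qed

lemma comm_zero: "comm_delta (\<lambda>w. 0) = (\<lambda>w. 0)"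
  by (simp add: comm_delta_def lmul_linear rmul_linear)

lemma comm_scale: "comm_delta (\<lambda>w. c * p w) = (\<lambda>w. c * comm_delta p w)"
  by (simp add: comm_delta_def lmul_linear rmul_linear fun_eq_iff algebra_simps)

lemma comm_delta_Nil: "comm_delta (word_delta []) = (\<lambda>w. 0)"
  by (simp add: comm_delta_def lmul_delta rmul_delta)

text \<open>The derivative passes through the commutators down to v_1, where it gives the unit, and
  the unit commutes with D.\<close>

lemma deriv1_real_root: "skew_deriv q True (real_root (Suc k)) = (\<lambda>w. 0)"
proof (induction k)
  case 0
  show ?case
    by (simp add: real_root_def deriv1_comm flip: lmul_delta_Nil)
      (simp add: operator_simps skew_deriv_delta_Nil twist_delta_Nil comm_delta_Nil lmul_linear)
next
  case (Suc k)
  then show ?case by (simp add: real_root_def deriv1_comm comm_zero)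
qed

abbreviation "theta p \<equiv> skew_deriv q True (skew_deriv q False p)"

text \<open>Differentiating the correction term of \<open>deriv2_comm\<close> in v_1 produces one
  copy of \<open>p\<close> from each of its two parts, from the first by \<open>twist_twist\<close>.
  The copies cancel, which leaves only terms in the derivative of \<open>p\<close>.\<close>

lemma theta_comm: "theta (comm_delta p) = (\<lambda>w. comm_delta (theta p) w + (1 - b * b) *
    (b * lmul True (twist q False (skew_deriv q True p)) w - a * rmul True (skew_deriv q True p) w))"
  by (simp add: deriv2_comm skew_deriv_add skew_deriv_scale skew_deriv_diff deriv1_comm
      skew_deriv_lmul skew_deriv_rmul skew_deriv_twist q_simps twist_twist lmul_linear)

text \<open>For \<open>k = 0\<close> only the correction in \<open>theta_comm\<close> contributes,
  and v_1 has derivative 1, whence the factor \<open>b - a\<close>. Afterwards the derivative in v_1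
  is zero by \<open>deriv1_real_root\<close>, and \<open>theta\<close> commutes with the
  commutator.\<close>

lemma theta_real_root: "theta (real_root (Suc k)) = (\<lambda>w. (1 - b * b) * (b - a) * real_root k w)"
proof (induction k)
  case 0
  have 1: "skew_deriv q True (word_delta [True]) = word_delta []"
    by (simp add: operator_simps skew_deriv_delta_Nil twist_delta_Nil lmul_linear flip: lmul_delta_Nil)
  have 2: "skew_deriv q False (word_delta [True]) = (\<lambda>w. 0)"
    by (simp add: operator_simps skew_deriv_delta_Nil lmul_linear flip: lmul_delta_Nil)
  show ?case
    by (simp add: real_root_def theta_comm 1 2 skew_deriv_zero comm_zero twist_delta_Nil lmul_delta rmul_delta
        fun_eq_iff algebra_simps)
next
  case (Suc k)
  have "theta (real_root (Suc (Suc k))) = comm_delta (theta (real_root (Suc k)))"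
    using theta_comm[of "real_root (Suc k)"] deriv1_real_root[of k]
    by (simp add: real_root_def twist_zero lmul_linear rmul_linear)
  then show ?case unfolding Suc comm_scale by (simp add: real_root_def)
qed

end


section \<open>Inversions and reduced expressions\<close>

abbreviation (input) "adj i \<equiv> Transposition.transpose i (Suc i)"

definition inversions :: "nat \<Rightarrow> (nat \<Rightarrow> nat) \<Rightarrow> (nat \<times> nat) set"
  where "inversions n \<sigma> = {(l, m). l < m \<and> m < n \<and> \<sigma> m < \<sigma> l}"

lemma finite_inversions [simp]: "finite (inversions n \<sigma>)"
  by (rule finite_subset[of _ "{..<n} \<times> {..<n}"]) (auto simp: inversions_def)

text \<open>\<open>adj i\<close> preserves the order of every pair of positions except
  \<open>(i, Suc i)\<close>, so it merely relabels the inversions of \<open>\<sigma>\<close>; the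
  exceptional pair is an ascent of \<open>\<sigma>\<close> and becomes the one new
  inversion.\<close>

lemma inversions_adj:
  assumes i: "Suc i < n" "\<sigma> i < \<sigma> (Suc i)"
  shows "inversions n (\<sigma> \<circ> adj i) = insert (i, Suc i) (map_prod (adj i) (adj i) ` inversions n \<sigma>)"
    and "(i, Suc i) \<notin> map_prod (adj i) (adj i) ` inversions n \<sigma>"
proof -
  have lt: "adj i l < adj i m" if "l < m" "(l, m) \<noteq> (i, Suc i)" for l m
    using that by (auto simp: Transposition.transpose_def split: if_splits)
  have bd: "adj i m < n" if "m < n" for m
    using that i(1) by (auto simp: Transposition.transpose_def split: if_splits)
  show notin: "(i, Suc i) \<notin> map_prod (adj i) (adj i) ` inversions n \<sigma>"
  proof
    assume "(i, Suc i) \<in> map_prod (adj i) (adj i) ` inversions n \<sigma>"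
    then obtain l m where lm: "(l, m) \<in> inversions n \<sigma>" "i = adj i l" "Suc i = adj i m" by auto
    then have "l = Suc i" "m = i"
      by (auto simp: Transposition.transpose_def split: if_splits)
    then show False using lm(1) by (simp add: inversions_def)
  qed
  show "inversions n (\<sigma> \<circ> adj i) = insert (i, Suc i) (map_prod (adj i) (adj i) ` inversions n \<sigma>)"
  proof (intro Set.set_eqI iffI)
    fix z assume z: "z \<in> inversions n (\<sigma> \<circ> adj i)"
    obtain l m where lm: "z = (l, m)" by fastforce
    show "z \<in> insert (i, Suc i) (map_prod (adj i) (adj i) ` inversions n \<sigma>)"
    proof (cases "z = (i, Suc i)")
      case False
      then have "(adj i l, adj i m) \<in> inversions n \<sigma>"
        using z lt bd unfolding lm by (auto simp: inversions_def)
      then show ?thesis unfolding lm by (auto intro!: image_eqI[of _ _ "(adj i l, adj i m)"])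
    qed simp
  next
    fix z assume z: "z \<in> insert (i, Suc i) (map_prod (adj i) (adj i) ` inversions n \<sigma>)"
    show "z \<in> inversions n (\<sigma> \<circ> adj i)"
    proof (cases "z = (i, Suc i)")
      case True
      then show ?thesis using i by (simp add: inversions_def)
    next
      case False
      then obtain l m where lm: "(l, m) \<in> inversions n \<sigma>" "z = (adj i l, adj i m)" using z by auto
      then have "(l, m) \<noteq> (i, Suc i)" using i by (auto simp: inversions_def)
      then show ?thesis using lm lt[of l m] bd by (auto simp: inversions_def)
    qed
  qed
qed

lemma inj_map_adj: "inj_on (map_prod (adj i) (adj i)) S"
  by (metis inj_on_subset inj_on_transpose map_prod_inj_on subset_UNIV UNIV_Times_UNIV)

lemma card_inversions_adj:
  assumes "Suc i < n" "\<sigma> i < \<sigma> (Suc i)"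
  shows "card (inversions n (\<sigma> \<circ> adj i)) = Suc (card (inversions n \<sigma>))"
  using inversions_adj[OF assms] by (simp add: card_image inj_map_adj)

lemma adj_adj: "(\<sigma> \<circ> adj i) \<circ> adj i = \<sigma>"
  by (simp add: comp_assoc)

lemma card_inversions_adj_desc:
  assumes "Suc i < n" "\<sigma> (Suc i) < \<sigma> i"
  shows "card (inversions n \<sigma>) = Suc (card (inversions n (\<sigma> \<circ> adj i)))"
  using card_inversions_adj[of i n "\<sigma> \<circ> adj i"] assms unfolding adj_adj by simp

lemma expresses_Nil: "expresses n id []"
  by (simp add: expresses_def)

lemma foldr_adj: "foldr (\<lambda>i \<tau>. adj i \<circ> \<tau>) ws \<tau>' = foldr (\<lambda>i \<tau>. adj i \<circ> \<tau>) ws id \<circ> \<tau>'"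
  by (induction ws) (simp_all add: comp_assoc)

text \<open>Words are shortened at the right end because composing with \<open>adj i\<close> on that
  side exchanges positions, the situation of \<open>inversions_adj\<close>.\<close>

lemma expresses_snoc: "expresses n \<sigma> (ws @ [i]) \<longleftrightarrow> Suc i < n \<and> expresses n (\<sigma> \<circ> adj i) ws"
proof -
  have "\<sigma> = \<tau> \<circ> adj i \<longleftrightarrow> \<sigma> \<circ> adj i = \<tau>" for \<tau>
    using adj_adj[of \<sigma> i] adj_adj[of \<tau> i] by auto
  then show ?thesis
    using foldr_adj[of ws "adj i"] by (auto simp: expresses_def)
qed

lemma expresses_permutes: "expresses n \<sigma> ws \<Longrightarrow> \<sigma> permutes {..<n}"
proof (induction ws arbitrary: \<sigma> rule: rev_induct)
  case Nil
  then have "\<sigma> = id" by (simp add: expresses_def)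
  then show ?case by (simp only: permutes_id)
next
  case (snoc i ws)
  then have p: "adj i permutes {..<n}" "(\<sigma> \<circ> adj i) permutes {..<n}"
    by (auto simp: expresses_snoc permutes_swap_id)
  from permutes_compose[OF this] show ?case unfolding adj_adj .
qed

lemma permutes_neq_Suc: "\<sigma> permutes S \<Longrightarrow> \<sigma> i \<noteq> \<sigma> (Suc i)"
  by (simp add: inj_eq permutes_inj)

text \<open>One more letter changes the number of inversions by one, up or down, and the identity
  has none.\<close>

lemma card_inversions_le: "expresses n \<sigma> ws \<Longrightarrow> card (inversions n \<sigma>) \<le> length ws"
proof (induction ws arbitrary: \<sigma> rule: rev_induct)
  case Nil
  have "inversions n id = {}" by (auto simp: inversions_def)
  moreover have "\<sigma> = id" using Nil by (simp add: expresses_def)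
  ultimately show ?case by (simp only: card.empty le0)
next
  case (snoc i ws)
  then have i: "Suc i < n" and e: "expresses n (\<sigma> \<circ> adj i) ws" by (auto simp: expresses_snoc)
  have "card (inversions n \<sigma>) \<le> Suc (card (inversions n (\<sigma> \<circ> adj i)))"
  proof (cases "\<sigma> i < \<sigma> (Suc i)")
    case True
    then show ?thesis using card_inversions_adj[OF i True] by linarith
  next
    case False
    then have "\<sigma> (Suc i) < \<sigma> i"
      using permutes_neq_Suc[OF expresses_permutes[OF snoc.prems], of i] by simp
    then show ?thesis using card_inversions_adj_desc[OF i, of \<sigma>] by linarith
  qed
  also have "\<dots> \<le> Suc (length ws)" using snoc.IH[OF e] by (simp only: Suc_le_mono)
  finally show ?case by simp
qed

text \<open>Values that rise at every step grow at least as fast as the index; being bounded by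
  \<open>n - 1\<close>, they have no room to jump.\<close>

lemma permutes_no_descent:
  assumes p: "\<sigma> permutes {..<n}" and d: "\<And>i. Suc i < n \<Longrightarrow> \<sigma> i < \<sigma> (Suc i)"
  shows "\<sigma> = id"
proof -
  have mono: "\<sigma> l + (m - l) \<le> \<sigma> m" if "l \<le> m" "m < n" for l m
    using that
  proof (induction m rule: dec_induct)
    case (step m)
    then show ?case using d[of m] by simp
  qed simp
  have "\<sigma> l = l" if l: "l < n" for l
  proof -
    have "\<sigma> (n - 1) < n" using p l permutes_in_image[OF p, of "n - 1"] by simp
    moreover have "\<sigma> l + (n - 1 - l) \<le> \<sigma> (n - 1)" using mono[of l "n - 1"] l by simp
    moreover have "l \<le> \<sigma> l" using mono[of 0 l] l by simp
    ultimately show ?thesis using l by simp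
  qed
  then show ?thesis using permutes_not_in[OF p] by (auto simp: fun_eq_iff)
qed

text \<open>Bubble sort: each descent that is undone lowers the number of inversions by exactly
  one.\<close>

lemma expresses_exists:
  "\<sigma> permutes {..<n} \<Longrightarrow> \<exists>ws. expresses n \<sigma> ws \<and> length ws = card (inversions n \<sigma>)"
proof (induction "card (inversions n \<sigma>)" arbitrary: \<sigma> rule: less_induct)
  case less
  show ?case
  proof (cases "\<exists>i. Suc i < n \<and> \<not> \<sigma> i < \<sigma> (Suc i)")
    case False
    then have e: "\<sigma> = id" using permutes_no_descent[OF less.prems] by blast
    have "inversions n id = {}" by (auto simp: inversions_def)
    then show ?thesis using expresses_Nil unfolding e by (intro exI[of _ "[]"]) simp
  next
    case True
    then obtain i where i: "Suc i < n" "\<sigma> (Suc i) < \<sigma> i"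
      using permutes_neq_Suc[OF less.prems] by (metis linorder_neqE_nat)
    note c = card_inversions_adj_desc[OF i]
    have "\<sigma> \<circ> adj i permutes {..<n}"
      using less.prems i by (intro permutes_compose permutes_swap_id) auto
    then obtain ws where "expresses n (\<sigma> \<circ> adj i) ws" "length ws = card (inversions n (\<sigma> \<circ> adj i))"
      using less.hyps[of "\<sigma> \<circ> adj i"] c by auto
    then show ?thesis using i c by (intro exI[of _ "ws @ [i]"]) (simp add: expresses_snoc)
  qed
qed

lemma arg_min_expresses:
  assumes "\<sigma> permutes {..<n}"
  shows "expresses n \<sigma> (arg_min length (expresses n \<sigma>))"
    and "length (arg_min length (expresses n \<sigma>)) = card (inversions n \<sigma>)"
proof -
  obtain ws where ws: "expresses n \<sigma> ws" "length ws = card (inversions n \<sigma>)"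
    using expresses_exists[OF assms] by blast
  note am = arg_min_nat_lemma[of "expresses n \<sigma>" ws length, OF ws(1)]
  then show 1: "expresses n \<sigma> (arg_min length (expresses n \<sigma>))" by blast
  then show "length (arg_min length (expresses n \<sigma>)) = card (inversions n \<sigma>)"
    using am ws card_inversions_le[OF 1] by (metis order_antisym)
qed

text \<open>The last letter of a reduced word is a descent of \<open>\<sigma>\<close>: otherwise the
  prefix would be shorter than the number of inversions of what it expresses. So the prefix is
  reduced again, and the step may assume the ascent that \<open>inversions_adj\<close> asks
  for.\<close>

lemma reduced_induct [consumes 2, case_names Nil snoc]:
  assumes "expresses n \<sigma> ws" "length ws = card (inversions n \<sigma>)" and "P id []"
    and step: "\<And>\<sigma> ws i. expresses n \<sigma> ws \<Longrightarrow> \<sigma> permutes {..<n} \<Longrightarrow> Suc i < n \<Longrightarrow> \<sigma> i < \<sigma> (Suc i) \<Longrightarrow>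
      P \<sigma> ws \<Longrightarrow> P (\<sigma> \<circ> adj i) (ws @ [i])"
  shows "P \<sigma> ws"
  using assms(1,2)
proof (induction ws arbitrary: \<sigma> rule: rev_induct)
  case Nil
  then have "\<sigma> = id" by (simp add: expresses_def)
  then show ?case using assms(3) by (simp only:)
next
  case (snoc i ws)
  let ?\<tau> = "\<sigma> \<circ> adj i"
  have i: "Suc i < n" and e: "expresses n ?\<tau> ws" using snoc.prems by (auto simp: expresses_snoc)
  have desc: "\<sigma> (Suc i) < \<sigma> i"
  proof (rule ccontr)
    assume "\<not> ?thesis"
    then have "\<sigma> i < \<sigma> (Suc i)"
      using permutes_neq_Suc[OF expresses_permutes[OF snoc.prems(1)], of i] by simp
    then show False
      using card_inversions_adj[OF i, of \<sigma>] card_inversions_le[OF e] snoc.prems(2) by simp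
  qed
  then have "length ws = card (inversions n ?\<tau>)"
    using card_inversions_adj_desc[OF i desc] snoc.prems(2) by simp
  then have "P ?\<tau> ws" by (rule snoc.IH[OF e])
  moreover have "?\<tau> i < ?\<tau> (Suc i)" using desc by simp
  ultimately have "P (?\<tau> \<circ> adj i) (ws @ [i])" by (intro step[OF e expresses_permutes[OF e] i])
  then show ?case unfolding adj_adj .
qed


section \<open>The quantum symmetrizer of a diagonal braiding\<close>

text \<open>One factor for each pair of strands that cross, the letter on the left before the
  crossing being the first index. The inversions depend on \<open>\<sigma>\<close> alone, so every
  reduced expression leads to the same coefficient.\<close>

definition braid_coeff :: "('i \<Rightarrow> 'i \<Rightarrow> 'k::comm_ring_1) \<Rightarrow> 'i list \<Rightarrow> (nat \<Rightarrow> nat) \<Rightarrow> 'k"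
  where "braid_coeff q w \<sigma> = (\<Prod>(l, m)\<in>inversions (length w) \<sigma>. q (w ! \<sigma> l) (w ! \<sigma> m))"

text \<open>The coefficient of \<open>w\<close> in the image of \<open>p\<close> under the quantum
  symmetrizer of the diagonal braiding \<open>q\<close>.\<close>

definition word_symm :: "('i \<Rightarrow> 'i \<Rightarrow> 'k::comm_ring_1) \<Rightarrow> ('i list \<Rightarrow> 'k) \<Rightarrow> 'i list \<Rightarrow> 'k"
  where "word_symm q p w =
    (\<Sum>\<sigma>\<in>{\<sigma>. \<sigma> permutes {..<length w}}. braid_coeff q w \<sigma> * p (permute_list \<sigma> w))"

lemma braid_coeff_id: "braid_coeff q w id = 1"
proof -
  have "inversions (length w) id = {}" by (auto simp: inversions_def)
  then show ?thesis by (simp add: braid_coeff_def)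
qed

lemma braid_coeff_adj:
  assumes "Suc i < length w" "\<sigma> i < \<sigma> (Suc i)"
  shows "braid_coeff q w (\<sigma> \<circ> adj i) = braid_coeff q w \<sigma> * q (w ! \<sigma> (Suc i)) (w ! \<sigma> i)"
proof -
  have "(\<Prod>(l, m)\<in>map_prod (adj i) (adj i) ` inversions (length w) \<sigma>.
      q (w ! (\<sigma> \<circ> adj i) l) (w ! (\<sigma> \<circ> adj i) m)) = braid_coeff q w \<sigma>"
    unfolding braid_coeff_def
    by (subst prod.reindex[OF inj_map_adj]) (auto intro!: prod.cong)
  then show ?thesis
    unfolding braid_coeff_def inversions_adj(1)[OF assms]
    using inversions_adj(2)[OF assms] by (simp add: mult.commute)
qed

lemma permute_list_adj:
  "Suc i < length u \<Longrightarrow> permute_list (adj i) u = u[i := u ! Suc i, Suc i := u ! i]"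
  by (rule nth_equalityI)
    (auto simp: permute_list_def nth_list_update Transposition.transpose_def)

lemma word_symm_Nil: "word_symm q p [] = p []"
proof -
  have "{\<sigma>. \<sigma> permutes {..<0::nat}} = {id}" by simp
  then show ?thesis by (simp add: word_symm_def braid_coeff_def inversions_def)
qed

text \<open>For \<open>j \<le> n\<close>, the cycle that moves the last of \<open>Suc n\<close>
  letters to position \<open>j\<close>: one representative for each coset of the permutations of
  \<open>{..<n}\<close>. Above \<open>n\<close> it is the identity, as \<open>permutes\<close>
  requires.\<close>

definition insert_last :: "nat \<Rightarrow> nat \<Rightarrow> nat \<Rightarrow> nat"
  where "insert_last n j l = (if l < j then l else if l = j then n else if l \<le> n then l - 1 else l)"

text \<open>The increasing enumeration of the positions other than \<open>j\<close>, along which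
  \<open>insert_last\<close> is undone.\<close>

definition skip :: "nat \<Rightarrow> nat \<Rightarrow> nat"
  where "skip j l = (if l < j then l else Suc l)"

lemma insert_last_skip: "l < n \<Longrightarrow> insert_last n j (skip j l) = l"
  by (auto simp: insert_last_def skip_def)

lemma skip_less: "skip j l < skip j m \<longleftrightarrow> l < m"
  by (auto simp: skip_def)

lemma skip_cases: "j \<le> n \<Longrightarrow> l < Suc n \<Longrightarrow> l \<noteq> j \<Longrightarrow> \<exists>l'<n. l = skip j l'"
  by (cases "l < j") (auto simp: skip_def intro!: exI[of _ "if l < j then l else l - 1"])

lemma insert_last_permutes:
  assumes j: "j \<le> n" shows "insert_last n j permutes {..<Suc n}"
proof (rule bij_imp_permutes)
  have "inj_on (insert_last n j) {..<Suc n}"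
    using j by (auto simp: inj_on_def insert_last_def split: if_splits)
  moreover have "insert_last n j ` {..<Suc n} \<subseteq> {..<Suc n}"
    using j by (auto simp: insert_last_def)
  ultimately show "bij_betw (insert_last n j) {..<Suc n} {..<Suc n}"
    by (simp add: bij_betw_def endo_inj_surj)
qed (use j in \<open>auto simp: insert_last_def\<close>)

text \<open>\<open>j\<close> is recovered as the position that carries the value \<open>n\<close>;
  surjectivity then follows by counting.\<close>

lemma permutes_Suc_bij:
  "bij_betw (\<lambda>(j, \<sigma>). \<sigma> \<circ> insert_last n j) ({..n} \<times> {\<sigma>. \<sigma> permutes {..<n}}) {\<sigma>. \<sigma> permutes {..<Suc n}}"
proof -
  let ?h = "\<lambda>(j, \<sigma>). \<sigma> \<circ> insert_last n j" and ?D = "{..n} \<times> {\<sigma>. \<sigma> permutes {..<n}}"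
  have last: "(\<sigma> \<circ> insert_last n j) l = n \<longleftrightarrow> l = j" if "\<sigma> permutes {..<n}" "j \<le> n" "l \<le> n" for \<sigma> j l
  proof (cases "l = j")
    case True
    then show ?thesis using permutes_not_in[OF that(1), of n] by (simp add: insert_last_def)
  next
    case False
    then have "insert_last n j l < n" using that by (auto simp: insert_last_def)
    then have "\<sigma> (insert_last n j l) < n" using permutes_in_image[OF that(1)] by auto
    then show ?thesis using False by simp
  qed
  have "inj_on ?h ?D"
  proof (rule inj_onI)
    fix x y assume xy: "x \<in> ?D" "y \<in> ?D" "?h x = ?h y"
    obtain j \<sigma> k \<tau> where e: "x = (j, \<sigma>)" "y = (k, \<tau>)" by fastforce
    have a: "j \<in> {..n}" "k \<in> {..n}" "\<sigma> permutes {..<n}" "\<tau> permutes {..<n}"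
      "\<sigma> \<circ> insert_last n j = \<tau> \<circ> insert_last n k"
      using xy by (auto simp: e)
    have jk: "j = k" using a last[of \<sigma> j j] last[of \<tau> k j] by simp
    have "surj (insert_last n k)" using permutes_surj[OF insert_last_permutes] a by blast
    then have "\<sigma> = \<tau>" using a(5) jk by (auto simp: fun_eq_iff surj_def) metis
    then show "x = y" using jk by (simp add: e)
  qed
  moreover have "?h ` ?D = {\<sigma>. \<sigma> permutes {..<Suc n}}"
  proof (rule card_subset_eq)
    show "finite {\<sigma>. \<sigma> permutes {..<Suc n}}" by (simp add: finite_permutations)
    show "?h ` ?D \<subseteq> {\<sigma>. \<sigma> permutes {..<Suc n}}"
      using insert_last_permutes
      by (auto intro!: permutes_compose intro: permutes_subset[of _ "{..<n}"])
    show "card (?h ` ?D) = card {\<sigma>. \<sigma> permutes {..<Suc n}}"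
      unfolding card_image[OF calculation]
      by (simp add: card_cartesian_product card_permutations[OF refl])
  qed
  ultimately show ?thesis by (simp add: bij_betw_def)
qed

lemma permute_list_insert_last:
  assumes "\<sigma> permutes {..<length w}" "j \<le> length w"
  shows "permute_list (\<sigma> \<circ> insert_last (length w) j) (w @ [i]) =
    take j (permute_list \<sigma> w) @ i # drop j (permute_list \<sigma> w)"
proof (rule nth_equalityI)
  fix l assume "l < length (permute_list (\<sigma> \<circ> insert_last (length w) j) (w @ [i]))"
  then have l: "l < Suc (length w)" by simp
  have s: "\<sigma> m < length w" if "m < length w" for m using permutes_in_image[OF assms(1)] that by auto
  have n: "\<sigma> (length w) = length w" using permutes_not_in[OF assms(1)] by simp
  show "permute_list (\<sigma> \<circ> insert_last (length w) j) (w @ [i]) ! l =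
      (take j (permute_list \<sigma> w) @ i # drop j (permute_list \<sigma> w)) ! l"
    using l assms(2) s n
    by (auto simp: permute_list_def nth_append nth_Cons' insert_last_def less_Suc_eq_le)
qed (use assms in auto)

text \<open>Position \<open>j\<close> carries the largest value \<open>n\<close>, so it is inverted
  with every later position and with no earlier one. The remaining pairs are those of
  \<open>\<sigma>\<close>, with \<open>j\<close> skipped.\<close>

lemma inversions_insert_last:
  assumes "\<sigma> permutes {..<n}" "j \<le> n"
  shows "inversions (Suc n) (\<sigma> \<circ> insert_last n j) =
    map_prod (skip j) (skip j) ` inversions n \<sigma> \<union> (\<lambda>l. (j, Suc l)) ` {j..<n}"
proof (intro Set.set_eqI iffI)
  have s: "\<sigma> m < n" if "m < n" for m using permutes_in_image[OF assms(1)] that by auto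
  have n: "\<sigma> n = n" using permutes_not_in[OF assms(1)] by simp
  have j: "insert_last n j j = n" using assms(2) by (simp add: insert_last_def)
  fix z :: "nat \<times> nat"
  obtain l m where z: "z = (l, m)" by fastforce
  { assume "z \<in> inversions (Suc n) (\<sigma> \<circ> insert_last n j)"
    then have lm: "l < m" "m < Suc n" "\<sigma> (insert_last n j m) < \<sigma> (insert_last n j l)"
      by (auto simp: z inversions_def)
    show "z \<in> map_prod (skip j) (skip j) ` inversions n \<sigma> \<union> (\<lambda>l. (j, Suc l)) ` {j..<n}"
    proof (cases "l = j")
      case True
      then show ?thesis using lm(1,2) by (auto simp: z intro!: image_eqI[of _ _ "m - 1"])
    next
      case False
      then obtain l' where l': "l' < n" "l = skip j l'" using skip_cases[OF assms(2)] lm by (meson less_trans)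
      have "m \<noteq> j" using lm(3) s[of l'] l' by (auto simp: j n insert_last_skip)
      then obtain m' where m': "m' < n" "m = skip j m'" using skip_cases[OF assms(2)] lm by blast
      have "(l', m') \<in> inversions n \<sigma>"
        using lm l' m' by (simp add: inversions_def skip_less insert_last_skip)
      then show ?thesis using l' m' z by force
    qed }
  { assume "z \<in> map_prod (skip j) (skip j) ` inversions n \<sigma> \<union> (\<lambda>l. (j, Suc l)) ` {j..<n}"
    then show "z \<in> inversions (Suc n) (\<sigma> \<circ> insert_last n j)"
    proof
      assume "z \<in> map_prod (skip j) (skip j) ` inversions n \<sigma>"
      then obtain l' m' where "(l', m') \<in> inversions n \<sigma>" "z = (skip j l', skip j m')" by auto
      then show ?thesis by (auto simp: inversions_def skip_less insert_last_skip) (auto simp: skip_def)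
    next
      assume "z \<in> (\<lambda>l. (j, Suc l)) ` {j..<n}"
      then obtain l' where l': "j \<le> l'" "l' < n" "z = (j, Suc l')" by auto
      then have "insert_last n j (Suc l') = l'" by (simp add: insert_last_def)
      then show ?thesis using l' s by (simp add: inversions_def j n)
    qed }
qed

lemma braid_coeff_insert_last:
  assumes "\<sigma> permutes {..<length w}" "j \<le> length w"
  shows "braid_coeff q (w @ [i]) (\<sigma> \<circ> insert_last (length w) j) =
    braid_coeff q w \<sigma> * (\<Prod>y\<leftarrow>drop j (permute_list \<sigma> w). q i y)"
proof -
  let ?n = "length w" and ?c = "insert_last (length w) j"
  have s: "\<sigma> m < ?n" if "m < ?n" for m using permutes_in_image[OF assms(1)] that by auto
  have n: "\<sigma> ?n = ?n" using permutes_not_in[OF assms(1)] by simp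
  have inj: "inj_on (map_prod (skip j) (skip j)) S" for S
    by (auto simp: inj_on_def skip_def split: if_splits)
  have disj: "map_prod (skip j) (skip j) ` inversions ?n \<sigma> \<inter> (\<lambda>l. (j, Suc l)) ` {j..<?n} = {}"
    by (auto simp: skip_def split: if_splits)
  have 1: "(\<Prod>(l, m)\<in>map_prod (skip j) (skip j) ` inversions ?n \<sigma>.
      q ((w @ [i]) ! (\<sigma> \<circ> ?c) l) ((w @ [i]) ! (\<sigma> \<circ> ?c) m)) = braid_coeff q w \<sigma>"
    unfolding braid_coeff_def prod.reindex[OF inj]
    by (intro prod.cong) (auto simp: inversions_def insert_last_skip nth_append s)
  have "(\<Prod>(l, m)\<in>(\<lambda>l. (j, Suc l)) ` {j..<?n}. q ((w @ [i]) ! (\<sigma> \<circ> ?c) l) ((w @ [i]) ! (\<sigma> \<circ> ?c) m))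
      = (\<Prod>l\<in>{j..<?n}. q i (permute_list \<sigma> w ! l))"
    by (subst prod.reindex)
      (auto simp: inj_on_def insert_last_def nth_append s n permute_list_def intro!: prod.cong)
  also have "\<dots> = (\<Prod>y\<leftarrow>drop j (permute_list \<sigma> w). q i y)"
    by (simp add: prod.list_conv_set_nth prod.shift_bounds_nat_ivl[of _ 0 j, simplified] atLeast0LessThan
        prod.atLeastLessThan_shift_0[of _ j] add.commute)
  finally have 2: "(\<Prod>(l, m)\<in>(\<lambda>l. (j, Suc l)) ` {j..<?n}.
      q ((w @ [i]) ! (\<sigma> \<circ> ?c) l) ((w @ [i]) ! (\<sigma> \<circ> ?c) m)) = \<dots>" .
  have "braid_coeff q (w @ [i]) (\<sigma> \<circ> ?c) = (\<Prod>(l, m)\<in>inversions (Suc ?n) (\<sigma> \<circ> ?c).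
      q ((w @ [i]) ! (\<sigma> \<circ> ?c) l) ((w @ [i]) ! (\<sigma> \<circ> ?c) m))"
    by (simp add: braid_coeff_def)
  also have "\<dots> = braid_coeff q w \<sigma> * (\<Prod>y\<leftarrow>drop j (permute_list \<sigma> w). q i y)"
    unfolding inversions_insert_last[OF assms]
    by (subst prod.union_disjoint[OF _ _ disj]) (auto simp: 1[simplified] 2[simplified])
  finally show ?thesis .
qed

text \<open>The symmetrizer in degree \<open>n + 1\<close> factors through the one in degree
  \<open>n\<close>, and the sum over the coset representatives is the skew derivative. Iterated, the
  coefficient at \<open>w\<close> becomes a chain of derivatives in the letters of \<open>w\<close>,
  taken from the right.\<close>

lemma word_symm_snoc: "word_symm q p (w @ [i]) = word_symm q (skew_deriv q i p) w"
proof -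
  let ?n = "length w" and ?S = "\<lambda>n. {\<sigma>::nat \<Rightarrow> nat. \<sigma> permutes {..<n}}"
  let ?t = "\<lambda>\<sigma>. braid_coeff q (w @ [i]) \<sigma> * p (permute_list \<sigma> (w @ [i]))"
  have "word_symm q p (w @ [i]) = (\<Sum>\<sigma>\<in>?S (Suc ?n). ?t \<sigma>)" by (simp add: word_symm_def)
  also have "\<dots> = (\<Sum>(j, \<sigma>)\<in>{..?n} \<times> ?S ?n. ?t (\<sigma> \<circ> insert_last ?n j))"
    using sum.reindex_bij_betw[OF permutes_Suc_bij, of ?t ?n] by (simp add: case_prod_unfold)
  also have "\<dots> = (\<Sum>(j, \<sigma>)\<in>{..?n} \<times> ?S ?n. braid_coeff q w \<sigma> *
      ((\<Prod>y\<leftarrow>drop j (permute_list \<sigma> w). q i y) *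
        p (take j (permute_list \<sigma> w) @ i # drop j (permute_list \<sigma> w))))"
    by (intro sum.cong) (auto simp: braid_coeff_insert_last permute_list_insert_last mult.assoc)
  also have "\<dots> = word_symm q (skew_deriv q i p) w"
    unfolding word_symm_def skew_deriv_def sum_distrib_left sum.cartesian_product[symmetric]
    by (subst sum.swap) simp
  finally show ?thesis .
qed

section \<open>Words at which the symmetrizer does not vanish\<close>

context affine_rank_two
begin

lemma word_symm_real_root:
  "word_symm q (real_root k) (True # concat (replicate k [True, False])) = ((1 - b * b) * (b - a)) ^ k"
proof (induction k)
  case 0
  have "skew_deriv q True (word_delta [True]) [] = (1::'k)"
    by (simp add: skew_deriv_Nil word_delta_def)
  then show ?case
    using word_symm_snoc[of q "real_root 0" "[]" True] by (simp add: word_symm_Nil real_root_def)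
next
  case (Suc k)
  \<comment> \<open>The block is needed at the right end, where it is stripped first: the derivative
    in \<open>False\<close> and then in \<open>True\<close>, together \<open>theta\<close>.\<close>
  have r: "concat (replicate (Suc k) [True, False]) = concat (replicate k [True, False]) @ [True, False]"
    by (metis concat_append concat.simps append_Nil2 replicate_append_same replicate_Suc)
  let ?w = "True # concat (replicate k [True, False])"
  have "word_symm q (real_root (Suc k)) ((?w @ [True]) @ [False]) = word_symm q (theta (real_root (Suc k))) ?w"
    by (simp only: word_symm_snoc)
  also have "\<dots> = (1 - b * b) * (b - a) * word_symm q (real_root k) ?w"
    unfolding theta_real_root word_symm_def sum_distrib_left by (simp add: mult.left_commute)
  finally show ?case unfolding r using Suc by simp
qed

end

text \<open>With \<open>q i i = 1\<close> the skew derivative acts on powers of the letter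
  \<open>i\<close> as the ordinary derivative.\<close>

lemma word_symm_delta_replicate:
  assumes "q i i = (1 :: 'k::{comm_ring_1, ring_char_0})"
  shows "word_symm q (word_delta (replicate n i)) (replicate n i) = fact n"
proof (induction n)
  case 0
  show ?case by (simp add: word_symm_Nil word_delta_def)
next
  case (Suc n)
  have d: "skew_deriv q i (word_delta (replicate n i)) = (\<lambda>w. of_nat n * word_delta (replicate (n - 1) i) w)" for n
  proof (induction n)
    case 0
    show ?case by (simp add: skew_deriv_delta_Nil)
  next
    case (Suc n)
    have r: "rmul i (\<lambda>w. of_nat n * word_delta (replicate (n - 1) i) w) = (\<lambda>w. of_nat n * word_delta (replicate n i) w)"
      by (cases n) (simp_all add: rmul_linear rmul_delta replicate_append_same)
    have "skew_deriv q i (rmul i (word_delta (replicate n i))) =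
        (\<lambda>w. word_delta (replicate n i) w + of_nat n * word_delta (replicate n i) w)"
      unfolding skew_deriv_rmul Suc r by (simp add: assms)
    then show ?case by (simp add: rmul_delta replicate_append_same distrib_right)
  qed
  have "word_symm q (word_delta (replicate (Suc n) i)) (replicate n i @ [i]) =
      (1 + of_nat n) * word_symm q (word_delta (replicate n i)) (replicate n i)"
    unfolding word_symm_snoc d by (simp add: word_symm_def sum_distrib_left mult.left_commute)
  then show ?case using Suc by (simp add: replicate_append_same)
qed


section \<open>Pure tensors and tensor powers\<close>

context tensor_setup
begin

text \<open>A defining relation stays in the ideal when it is multiplied by the words to the left
  and to the right of slot \<open>i\<close>.\<close>

lemma pure_update:
  assumes w: "w \<in> words" "i < length w" and u: "u \<in> carrier V"
  shows "v \<in> carrier V \<Longrightarrow> pure_tensor V (w[i := u \<oplus>\<^bsub>V\<^esub> v]) =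
      pure_tensor V (w[i := u]) \<oplus>\<^bsub>T\<^esub> pure_tensor V (w[i := v])"
    and "pure_tensor V (w[i := a \<odot>\<^bsub>V\<^esub> u]) = a \<odot>\<^bsub>T\<^esub> pure_tensor V (w[i := u])"
proof -
  let ?l = "take i w" and ?r = "drop (Suc i) w"
  have lr: "?l \<in> words" "?r \<in> words" using w by (auto dest: in_set_takeD in_set_dropD)
  have up: "w[i := z] = ?l @ [z] @ ?r" for z using w(2) by (simp add: upd_conv_take_nth_drop)
  have wc: "w[i := z] \<in> words" if "z \<in> carrier V" for z unfolding up using lr that by simp
  have J: "sg ?l 1 \<otimes>\<^bsub>F\<^esub> p \<otimes>\<^bsub>F\<^esub> sg ?r 1 \<in> J" if "p \<in> J" for p
    using J.I_r_closed[OF J.I_l_closed[OF that]] lr by simp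
  have mdist: "sg ?l 1 \<otimes>\<^bsub>F\<^esub> (p - r) \<otimes>\<^bsub>F\<^esub> sg ?r 1 =
      sg ?l 1 \<otimes>\<^bsub>F\<^esub> p \<otimes>\<^bsub>F\<^esub> sg ?r 1 - sg ?l 1 \<otimes>\<^bsub>F\<^esub> r \<otimes>\<^bsub>F\<^esub> sg ?r 1" for p r
    unfolding free_algebra_def by (simp only: monoid_algebra_mult_diff)
  have coset: "J +>\<^bsub>F\<^esub> p = J +>\<^bsub>F\<^esub> r" if "p \<in> carrier F" "r \<in> carrier F" "p - r \<in> J" for p r
    using q.coset_eq[OF that(1,2)] free_minus(1)[OF that(1,2)] that(3) by simp
  { assume v: "v \<in> carrier V"
    have "sg [u \<oplus>\<^bsub>V\<^esub> v] 1 - sg [u] 1 - sg [v] 1 \<in> J" using gens_J u v by blast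
    from J[OF this] have "sg (w[i := u \<oplus>\<^bsub>V\<^esub> v]) 1 - sg (w[i := u]) 1 - sg (w[i := v]) 1 \<in> J"
      by (simp add: mdist free_simps(6) up)
    then have "sg (w[i := u \<oplus>\<^bsub>V\<^esub> v]) 1 - (sg (w[i := u]) 1 + sg (w[i := v]) 1) \<in> J"
      by (simp add: diff_diff_eq)
    moreover have "sg (w[i := u]) 1 + sg (w[i := v]) 1 \<in> carrier F"
      using F.a_closed[OF single_closed[OF wc[OF u]] single_closed[OF wc[OF v]], of 1 1] by (simp add: free_simps(3))
    ultimately have "J +>\<^bsub>F\<^esub> sg (w[i := u \<oplus>\<^bsub>V\<^esub> v]) 1 = J +>\<^bsub>F\<^esub> (sg (w[i := u]) 1 + sg (w[i := v]) 1)"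
      using u v by (intro coset single_closed wc) auto
    then show "pure_tensor V (w[i := u \<oplus>\<^bsub>V\<^esub> v]) =
      pure_tensor V (w[i := u]) \<oplus>\<^bsub>T\<^esub> pure_tensor V (w[i := v])"
      unfolding pure_tensor_def T_eq
      using q.quot_add[OF single_closed[OF wc[OF u]] single_closed[OF wc[OF v]], of 1 1]
      by (simp add: free_simps(3)) }
  have "sg [a \<odot>\<^bsub>V\<^esub> u] 1 - sg [u] a \<in> J" using gens_J u by blast
  from J[OF this] have "sg (w[i := a \<odot>\<^bsub>V\<^esub> u]) 1 - sg (w[i := u]) a \<in> J"
    by (simp add: mdist free_simps(6) up)
  then have "J +>\<^bsub>F\<^esub> sg (w[i := a \<odot>\<^bsub>V\<^esub> u]) 1 = J +>\<^bsub>F\<^esub> sg (w[i := u]) a"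
    using u V.smult_closed[of a u] by (intro coset single_closed wc) auto
  then show "pure_tensor V (w[i := a \<odot>\<^bsub>V\<^esub> u]) = a \<odot>\<^bsub>T\<^esub> pure_tensor V (w[i := u])"
    unfolding pure_tensor_def T_eq
    using q.quot_smult[OF single_closed[OF wc[OF u]], of a 1] by (simp add: free_simps(5))
qed

lemma pure_update_zero:
  assumes w: "w \<in> words" "i < length w"
  shows "pure_tensor V (w[i := \<zero>\<^bsub>V\<^esub>]) = \<zero>\<^bsub>T\<^esub>"
proof -
  have "w[i := \<zero>\<^bsub>V\<^esub>] \<in> words" using w by (auto dest!: set_update_subset_insert[THEN subsetD])
  then show ?thesis
    using pure_update(2)[OF w V.M.zero_closed, of 0] V.smult_l_null[OF V.M.zero_closed]
      Tm.smult_l_null[of "pure_tensor V (w[i := \<zero>\<^bsub>V\<^esub>])"] by simp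
qed

lemma multilinearI:
  assumes "\<And>w. w \<in> words \<Longrightarrow> f w \<in> carrier M"
    and "\<And>w i u v. w \<in> words \<Longrightarrow> i < length w \<Longrightarrow> u \<in> carrier V \<Longrightarrow> v \<in> carrier V \<Longrightarrow>
      f (w[i := u \<oplus>\<^bsub>V\<^esub> v]) = f (w[i := u]) \<oplus>\<^bsub>M\<^esub> f (w[i := v])"
    and "\<And>w i u a. w \<in> words \<Longrightarrow> i < length w \<Longrightarrow> u \<in> carrier V \<Longrightarrow>
      f (w[i := a \<odot>\<^bsub>V\<^esub> u]) = a \<odot>\<^bsub>M\<^esub> f (w[i := u])"
  shows "multilinear M f"
  using assms unfolding multilinear_def by blast

lemma words_update: "w \<in> words \<Longrightarrow> u \<in> carrier V \<Longrightarrow> w[i := u] \<in> words"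
  using set_update_subset_insert[of w i u] by auto

lemma tensor_power_simps:
  "carrier (tensor_power V n) = lin_span T (pure_tensor V ` {vs \<in> words. length vs = n})"
  "add (tensor_power V n) = add T" "zero (tensor_power V n) = zero T"
  "Module.smult (tensor_power V n) = Module.smult T"
  by (simp_all add: tensor_power_def)

lemma tensor_power_submodule: "submodule (carrier (tensor_power V n)) scalars T"
  and pure_tensor_power: "w \<in> words \<Longrightarrow> length w = n \<Longrightarrow> pure_tensor V w \<in> carrier (tensor_power V n)"
proof -
  have "pure_tensor V ` {vs \<in> words. length vs = n} \<subseteq> carrier T" using pure_closed by blast
  note l = lin_span_submodule[OF Tm.module_axioms this]
  show "submodule (carrier (tensor_power V n)) scalars T" using l(1) by (simp add: tensor_power_simps)
  show "w \<in> words \<Longrightarrow> length w = n \<Longrightarrow> pure_tensor V w \<in> carrier (tensor_power V n)"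
    using l(2) by (auto simp: tensor_power_simps)
qed

lemma tensor_power_sub: "carrier (tensor_power V n) \<subseteq> carrier T"
  using Tm.submoduleE(1)[OF tensor_power_submodule] .

lemma tensor_power_module: "Module.module scalars (tensor_power V n)"
proof -
  have "tensor_power V n = T\<lparr>carrier := carrier (tensor_power V n)\<rparr>" by (simp add: tensor_power_def)
  then show ?thesis
    by (subst \<open>tensor_power V n = _\<close>) (rule submodule.submodule_is_module[OF tensor_power_submodule Tm.module_axioms])
qed

lemma linear_on_tensor_power: "linear_map T M f \<Longrightarrow> linear_map (tensor_power V n) M f"
  using tensor_power_sub[of n] unfolding linear_map_def tensor_power_simps(2,4) by blast

lemma tensor_power_linearI:
  assumes f: "linear_map T T f"
    and "\<And>w. w \<in> words \<Longrightarrow> length w = n \<Longrightarrow> f (pure_tensor V w) \<in> carrier (tensor_power V n)"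
  shows "linear_map (tensor_power V n) (tensor_power V n) f"
proof -
  have "f ` carrier (tensor_power V n) \<subseteq> carrier (tensor_power V n)"
    unfolding tensor_power_simps(1)[of n]
  proof (rule linear_map_span[OF Tm.module_axioms Tm.module_axioms f _ tensor_power_submodule[unfolded tensor_power_simps(1)]])
    show "pure_tensor V ` {vs \<in> words. length vs = n} \<subseteq> carrier T" using pure_closed by blast
    show "f ` pure_tensor V ` {vs \<in> words. length vs = n} \<subseteq> lin_span T (pure_tensor V ` {vs \<in> words. length vs = n})"
      using assms(2) unfolding tensor_power_simps(1) by blast
  qed
  then show ?thesis
    using f tensor_power_sub[of n] unfolding linear_map_def tensor_power_simps(2,4) by blast
qed

lemma tensor_power_eqI:
  assumes M: "Module.module scalars M"
    and f: "linear_map (tensor_power V n) M f" and g: "linear_map (tensor_power V n) M g"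
    and e: "\<And>w. w \<in> words \<Longrightarrow> length w = n \<Longrightarrow> f (pure_tensor V w) = g (pure_tensor V w)"
    and t: "t \<in> carrier (tensor_power V n)"
  shows "f t = g t"
proof -
  interpret P: Module.module scalars "tensor_power V n" by (rule tensor_power_module)
  note E = Tm.submoduleE[OF tensor_power_submodule[of n]]
  let ?U = "{t \<in> carrier (tensor_power V n). f t = g t}"
  have "submodule ?U scalars T"
  proof (rule Tm.submoduleI)
    show "?U \<subseteq> carrier T" using E(1) by blast
    have z: "\<zero>\<^bsub>T\<^esub> \<in> carrier (tensor_power V n)" using P.M.zero_closed by (simp add: tensor_power_simps(3))
    have fz: "f \<zero>\<^bsub>T\<^esub> = \<zero>\<^bsub>M\<^esub>" "g \<zero>\<^bsub>T\<^esub> = \<zero>\<^bsub>M\<^esub>"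
      using linear_map_zero[OF P.module_axioms M f] linear_map_zero[OF P.module_axioms M g]
      by (simp_all add: tensor_power_simps(3))
    show "\<zero>\<^bsub>T\<^esub> \<in> ?U" using z fz by simp
    fix a assume a: "a \<in> ?U"
    show "a \<oplus>\<^bsub>T\<^esub> b \<in> ?U" if "b \<in> ?U" for b
      using a that E(5) f g by (simp add: linear_map_def tensor_power_simps(2))
    have sm: "c \<odot>\<^bsub>T\<^esub> a \<in> ?U" for c
      using a E(4)[of c a] f g by (simp add: linear_map_def tensor_power_simps(4))
    then show "c \<odot>\<^bsub>T\<^esub> a \<in> ?U" for c .
    have aT: "a \<in> carrier T" using a E(1) by blast
    have "(- 1) \<odot>\<^bsub>T\<^esub> a \<oplus>\<^bsub>T\<^esub> a = (- 1 + 1) \<odot>\<^bsub>T\<^esub> a"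
      using Tm.smult_l_distr[of "- 1" 1 a] aT Tm.smult_one[OF aT] by simp
    also have "\<dots> = \<zero>\<^bsub>T\<^esub>" using Tm.smult_l_null[OF aT] by simp
    finally have "\<ominus>\<^bsub>T\<^esub> a = (- 1) \<odot>\<^bsub>T\<^esub> a"
      using Tm.M.minus_equality[of "(- 1) \<odot>\<^bsub>T\<^esub> a" a] aT Tm.smult_closed[of "- 1" a] by simp
    then show "\<ominus>\<^bsub>T\<^esub> a \<in> ?U" using sm by simp
  qed
  moreover have "pure_tensor V ` {vs \<in> words. length vs = n} \<subseteq> ?U"
    using e pure_tensor_power by auto
  ultimately have "carrier (tensor_power V n) \<subseteq> ?U"
    unfolding tensor_power_simps(1)[of n] by (rule lin_span_minimal)
  then show ?thesis using t by blast
qed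

end


section \<open>The braiding of a Yetter-Drinfeld module\<close>

context yetter_drinfeld
begin

sublocale tensor_setup V ..

lemma homog_closed: "h \<in> carrier G \<Longrightarrow> v \<in> homog V h \<Longrightarrow> v \<in> carrier V"
  using V.submoduleE(1)[OF homog_submodule] by blast

definition hcomp :: "'g \<Rightarrow> 'v \<Rightarrow> 'v"
  where "hcomp h v = (THE f. f \<in> (\<Pi>\<^sub>E h\<in>carrier G. homog V h) \<and> v = (\<Oplus>\<^bsub>V\<^esub>h\<in>carrier G. f h)) h"

lemma hcomp:
  assumes "v \<in> carrier V"
  shows hcomp_homog: "h \<in> carrier G \<Longrightarrow> hcomp h v \<in> homog V h"
    and hcomp_sum: "(\<Oplus>\<^bsub>V\<^esub>h\<in>carrier G. hcomp h v) = v"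
proof -
  note t = theI'[OF homog_decomposition[OF assms]]
  show "h \<in> carrier G \<Longrightarrow> hcomp h v \<in> homog V h"
    unfolding hcomp_def using conjunct1[OF t] by (rule PiE_mem)
  show "(\<Oplus>\<^bsub>V\<^esub>h\<in>carrier G. hcomp h v) = v"
    unfolding hcomp_def using conjunct2[OF t] by (rule sym)
qed

lemma hcomp_closed: "v \<in> carrier V \<Longrightarrow> h \<in> carrier G \<Longrightarrow> hcomp h v \<in> carrier V"
  using hcomp_homog homog_closed by blast

lemma hcomp_unique:
  assumes f: "\<And>h. h \<in> carrier G \<Longrightarrow> f h \<in> homog V h" and v: "v = (\<Oplus>\<^bsub>V\<^esub>h\<in>carrier G. f h)"
    and h: "h \<in> carrier G"
  shows "hcomp h v = f h"
proof -
  have fc: "f \<in> carrier G \<rightarrow> carrier V" using f homog_closed by blast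
  have "restrict f (carrier G) \<in> (\<Pi>\<^sub>E h\<in>carrier G. homog V h)" using f by auto
  moreover have "v = (\<Oplus>\<^bsub>V\<^esub>h\<in>carrier G. restrict f (carrier G) h)"
    unfolding v using fc by (intro V.M.finsum_cong') auto
  moreover have "v \<in> carrier V" unfolding v using fc by simp
  ultimately have "(THE f. f \<in> (\<Pi>\<^sub>E h\<in>carrier G. homog V h) \<and> v = (\<Oplus>\<^bsub>V\<^esub>h\<in>carrier G. f h)) = restrict f (carrier G)"
    by (intro the1_equality homog_decomposition conjI)
  then show ?thesis using h by (simp add: hcomp_def)
qed

lemma hcomp_linear: assumes h: "h \<in> carrier G" shows "linear_map V V (hcomp h)"
  unfolding linear_map_def
proof (intro conjI ballI allI funcsetI)
  fix u assume u: "u \<in> carrier V"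
  show "hcomp h u \<in> carrier V" using hcomp_closed u h by blast
  have uc: "(\<lambda>h. hcomp h u) \<in> carrier G \<rightarrow> carrier V" using hcomp_closed u by blast
  show "hcomp h (u \<oplus>\<^bsub>V\<^esub> v) = hcomp h u \<oplus>\<^bsub>V\<^esub> hcomp h v" if v: "v \<in> carrier V" for v
  proof (rule hcomp_unique[OF _ _ h])
    have "(\<lambda>h. hcomp h v) \<in> carrier G \<rightarrow> carrier V" using hcomp_closed v by blast
    then show "u \<oplus>\<^bsub>V\<^esub> v = (\<Oplus>\<^bsub>V\<^esub>h\<in>carrier G. hcomp h u \<oplus>\<^bsub>V\<^esub> hcomp h v)"
      using uc V.M.finsum_addf[of "\<lambda>h. hcomp h u" "carrier G" "\<lambda>h. hcomp h v"] by (simp add: hcomp_sum u v)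
  qed (use V.submoduleE(5)[OF homog_submodule] hcomp_homog u v in blast)
  show "hcomp h (a \<odot>\<^bsub>V\<^esub> u) = a \<odot>\<^bsub>V\<^esub> hcomp h u" for a
  proof (rule hcomp_unique[OF _ _ h])
    show "a \<odot>\<^bsub>V\<^esub> u = (\<Oplus>\<^bsub>V\<^esub>h\<in>carrier G. a \<odot>\<^bsub>V\<^esub> hcomp h u)"
      using V.finsum_smult_ldistr[OF finite_G, of a "\<lambda>h. hcomp h u"] uc hcomp_sum[OF u] by simp
  qed (use V.submoduleE(4)[OF homog_submodule] hcomp_homog u in simp)
qed

lemma homog_zero: "h \<in> carrier G \<Longrightarrow> \<zero>\<^bsub>V\<^esub> \<in> homog V h"
  using submodule.axioms(1)[OF homog_submodule] subgroup.one_closed by fastforce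

lemma hcomp_of_homog:
  assumes h: "h \<in> carrier G" and v: "v \<in> homog V h" and k: "k \<in> carrier G"
  shows "hcomp k v = (if k = h then v else \<zero>\<^bsub>V\<^esub>)"
proof (rule hcomp_unique[OF _ _ k])
  show "v = (\<Oplus>\<^bsub>V\<^esub>k\<in>carrier G. if k = h then v else \<zero>\<^bsub>V\<^esub>)"
    using V.M.finsum_singleton[OF h finite_G, of "\<lambda>_. v"] homog_closed[OF h v] by (simp add: eq_commute)
qed (use v homog_zero in auto)

text \<open>The summand for the degree \<open>h\<close> of the braiding in the factors
  \<open>i\<close> and \<open>Suc i\<close>: the first vector contributes its component of degree
  \<open>h\<close>, and \<open>h\<close> acts on the second.\<close>

definition swap_at :: "nat \<Rightarrow> 'g \<Rightarrow> 'v list \<Rightarrow> 'v list"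
  where "swap_at i h w = w[i := act V h (w ! Suc i), Suc i := hcomp h (w ! i)]"

text \<open>Zero outside length \<open>n\<close>, so that the function is multilinear on words of
  all lengths and \<open>tensor_lift\<close> applies.\<close>

definition braid_fun :: "nat \<Rightarrow> nat \<Rightarrow> 'v list \<Rightarrow> ('v list \<Rightarrow>\<^sub>0 'k) set"
  where "braid_fun n i w =
    (if length w = n then \<Oplus>\<^bsub>T\<^esub>h\<in>carrier G. pure_tensor V (swap_at i h w) else \<zero>\<^bsub>T\<^esub>)"

lemma act_closed: "h \<in> carrier G \<Longrightarrow> v \<in> carrier V \<Longrightarrow> act V h v \<in> carrier V"
  by (rule linear_map_closed[OF act_linear])

lemma swap_at_words:
  assumes "w \<in> words" "Suc i < length w" "h \<in> carrier G" shows "swap_at i h w \<in> words"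
proof -
  have "w ! i \<in> carrier V" "w ! Suc i \<in> carrier V"
    using nth_mem[of i w] nth_mem[of "Suc i" w] assms(1,2) by (auto simp del: nth_mem)
  then show ?thesis
    unfolding swap_at_def using assms(1,3) by (intro words_update act_closed hcomp_closed)
qed

text \<open>Each letter enters exactly one letter of the swapped word, and does so linearly: through
  the action, through \<open>hcomp\<close>, or unchanged. This spares
  \<open>braid_fun_multilinear\<close> a distinction by position.\<close>

lemma swap_at_update:
  assumes w: "Suc i < length w" "j < length w"
  obtains j' A where "j' < length w" "\<And>h. h \<in> carrier G \<Longrightarrow> linear_map V V (A h)"
    "\<And>h u. swap_at i h (w[j := u]) = (swap_at i h w)[j' := A h u]"
proof -
  consider "j = i" | "j = Suc i" | "j \<noteq> i" "j \<noteq> Suc i" by blast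
  then show ?thesis
  proof cases
    case 1
    show ?thesis
      by (rule that[of "Suc i" hcomp]) (use w 1 hcomp_linear in \<open>auto simp: swap_at_def list_update_swap[of _ "Suc i"]\<close>)
  next
    case 2
    show ?thesis
      by (rule that[of i "act V"])
        (use w 2 act_linear in \<open>auto simp: swap_at_def list_update_swap[of "Suc i" i]\<close>)
  next
    case 3
    show ?thesis
      by (rule that[of j "\<lambda>h u. u"])
        (use w 3 in \<open>auto simp: swap_at_def linear_map_def list_update_swap[of j]\<close>)
  qed
qed

lemma braid_fun_multilinear:
  assumes i: "Suc i < n" shows "multilinear T (braid_fun n i)"
proof (rule multilinearI)
  have cl: "pure_tensor V (swap_at i h w) \<in> carrier T" if "w \<in> words" "length w = n" "h \<in> carrier G" for w h
    using swap_at_words that i by simp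
  show "braid_fun n i w \<in> carrier T" if "w \<in> words" for w
    using cl[OF that] by (auto simp: braid_fun_def intro!: Tm.M.finsum_closed)
  fix w j u assume w: "w \<in> words" "j < length w" and u: "u \<in> carrier V"
  show "braid_fun n i (w[j := u \<oplus>\<^bsub>V\<^esub> v]) = braid_fun n i (w[j := u]) \<oplus>\<^bsub>T\<^esub> braid_fun n i (w[j := v])"
    if v: "v \<in> carrier V" for v
  proof (cases "length w = n")
    case True
    then obtain j' A where j': "j' < length w" and A: "\<And>h. h \<in> carrier G \<Longrightarrow> linear_map V V (A h)"
      and s: "\<And>h u. swap_at i h (w[j := u]) = (swap_at i h w)[j' := A h u]"
      using swap_at_update[of i w j] i w by blast
    have Ac: "A h z \<in> carrier V" if "h \<in> carrier G" "z \<in> carrier V" for h z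
      using linear_map_closed[OF A] that by blast
    have "pure_tensor V (swap_at i h (w[j := u \<oplus>\<^bsub>V\<^esub> v])) =
        pure_tensor V (swap_at i h (w[j := u])) \<oplus>\<^bsub>T\<^esub> pure_tensor V (swap_at i h (w[j := v]))"
      if h: "h \<in> carrier G" for h
    proof -
      have "A h (u \<oplus>\<^bsub>V\<^esub> v) = A h u \<oplus>\<^bsub>V\<^esub> A h v" using A[OF h] u v by (simp add: linear_map_def)
      then show ?thesis
        unfolding s using j' Ac h u v swap_at_words[OF w(1) _ h, of i] True i
        by (simp add: pure_update(1) swap_at_def)
    qed
    note p = this
    have c: "(\<lambda>h. pure_tensor V (swap_at i h (w[j := z]))) \<in> carrier G \<rightarrow> carrier T" if "z \<in> carrier V" for z
      using cl words_update[OF w(1) that] True by simp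
    have "(\<Oplus>\<^bsub>T\<^esub>h\<in>carrier G. pure_tensor V (swap_at i h (w[j := u \<oplus>\<^bsub>V\<^esub> v]))) =
        (\<Oplus>\<^bsub>T\<^esub>h\<in>carrier G. pure_tensor V (swap_at i h (w[j := u])) \<oplus>\<^bsub>T\<^esub> pure_tensor V (swap_at i h (w[j := v])))"
      using c[OF u] c[OF v] p by (intro Tm.M.finsum_cong') (auto simp: Pi_iff)
    then show ?thesis
      using True Tm.M.finsum_addf[OF c[OF u] c[OF v]] by (simp add: braid_fun_def)
  qed (simp add: braid_fun_def)
  show "braid_fun n i (w[j := a \<odot>\<^bsub>V\<^esub> u]) = a \<odot>\<^bsub>T\<^esub> braid_fun n i (w[j := u])" for a
  proof (cases "length w = n")
    case True
    then obtain j' A where j': "j' < length w" and A: "\<And>h. h \<in> carrier G \<Longrightarrow> linear_map V V (A h)"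
      and s: "\<And>h u. swap_at i h (w[j := u]) = (swap_at i h w)[j' := A h u]"
      using swap_at_update[of i w j] i w by blast
    have "pure_tensor V (swap_at i h (w[j := a \<odot>\<^bsub>V\<^esub> u])) = a \<odot>\<^bsub>T\<^esub> pure_tensor V (swap_at i h (w[j := u]))"
      if h: "h \<in> carrier G" for h
    proof -
      have "A h (a \<odot>\<^bsub>V\<^esub> u) = a \<odot>\<^bsub>V\<^esub> A h u" using A[OF h] u by (simp add: linear_map_def)
      then show ?thesis
        unfolding s using j' linear_map_closed[OF A[OF h] u] swap_at_words[OF w(1) _ h, of i] True i
        by (simp add: pure_update(2) swap_at_def)
    qed
    moreover have c: "(\<lambda>h. pure_tensor V (swap_at i h (w[j := u]))) \<in> carrier G \<rightarrow> carrier T"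
      using cl words_update[OF w(1) u] True by simp
    moreover have "(\<Oplus>\<^bsub>T\<^esub>h\<in>carrier G. pure_tensor V (swap_at i h (w[j := a \<odot>\<^bsub>V\<^esub> u]))) =
        (\<Oplus>\<^bsub>T\<^esub>h\<in>carrier G. a \<odot>\<^bsub>T\<^esub> pure_tensor V (swap_at i h (w[j := u])))"
      using calculation Tm.smult_closed by (intro Tm.M.finsum_cong') (auto simp: Pi_iff)
    ultimately show ?thesis
      using True Tm.finsum_smult_ldistr[OF finite_G _ c, of a] by (simp add: braid_fun_def)
  qed (use Tm.smult_r_null in \<open>simp add: braid_fun_def\<close>)
qed

lemma swap_at_2: "swap_at 0 h [u, v] = [act V h v, hcomp h u]"
  by (simp add: swap_at_def)

lemma braid_fun_tensor_power:
  assumes w: "w \<in> words" "length w = n" and i: "Suc i < n"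
  shows "(\<Oplus>\<^bsub>T\<^esub>h\<in>carrier G. pure_tensor V (swap_at i h w)) \<in> carrier (tensor_power V n)"
proof -
  note E = Tm.submoduleE[OF tensor_power_submodule[of n]]
  have c: "pure_tensor V (swap_at i h w) \<in> carrier (tensor_power V n)" if "h \<in> carrier G" for h
    using swap_at_words[OF w(1)] w i that by (intro pure_tensor_power) (auto simp: swap_at_def)
  have "(\<Oplus>\<^bsub>T\<^esub>h\<in>H. pure_tensor V (swap_at i h w)) \<in> carrier (tensor_power V n)"
    if "finite H" "H \<subseteq> carrier G" for H
    using that
  proof (induction H rule: finite_induct)
    case empty
    show ?case using abelian_monoid.zero_closed[of "tensor_power V n"] tensor_power_module[of n]
      by (simp add: module.axioms abelian_group.axioms tensor_power_simps(3))
  next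
    case (insert h H)
    have "(\<Oplus>\<^bsub>T\<^esub>h\<in>insert h H. pure_tensor V (swap_at i h w)) =
        pure_tensor V (swap_at i h w) \<oplus>\<^bsub>T\<^esub> (\<Oplus>\<^bsub>T\<^esub>h\<in>H. pure_tensor V (swap_at i h w))"
      using insert c E(1) by (intro Tm.M.finsum_insert) auto
    then show ?case using insert c E(5) by simp
  qed
  then show ?thesis using finite_G by blast
qed

lemma tensor_power_braid_fun:
  assumes i: "Suc i < n"
  shows "linear_map (tensor_power V n) (tensor_power V n) (tensor_lift T (braid_fun n i))"
    and "w \<in> words \<Longrightarrow> length w = n \<Longrightarrow>
      tensor_lift T (braid_fun n i) (pure_tensor V w) = (\<Oplus>\<^bsub>T\<^esub>h\<in>carrier G. pure_tensor V (swap_at i h w))"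
proof -
  note l = tensor_lift[OF Tm.module_axioms braid_fun_multilinear[OF i]]
  show e: "tensor_lift T (braid_fun n i) (pure_tensor V w) = (\<Oplus>\<^bsub>T\<^esub>h\<in>carrier G. pure_tensor V (swap_at i h w))"
    if "w \<in> words" "length w = n" for w
    using l(2)[OF that(1)] that(2) by (simp add: braid_fun_def)
  show "linear_map (tensor_power V n) (tensor_power V n) (tensor_lift T (braid_fun n i))"
    by (rule tensor_power_linearI[OF l(1)]) (simp add: e braid_fun_tensor_power i)
qed

abbreviation "braiding \<equiv> yd_braiding G V"

text \<open>The braiding is a \<open>SOME\<close>, so its properties must come from a witness. The
  lift of \<open>braid_fun\<close> is one: on a first vector of degree \<open>h\<close> all summands
  but that of \<open>h\<close> contain a zero factor.\<close>

lemma yd_braiding: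
  shows yd_braiding_linear: "linear_map (tensor_power V 2) (tensor_power V 2) braiding"
    and yd_braiding_homog: "h \<in> carrier G \<Longrightarrow> v \<in> homog V h \<Longrightarrow> w \<in> carrier V \<Longrightarrow>
      braiding (pure_tensor V [v, w]) = pure_tensor V [act V h w, v]"
proof -
  let ?P = "\<lambda>c. linear_map (tensor_power V 2) (tensor_power V 2) c \<and>
    (\<forall>h\<in>carrier G. \<forall>v\<in>homog V h. \<forall>w\<in>carrier V.
      c (pure_tensor V [v, w]) = pure_tensor V [act V h w, v])"
  have "?P (tensor_lift T (braid_fun 2 0))"
  proof (intro conjI ballI)
    show "linear_map (tensor_power V 2) (tensor_power V 2) (tensor_lift T (braid_fun 2 0))"
      by (rule tensor_power_braid_fun) simp
    fix h v w assume a: "h \<in> carrier G" "v \<in> homog V h" "w \<in> carrier V"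
    then have v: "v \<in> carrier V" using homog_closed by blast
    have "tensor_lift T (braid_fun 2 0) (pure_tensor V [v, w]) =
        (\<Oplus>\<^bsub>T\<^esub>k\<in>carrier G. pure_tensor V [act V k w, hcomp k v])"
      using v a by (simp add: tensor_power_braid_fun(2) swap_at_2)
    also have "\<dots> = (\<Oplus>\<^bsub>T\<^esub>k\<in>carrier G. if h = k then pure_tensor V [act V k w, v] else \<zero>\<^bsub>T\<^esub>)"
    proof (rule Tm.M.finsum_cong')
      fix k assume k: "k \<in> carrier G"
      have "pure_tensor V [act V k w, \<zero>\<^bsub>V\<^esub>] = \<zero>\<^bsub>T\<^esub>"
        using pure_update_zero[of "[act V k w, v]" 1] v act_closed[OF k a(3)] by simp
      then show "pure_tensor V [act V k w, hcomp k v] = (if h = k then pure_tensor V [act V k w, v] else \<zero>\<^bsub>T\<^esub>)"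
        using hcomp_of_homog[OF a(1,2) k] by auto
    qed (use v a act_closed in auto)
    also have "\<dots> = pure_tensor V [act V h w, v]"
      using v a act_closed by (intro Tm.M.finsum_singleton finite_G) auto
    finally show "tensor_lift T (braid_fun 2 0) (pure_tensor V [v, w]) = pure_tensor V [act V h w, v]" .
  qed
  then have P: "?P braiding" unfolding yd_braiding_def by (rule someI[of ?P])
  then show "linear_map (tensor_power V 2) (tensor_power V 2) braiding" by blast
  show "h \<in> carrier G \<Longrightarrow> v \<in> homog V h \<Longrightarrow> w \<in> carrier V \<Longrightarrow>
      braiding (pure_tensor V [v, w]) = pure_tensor V [act V h w, v]" using P by blast
qed

lemma yd_braiding_pure:
  assumes u: "u \<in> carrier V" and v: "v \<in> carrier V"
  shows "braiding (pure_tensor V [u, v]) = (\<Oplus>\<^bsub>T\<^esub>h\<in>carrier G. pure_tensor V [act V h v, hcomp h u])"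
proof -
  let ?f = "\<lambda>u. braiding (pure_tensor V [u, v])"
  have p: "pure_tensor V [u, v] \<in> carrier (tensor_power V 2)" if "u \<in> carrier V" for u
    using that v by (intro pure_tensor_power) auto
  have "linear_map V T ?f"
    unfolding linear_map_def
  proof (intro conjI ballI allI funcsetI)
    fix x assume x: "x \<in> carrier V"
    show "?f x \<in> carrier T"
      using linear_map_closed[OF yd_braiding_linear p[OF x]] tensor_power_sub by blast
    show "?f (x \<oplus>\<^bsub>V\<^esub> y) = ?f x \<oplus>\<^bsub>T\<^esub> ?f y" if y: "y \<in> carrier V" for y
      using pure_update(1)[of "[x, v]" 0 x y] x y v yd_braiding_linear p[OF x] p[OF y]
      by (simp add: linear_map_def tensor_power_simps(2))
    show "?f (a \<odot>\<^bsub>V\<^esub> x) = a \<odot>\<^bsub>T\<^esub> ?f x" for a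
      using pure_update(2)[of "[x, v]" 0 x a] x v yd_braiding_linear p[OF x]
      by (simp add: linear_map_def tensor_power_simps(4))
  qed
  then have "?f (\<Oplus>\<^bsub>V\<^esub>h\<in>carrier G. hcomp h u) = (\<Oplus>\<^bsub>T\<^esub>h\<in>carrier G. ?f (hcomp h u))"
    using hcomp_closed[OF u] by (intro linear_map_finsum V.module_axioms Tm.module_axioms finite_G) auto
  also have "\<dots> = (\<Oplus>\<^bsub>T\<^esub>h\<in>carrier G. pure_tensor V [act V h v, hcomp h u])"
    using act_closed v hcomp_closed[OF u] yd_braiding_homog hcomp_homog[OF u]
    by (intro Tm.M.finsum_cong') auto
  finally show ?thesis by (simp add: hcomp_sum[OF u])
qed

text \<open>Again a witness for \<open>SOME\<close>: splitting the first of the two vectors into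
  homogeneous components turns the product of three tensors into the sum over
  \<open>swap_at\<close>.\<close>

lemma braid_at:
  assumes i: "Suc i < n"
  shows braid_at_linear: "linear_map (tensor_power V n) (tensor_power V n) (braid_at V braiding n i)"
    and braid_at_pure: "\<And>w. w \<in> words \<Longrightarrow> length w = n \<Longrightarrow>
      braid_at V braiding n i (pure_tensor V w) = (\<Oplus>\<^bsub>T\<^esub>h\<in>carrier G. pure_tensor V (swap_at i h w))"
proof -
  let ?P = "\<lambda>f. linear_map (tensor_power V n) (tensor_power V n) f \<and>
    (\<forall>vs\<in>lists (carrier V). length vs = n \<longrightarrow>
      f (pure_tensor V vs) =
        pure_tensor V (take i vs) \<otimes>\<^bsub>tensor_algebra V\<^esub>
        braiding (pure_tensor V [vs ! i, vs ! Suc i]) \<otimes>\<^bsub>tensor_algebra V\<^esub>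
        pure_tensor V (drop (Suc (Suc i)) vs))"
  have e: "pure_tensor V (take i w) \<otimes>\<^bsub>T\<^esub> braiding (pure_tensor V [w ! i, w ! Suc i]) \<otimes>\<^bsub>T\<^esub>
      pure_tensor V (drop (Suc (Suc i)) w) = (\<Oplus>\<^bsub>T\<^esub>h\<in>carrier G. pure_tensor V (swap_at i h w))"
    if w: "w \<in> words" "length w = n" for w
  proof -
    have wi: "w ! i \<in> carrier V" "w ! Suc i \<in> carrier V"
      using nth_mem[of i w] nth_mem[of "Suc i" w] w i by (auto simp del: nth_mem)
    have lr: "take i w \<in> words" "drop (Suc (Suc i)) w \<in> words"
      using w by (auto dest: in_set_takeD in_set_dropD)
    let ?p = "\<lambda>h. pure_tensor V [act V h (w ! Suc i), hcomp h (w ! i)]"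
    have pc: "[act V h (w ! Suc i), hcomp h (w ! i)] \<in> words" if "h \<in> carrier G" for h
      using that wi act_closed hcomp_closed by simp
    then have p: "?p \<in> carrier G \<rightarrow> carrier T" by auto
    have sw: "take i w @ [act V h (w ! Suc i), hcomp h (w ! i)] @ drop (Suc (Suc i)) w = swap_at i h w" for h
    proof -
      have "w = take i w @ w ! i # w ! Suc i # drop (Suc (Suc i)) w"
        using i w(2) by (simp add: Cons_nth_drop_Suc)
      moreover have "(l @ a # b # r)[length l := x, Suc (length l) := y] = l @ [x, y] @ r" for l a b r x and y :: 'v
        by (simp add: list_update_append)
      ultimately have "w[length (take i w) := x, Suc (length (take i w)) := y] = take i w @ [x, y] @ drop (Suc (Suc i)) w" for x y
        by metis
      then show ?thesis using i w(2) by (simp add: swap_at_def)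
    qed
    have "pure_tensor V (take i w) \<otimes>\<^bsub>T\<^esub> (\<Oplus>\<^bsub>T\<^esub>h\<in>carrier G. ?p h) \<otimes>\<^bsub>T\<^esub> pure_tensor V (drop (Suc (Suc i)) w)
        = (\<Oplus>\<^bsub>T\<^esub>h\<in>carrier G. pure_tensor V (take i w) \<otimes>\<^bsub>T\<^esub> ?p h \<otimes>\<^bsub>T\<^esub> pure_tensor V (drop (Suc (Suc i)) w))"
      using T.finsum_rdistr[OF finite_G pure_closed[OF lr(1)] p]
        T.finsum_ldistr[OF finite_G pure_closed[OF lr(2)], of "\<lambda>h. pure_tensor V (take i w) \<otimes>\<^bsub>T\<^esub> ?p h"] p lr
      by (simp add: Pi_iff)
    also have "\<dots> = (\<Oplus>\<^bsub>T\<^esub>h\<in>carrier G. pure_tensor V (swap_at i h w))"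
    proof (rule Tm.M.finsum_cong')
      show "(\<lambda>h. pure_tensor V (swap_at i h w)) \<in> carrier G \<rightarrow> carrier T"
        using swap_at_words w i by simp
      show "pure_tensor V (take i w) \<otimes>\<^bsub>T\<^esub> ?p h \<otimes>\<^bsub>T\<^esub> pure_tensor V (drop (Suc (Suc i)) w) =
          pure_tensor V (swap_at i h w)" if h: "h \<in> carrier G" for h
        using lr pc[OF h] sw[of h] by (simp add: pure_mult del: append_Cons Cons_in_lists_iff)
    qed simp
    finally show ?thesis unfolding yd_braiding_pure[OF wi] .
  qed
  have "?P (tensor_lift T (braid_fun n i))"
    using tensor_power_braid_fun[OF i] e by simp
  then have P: "?P (braid_at V braiding n i)" unfolding braid_at_def by (rule someI[of ?P])
  then show "linear_map (tensor_power V n) (tensor_power V n) (braid_at V braiding n i)" by blast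
  show "braid_at V braiding n i (pure_tensor V w) = (\<Oplus>\<^bsub>T\<^esub>h\<in>carrier G. pure_tensor V (swap_at i h w))"
    if "w \<in> words" "length w = n" for w using P e that by simp
qed

end


section \<open>Coordinate functionals on the Nichols algebra\<close>

text \<open>The field as a vector space over itself, so that functionals are instances of
  \<open>linear_map\<close>.\<close>

definition scalar_module :: "('k::field, 'k) module"
  where "scalar_module = \<lparr>carrier = UNIV, mult = (*), one = 1, zero = 0, add = (+), module.smult = (*)\<rparr>"

lemma scalar_module_simps [simp]:
  "carrier scalar_module = UNIV" "zero scalar_module = 0" "add scalar_module = (+)"
  "Module.smult scalar_module = (*)"
  by (simp_all add: scalar_module_def)

lemma module_scalar_module: "Module.module scalars (scalar_module :: ('k::field, 'k) module)"
proof (rule moduleI)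
  show "abelian_group (scalar_module :: ('k, 'k) module)"
  proof (rule abelian_groupI)
    show "\<exists>y\<in>carrier scalar_module. y \<oplus>\<^bsub>scalar_module\<^esub> x = \<zero>\<^bsub>scalar_module\<^esub>" for x :: 'k
      by (intro bexI[of _ "- x"]) auto
  qed (auto simp: add_ac)
qed (auto simp: cring_from_type_algebra algebra_simps)

lemma linear_map_compose:
  "linear_map U V f \<Longrightarrow> linear_map V W g \<Longrightarrow> linear_map U W (\<lambda>u. g (f u))"
  unfolding linear_map_def by (simp add: Pi_iff)

lemma linear_functional_simps:
  assumes "linear_map M scalar_module f"
  shows "u \<in> carrier M \<Longrightarrow> v \<in> carrier M \<Longrightarrow> f (u \<oplus>\<^bsub>M\<^esub> v) = f u + f v"
    and "u \<in> carrier M \<Longrightarrow> f (a \<odot>\<^bsub>M\<^esub> u) = a * f u"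
  using assms by (auto simp: linear_map_def)

lemma linear_functional_sum:
  assumes "\<And>i. linear_map M scalar_module (f i)"
  shows "linear_map M scalar_module (\<lambda>t. \<Sum>i\<in>I. c i * f i t)"
  using assms unfolding linear_map_def
  by (simp add: distrib_left sum.distrib sum_distrib_left mult.left_commute)

lemma linear_functional_scale:
  "linear_map M scalar_module f \<Longrightarrow> linear_map M scalar_module (\<lambda>t. c * f t)"
  unfolding linear_map_def by (simp add: distrib_left mult.left_commute)

lemma finsum_scalar_module: "finite I \<Longrightarrow> (\<Oplus>\<^bsub>scalar_module\<^esub>i\<in>I. t i) = (\<Sum>i\<in>I. t i :: 'k::field)"
proof (induction I rule: finite_induct)
  interpret K: Module.module scalars "scalar_module :: ('k, 'k) module" by (rule module_scalar_module)
  case empty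
  show ?case using K.M.finsum_empty[of t] by (simp only: sum.empty scalar_module_simps)
next
  interpret K: Module.module scalars "scalar_module :: ('k, 'k) module" by (rule module_scalar_module)
  case (insert i I)
  have "(\<Oplus>\<^bsub>scalar_module\<^esub>i\<in>insert i I. t i) = t i + (\<Oplus>\<^bsub>scalar_module\<^esub>i\<in>I. t i)"
    using K.M.finsum_insert[OF insert(1,2), of t] by (simp only: Pi_UNIV UNIV_I scalar_module_simps simp_thms)
  then show ?case using insert by (simp only: sum.insert[OF insert(1,2)])
qed

lemma linear_functional_finsum:
  assumes M: "Module.module scalars M" and f: "linear_map M scalar_module f"
    and "finite I" "s \<in> I \<rightarrow> carrier M"
  shows "f (\<Oplus>\<^bsub>M\<^esub>i\<in>I. s i) = (\<Sum>i\<in>I. f (s i))"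
  using linear_map_finsum[OF M module_scalar_module assms(2-4)] finsum_scalar_module[OF assms(3)] by (rule trans)
lemma linear_functional_kernel_span:
  assumes M: "Module.module scalars M" and f: "linear_map M scalar_module f"
    and S: "S \<subseteq> carrier M" "\<And>s. s \<in> S \<Longrightarrow> f s = 0" and v: "v \<in> lin_span M S"
  shows "f v = 0"
proof -
  interpret K: Module.module scalars "scalar_module :: ('a, 'a) module" by (rule module_scalar_module)
  have "submodule {0} scalars (scalar_module :: ('a, 'a) module)"
    using K.M.minus_equality[of 0 0] by (intro K.submoduleI) auto
  from linear_map_span[OF M module_scalar_module f S(1) this] S(2) v show ?thesis by blast
qed

text \<open>
  The span of the homogeneous vectors \<open>x i\<close> is a braided subspace with diagonal braiding \<open>q\<close>; it is
  encoded by the coordinate functionals \<open>\<phi> i\<close>, which vanish on the other homogeneous components.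
\<close>
locale diagonal_part = yetter_drinfeld G V
  for G :: "('g, 'b) monoid_scheme" and V :: "('k::field, 'v, 'g, 'm) yd_module_scheme" +
  fixes gs :: "'i \<Rightarrow> 'g" and x :: "'i \<Rightarrow> 'v" and \<phi> :: "'i \<Rightarrow> 'v \<Rightarrow> 'k" and q :: "'i \<Rightarrow> 'i \<Rightarrow> 'k"
  assumes gs: "gs i \<in> carrier G" and x: "x i \<in> carrier V"
    and \<phi>_linear: "linear_map V scalar_module (\<phi> i)"
    and \<phi>_homog: "\<lbrakk>h \<in> carrier G; h \<noteq> gs i; v \<in> homog V h\<rbrakk> \<Longrightarrow> \<phi> i v = 0"
    and \<phi>_act: "v \<in> carrier V \<Longrightarrow> \<phi> i (act V (gs j) v) = q j i * \<phi> i v"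
    and \<phi>_x: "\<phi> i (x j) = (if i = j then 1 else 0)"
begin

abbreviation "K \<equiv> scalar_module :: ('k, 'k) module"

lemma \<phi>_hcomp: assumes "v \<in> carrier V" "h \<in> carrier G"
  shows "\<phi> i (hcomp h v) = (if h = gs i then \<phi> i v else 0)"
proof -
  have z: "\<phi> i (hcomp k v) = 0" if "k \<in> carrier G" "k \<noteq> gs i" for k
    using \<phi>_homog[OF that] hcomp_homog[OF assms(1)] that by blast
  have "\<phi> i v = \<phi> i (\<Oplus>\<^bsub>V\<^esub>h\<in>carrier G. hcomp h v)" by (simp add: hcomp_sum[OF assms(1)])
  also have "\<dots> = (\<Sum>h\<in>carrier G. \<phi> i (hcomp h v))"
    using hcomp_closed[OF assms(1)]
    by (intro linear_functional_finsum[OF V.module_axioms \<phi>_linear finite_G]) auto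
  also have "\<dots> = (\<Sum>h\<in>carrier G. if h = gs i then \<phi> i (hcomp (gs i) v) else 0)"
    using z by (intro sum.cong) auto
  also have "\<dots> = \<phi> i (hcomp (gs i) v)" using finite_G gs by simp
  finally show ?thesis using z assms(2) by auto
qed

text \<open>The tensor product of the coordinate functionals along \<open>w\<close>. Its vanishing
  on other lengths makes \<open>coord w\<close> vanish on all other tensor powers.\<close>

definition word_fun :: "'i list \<Rightarrow> 'v list \<Rightarrow> 'k"
  where "word_fun w vs = (if length vs = length w then \<Prod>l<length w. \<phi> (w ! l) (vs ! l) else 0)"

lemma word_fun_update:
  assumes "j < length vs"
  shows "word_fun w (vs[j := u]) = (if length vs = length w
    then \<phi> (w ! j) u * (\<Prod>l\<in>{..<length w} - {j}. \<phi> (w ! l) (vs ! l)) else 0)"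
proof (cases "length vs = length w")
  case True
  have "(\<Prod>l<length w. \<phi> (w ! l) (vs[j := u] ! l)) =
      \<phi> (w ! j) (vs[j := u] ! j) * (\<Prod>l\<in>{..<length w} - {j}. \<phi> (w ! l) (vs[j := u] ! l))"
    using assms True by (intro prod.remove) auto
  also have "\<dots> = \<phi> (w ! j) u * (\<Prod>l\<in>{..<length w} - {j}. \<phi> (w ! l) (vs ! l))"
    using assms by (intro arg_cong2[of _ _ _ _ "(*)"] prod.cong) auto
  finally show ?thesis using True by (simp add: word_fun_def)
qed (simp add: word_fun_def)

lemma word_fun_multilinear: "multilinear K (word_fun w)"
  by (rule multilinearI)
    (auto simp: word_fun_update linear_functional_simps[OF \<phi>_linear] distrib_right mult.assoc)

definition coord :: "'i list \<Rightarrow> ('v list \<Rightarrow>\<^sub>0 'k) set \<Rightarrow> 'k"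
  where "coord w = tensor_lift K (word_fun w)"

lemma coord_linear: "linear_map T K (coord w)"
  and coord_pure: "vs \<in> words \<Longrightarrow> coord w (pure_tensor V vs) = word_fun w vs"
  unfolding coord_def
  by (rule tensor_lift(1)[OF module_scalar_module word_fun_multilinear])
    (rule tensor_lift(2)[OF module_scalar_module word_fun_multilinear])

lemma coord_other_degree:
  assumes t: "t \<in> carrier (tensor_power V n)" and n: "n \<noteq> length w" shows "coord w t = 0"
proof (rule linear_functional_kernel_span[OF Tm.module_axioms coord_linear])
  show "pure_tensor V ` {vs \<in> words. length vs = n} \<subseteq> carrier T" using pure_closed by blast
  show "t \<in> lin_span T (pure_tensor V ` {vs \<in> words. length vs = n})"
    using t unfolding tensor_power_simps(1) .
  fix s assume "s \<in> pure_tensor V ` {vs \<in> words. length vs = n}"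
  then obtain vs where vs: "vs \<in> words" "length vs = n" "s = pure_tensor V vs" by blast
  have "coord w s = word_fun w vs" unfolding vs(3) by (rule coord_pure[OF vs(1)])
  also have "\<dots> = 0" using vs(2) n by (simp only: word_fun_def if_False simp_thms)
  finally show "coord w s = 0" .
qed

text \<open>Only \<open>h = gs j\<close> contributes, since \<open>\<phi> j\<close> sees no other
  degree, and \<open>\<phi> i\<close> is an eigenvector for the action of
  \<open>gs j\<close>.\<close>

lemma sum_act_hcomp:
  assumes "u \<in> carrier V" "v \<in> carrier V"
  shows "(\<Sum>h\<in>carrier G. \<phi> i (act V h v) * \<phi> j (hcomp h u)) = q j i * \<phi> i v * \<phi> j u"
proof -
  have "(\<Sum>h\<in>carrier G. \<phi> i (act V h v) * \<phi> j (hcomp h u)) =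
      (\<Sum>h\<in>carrier G. if h = gs j then \<phi> i (act V (gs j) v) * \<phi> j u else 0)"
    using \<phi>_hcomp[OF assms(1)] by (intro sum.cong) auto
  also have "\<dots> = q j i * \<phi> i v * \<phi> j u" using finite_G gs \<phi>_act[OF assms(2)] by simp
  finally show ?thesis .
qed

text \<open>On a pure tensor the slots \<open>i\<close> and \<open>Suc i\<close> give the sum of
  \<open>sum_act_hcomp\<close>, and the other slots factor out. The indices of \<open>q\<close>
  follow the order before the braiding, hence appear exchanged with respect to
  \<open>w\<close>.\<close>

lemma coord_braid_at:
  assumes i: "Suc i < length w" and t: "t \<in> carrier (tensor_power V (length w))"
  shows "coord w (braid_at V braiding (length w) i t) =
    q (w ! Suc i) (w ! i) * coord (permute_list (adj i) w) t"
proof -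
  let ?n = "length w" and ?w = "w[i := w ! Suc i, Suc i := w ! i]"
  let ?f = "\<lambda>t. coord w (braid_at V braiding ?n i t)" and ?g = "\<lambda>t. q (w ! Suc i) (w ! i) * coord ?w t"
  note bl = braid_at_linear[OF i] and cl = linear_on_tensor_power[OF coord_linear, of ?n]
  have "?f t = ?g t"
  proof (rule tensor_power_eqI[OF module_scalar_module _ _ _ t])
    show "linear_map (tensor_power V ?n) K ?f"
      by (rule linear_map_compose[OF bl cl])
    show "linear_map (tensor_power V ?n) K ?g"
      by (rule linear_functional_scale[OF cl])
    fix vs assume vs: "vs \<in> words" "length vs = ?n"
    have vi: "vs ! i \<in> carrier V" "vs ! Suc i \<in> carrier V"
      using nth_mem[of i vs] nth_mem[of "Suc i" vs] vs i by (auto simp del: nth_mem)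
    let ?R = "\<Prod>l\<in>{..<?n} - {i} - {Suc i}. \<phi> (w ! l) (vs ! l)"
    have split: "prod F {..<?n} = F i * (F (Suc i) * prod F ({..<?n} - {i} - {Suc i}))" for F :: "nat \<Rightarrow> 'k"
      using i prod.remove[of "{..<?n}" i F] prod.remove[of "{..<?n} - {i}" "Suc i" F] by simp
    have "?f (pure_tensor V vs) = coord w (\<Oplus>\<^bsub>T\<^esub>h\<in>carrier G. pure_tensor V (swap_at i h vs))"
      using braid_at_pure[OF i vs] by simp
    also have "\<dots> = (\<Sum>h\<in>carrier G. coord w (pure_tensor V (swap_at i h vs)))"
      using swap_at_words[OF vs(1)] vs(2) i
      by (intro linear_functional_finsum[OF Tm.module_axioms coord_linear finite_G]) auto
    also have "\<dots> = (\<Sum>h\<in>carrier G. \<phi> (w ! i) (act V h (vs ! Suc i)) * \<phi> (w ! Suc i) (hcomp h (vs ! i)) * ?R)"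
    proof (rule sum.cong[OF refl])
      fix h assume h: "h \<in> carrier G"
      have "coord w (pure_tensor V (swap_at i h vs)) = (\<Prod>l<?n. \<phi> (w ! l) (swap_at i h vs ! l))"
        using coord_pure[OF swap_at_words[OF vs(1) _ h]] vs(2) i by (simp add: word_fun_def swap_at_def)
      also have "\<dots> = \<phi> (w ! i) (act V h (vs ! Suc i)) * \<phi> (w ! Suc i) (hcomp h (vs ! i)) *
          (\<Prod>l\<in>{..<?n} - {i} - {Suc i}. \<phi> (w ! l) (swap_at i h vs ! l))"
        unfolding split using i vs(2) by (simp add: swap_at_def mult.assoc)
      also have "(\<Prod>l\<in>{..<?n} - {i} - {Suc i}. \<phi> (w ! l) (swap_at i h vs ! l)) = ?R"
        by (intro prod.cong) (auto simp: swap_at_def)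
      finally show "coord w (pure_tensor V (swap_at i h vs)) =
        \<phi> (w ! i) (act V h (vs ! Suc i)) * \<phi> (w ! Suc i) (hcomp h (vs ! i)) * ?R" .
    qed
    also have "\<dots> = q (w ! Suc i) (w ! i) * (\<phi> (w ! i) (vs ! Suc i) * \<phi> (w ! Suc i) (vs ! i) * ?R)"
      unfolding sum_distrib_right[symmetric] sum_act_hcomp[OF vi] by (simp add: mult.assoc)
    also have "\<phi> (w ! i) (vs ! Suc i) * \<phi> (w ! Suc i) (vs ! i) * ?R = (\<Prod>l<?n. \<phi> (?w ! l) (vs ! l))"
    proof -
      have "(\<Prod>l\<in>{..<?n} - {i} - {Suc i}. \<phi> (?w ! l) (vs ! l)) = ?R" by (intro prod.cong) auto
      then show ?thesis unfolding split using i by (simp add: mult_ac)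
    qed
    also have "\<dots> = coord ?w (pure_tensor V vs)" using coord_pure[OF vs(1)] vs(2) by (simp add: word_fun_def)
    finally show "?f (pure_tensor V vs) = ?g (pure_tensor V vs)" .
  qed
  then show ?thesis using permute_list_adj[OF i] by simp
qed

text \<open>Induction over the reduced word. Its last letter acts on the tensor first, so
  \<open>t\<close> must vary in the induction; each step adds the factor of the new
  inversion.\<close>

lemma coord_braid_perm:
  assumes \<sigma>: "\<sigma> permutes {..<length w}" and t: "t \<in> carrier (tensor_power V (length w))"
  shows "braid_perm V braiding (length w) \<sigma> t \<in> carrier (tensor_power V (length w)) \<and>
    coord w (braid_perm V braiding (length w) \<sigma> t) = braid_coeff q w \<sigma> * coord (permute_list \<sigma> w) t"
proof -
  let ?n = "length w" and ?F = "\<lambda>ws. foldr (\<lambda>i f. braid_at V braiding (length w) i \<circ> f) ws id"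
  have F: "?F (ws @ [i]) t = ?F ws (braid_at V braiding ?n i t)" for ws i t
    by (induction ws) simp_all
  have "?F ws t \<in> carrier (tensor_power V ?n) \<and> coord w (?F ws t) = braid_coeff q w \<sigma> * coord (permute_list \<sigma> w) t"
    if "expresses ?n \<sigma> ws" "length ws = card (inversions ?n \<sigma>)" for ws
    using that t
  proof (induction arbitrary: t rule: reduced_induct)
    case Nil
    then show ?case
      by (simp add: braid_coeff_id[unfolded id_def] permute_list_id[unfolded id_def])
  next
    case (snoc \<sigma> ws i)
    let ?t = "braid_at V braiding ?n i t"
    have t': "?t \<in> carrier (tensor_power V ?n)"
      using linear_map_closed[OF braid_at_linear[OF snoc.hyps(3)] snoc.prems] .
    have "permute_list \<sigma> w ! Suc i = w ! \<sigma> (Suc i)" "permute_list \<sigma> w ! i = w ! \<sigma> i"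
      using snoc.hyps(3) by (simp_all add: permute_list_def)
    then have c: "coord (permute_list \<sigma> w) ?t =
        q (w ! \<sigma> (Suc i)) (w ! \<sigma> i) * coord (permute_list (adj i) (permute_list \<sigma> w)) t"
      using coord_braid_at[of i "permute_list \<sigma> w" t] snoc.hyps(3) snoc.prems by simp
    have p: "permute_list (\<sigma> \<circ> adj i) w = permute_list (adj i) (permute_list \<sigma> w)"
      using snoc.hyps(3) by (intro permute_list_compose permutes_swap_id) auto
    have "?F (ws @ [i]) t \<in> carrier (tensor_power V ?n) \<and>
      coord w (?F (ws @ [i]) t) = braid_coeff q w (\<sigma> \<circ> adj i) * coord (permute_list (\<sigma> \<circ> adj i) w) t"
      using snoc.IH[OF t'] unfolding F braid_coeff_adj[OF snoc.hyps(3,4)] p c by (metis mult.assoc)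
    then show ?case .
  qed
  then show ?thesis unfolding braid_perm_def using arg_min_expresses[OF \<sigma>] by blast
qed

text \<open>Equals \<open>coord w\<close> after the quantum symmetrizer in degree
  \<open>length w\<close>; written as a combination of coordinates, it is visibly linear on the
  whole tensor algebra.\<close>

definition symm_coord :: "'i list \<Rightarrow> ('v list \<Rightarrow>\<^sub>0 'k) set \<Rightarrow> 'k"
  where "symm_coord w t =
    (\<Sum>\<sigma>\<in>{\<sigma>. \<sigma> permutes {..<length w}}. braid_coeff q w \<sigma> * coord (permute_list \<sigma> w) t)"

lemma symm_coord_linear: "linear_map T K (symm_coord w)"
  unfolding symm_coord_def by (rule linear_functional_sum[OF coord_linear])

lemma coord_quantum_symmetrizer:
  assumes "t \<in> carrier (tensor_power V (length w))"
  shows "coord w (quantum_symmetrizer V braiding (length w) t) = symm_coord w t"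
proof -
  have "(\<lambda>\<sigma>. braid_perm V braiding (length w) \<sigma> t) \<in> {\<sigma>. \<sigma> permutes {..<length w}} \<rightarrow> carrier T"
    using coord_braid_perm[OF _ assms] tensor_power_sub by blast
  from linear_functional_finsum[OF Tm.module_axioms coord_linear _ this, of w]
  have "coord w (quantum_symmetrizer V braiding (length w) t) =
      (\<Sum>\<sigma>\<in>{\<sigma>. \<sigma> permutes {..<length w}}. coord w (braid_perm V braiding (length w) \<sigma> t))"
    by (simp add: quantum_symmetrizer_def finite_permutations)
  also have "\<dots> = symm_coord w t"
    unfolding symm_coord_def using coord_braid_perm[OF _ assms] by (intro sum.cong) auto
  finally show ?thesis .
qed

abbreviation "kernels \<equiv> \<Union>n\<in>{2..}. {t \<in> carrier (tensor_power V n).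
  quantum_symmetrizer V braiding n t = \<zero>\<^bsub>T\<^esub>}"

lemma kernels_sub: "kernels \<subseteq> carrier T"
  using tensor_power_sub by blast

text \<open>In degree \<open>length w\<close> the symmetrizer itself is zero on the kernel; in any
  other degree all coordinates along rearrangements of \<open>w\<close> are zero.\<close>

lemma symm_coord_kernels:
  assumes "t \<in> lin_span T kernels" shows "symm_coord w t = 0"
proof (rule linear_functional_kernel_span[OF Tm.module_axioms symm_coord_linear kernels_sub _ assms])
  fix t assume "t \<in> kernels"
  then obtain n where t: "t \<in> carrier (tensor_power V n)" "quantum_symmetrizer V braiding n t = \<zero>\<^bsub>T\<^esub>" by blast
  show "symm_coord w t = 0"
  proof (cases "n = length w")
    case True
    then show ?thesis
      using coord_quantum_symmetrizer[of t w] t linear_map_zero[OF Tm.module_axioms module_scalar_module coord_linear]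
      by simp
  next
    case False
    then show ?thesis using coord_other_degree[OF t(1)] by (simp add: symm_coord_def)
  qed
qed

lemma coord_bounded_degree:
  assumes "t \<in> carrier T" shows "\<exists>B. \<forall>w. B < length w \<longrightarrow> coord w t = 0"
proof -
  obtain p where p: "p \<in> carrier F" "t = J +>\<^bsub>F\<^esub> p" using q.quot_ex assms unfolding T_eq by blast
  have "\<exists>B. \<forall>w. B < length w \<longrightarrow> coord w (J +>\<^bsub>F\<^esub> p) = 0" using p(1)
  proof (induction rule: free_induct)
    case zero
    have "J +>\<^bsub>F\<^esub> 0 = \<zero>\<^bsub>T\<^esub>" unfolding T_eq q.quot_zero by (simp add: free_simps)
    then show ?case
      using linear_map_zero[OF Tm.module_axioms module_scalar_module coord_linear] by simp
  next
    case (add p r)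
    then obtain B C where B: "\<And>w. B < length w \<Longrightarrow> coord w (J +>\<^bsub>F\<^esub> p) = 0"
      "\<And>w. C < length w \<Longrightarrow> coord w (J +>\<^bsub>F\<^esub> r) = 0" by blast
    have c: "J +>\<^bsub>F\<^esub> p \<in> carrier T" "J +>\<^bsub>F\<^esub> r \<in> carrier T" using q.quot_mem add by (auto simp: T_eq)
    have "J +>\<^bsub>F\<^esub> (p + r) = (J +>\<^bsub>F\<^esub> p) \<oplus>\<^bsub>T\<^esub> (J +>\<^bsub>F\<^esub> r)"
      using q.quot_add[OF add(1,2)] by (simp add: T_eq free_simps)
    then show ?case
      using B linear_functional_simps(1)[OF coord_linear c] by (intro exI[of _ "max B C"]) simp
  next
    case (single v c)
    have "Poly_Mapping.map ((*) c) (Poly_Mapping.single v 1) = Poly_Mapping.single v c"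
      by (intro poly_mapping_eqI) (simp add: lookup_smult lookup_single when_def)
    then have "J +>\<^bsub>F\<^esub> Poly_Mapping.single v c = c \<odot>\<^bsub>T\<^esub> pure_tensor V v"
      unfolding pure_tensor_def T_eq using q.quot_smult[OF single_closed[OF single], of c 1]
      by (simp add: free_simps(5))
    then have "coord w (J +>\<^bsub>F\<^esub> Poly_Mapping.single v c) = c * word_fun w v" for w
      using linear_functional_simps(2)[OF coord_linear pure_closed[OF single]] coord_pure[OF single] by simp
    then show ?case by (intro exI[of _ "length v"]) (simp add: word_fun_def)
  qed
  then show ?thesis using p(2) by simp
qed

text \<open>The representatives of a finite spanning set have a common degree bound. A functional
  for a longer word vanishes on them, hence on the whole quotient.\<close>

lemma symm_coord_finite_dimensional:
  assumes "finite_dimensional (nichols_algebra V braiding)"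
  shows "\<exists>B. \<forall>w. B < length w \<longrightarrow> (\<forall>t\<in>carrier T. symm_coord w t = 0)"
proof -
  interpret n: quotient_space T "lin_span T kernels"
    by (intro quotient_space.intro quotient_space_axioms.intro Tm.module_axioms
        lin_span_submodule(1)[OF Tm.module_axioms kernels_sub])
  let ?N = "quot_module T (lin_span T kernels)"
  have N: "nichols_algebra V braiding = ?N" by (simp add: nichols_algebra_def)
  obtain S where S: "finite S" "S \<subseteq> carrier ?N" "lin_span ?N S = carrier ?N"
    using assms unfolding N finite_dimensional_def by blast
  let ?f = "\<lambda>w. n.factor (symm_coord w)"
  have k: "symm_coord w u = \<zero>\<^bsub>K\<^esub>" if "u \<in> lin_span T kernels" for w u
    using symm_coord_kernels[OF that] by (simp only: scalar_module_simps)
  have f: "linear_map ?N K (?f w)" for w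
    by (rule n.factor_linear[OF module_scalar_module symm_coord_linear k])
  have ft: "?f w (lin_span T kernels +>\<^bsub>T\<^esub> t) = symm_coord w t" if "t \<in> carrier T" for w t
    by (rule n.factor_coset[OF module_scalar_module symm_coord_linear k that])
  have "\<exists>B. \<forall>w. B < length w \<longrightarrow> ?f w s = 0" if s: "s \<in> S" for s
  proof -
    obtain t where t: "t \<in> carrier T" "s = lin_span T kernels +>\<^bsub>T\<^esub> t" using n.quot_ex S(2) s by blast
    obtain B where "\<And>w. B < length w \<Longrightarrow> coord w t = 0" using coord_bounded_degree[OF t(1)] by blast
    then have "symm_coord w t = 0" if "B < length w" for w using that by (simp add: symm_coord_def)
    then show ?thesis unfolding t(2) ft[OF t(1)] by blast
  qed
  then obtain b where b: "\<And>s w. s \<in> S \<Longrightarrow> b s < length w \<Longrightarrow> ?f w s = 0" by metis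
  \<comment> \<open>Inserting 0 keeps the maximum meaningful when \<open>S\<close> is empty.\<close>
  have "symm_coord w t = 0" if w: "Max (insert 0 (b ` S)) < length w" and t: "t \<in> carrier T" for w t
  proof -
    have "b s < length w" if "s \<in> S" for s using w S(1) that by (simp add: le_less_trans)
    then have "?f w s = 0" if "s \<in> S" for s using b that by blast
    moreover have "lin_span T kernels +>\<^bsub>T\<^esub> t \<in> lin_span ?N S" using n.quot_mem[OF t] unfolding S(3) .
    ultimately have "?f w (lin_span T kernels +>\<^bsub>T\<^esub> t) = 0"
      by (rule linear_functional_kernel_span[OF n.module_quot f S(2)])
    then show ?thesis unfolding ft[OF t] .
  qed
  then show ?thesis by blast
qed

theorem word_symm_finite_dimensional:
  assumes "finite_dimensional (nichols_algebra V braiding)"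
  shows "\<exists>B. \<forall>w p. B < length w \<longrightarrow> word_symm q p w = 0"
proof -
  obtain B where B: "\<And>w t. B < length w \<Longrightarrow> t \<in> carrier T \<Longrightarrow> symm_coord w t = 0"
    using symm_coord_finite_dimensional[OF assms] by blast
  have "word_symm q p w = 0" if w: "B < length w" for w p
  proof -
    \<comment> \<open>Only the values of \<open>p\<close> at rearrangements of \<open>w\<close>
      matter, so \<open>p\<close> may be replaced by a finite combination of monomials, and each
      monomial is realised by a pure tensor in the vectors \<open>x i\<close>.\<close>
    let ?P = "{\<sigma>. \<sigma> permutes {..<length w}}" and ?U = "(\<lambda>\<sigma>. permute_list \<sigma> w) ` {\<sigma>. \<sigma> permutes {..<length w}}"
    have fin: "finite ?P" by (simp add: finite_permutations)
    have 0: "word_symm q (word_delta u) w = 0" if u: "u \<in> ?U" for u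
    proof -
      have len: "length u = length w" using u by auto
      have c: "map x u \<in> words" using x by auto
      have "word_fun v (map x u) = word_delta u v" if v: "length v = length w" for v
      proof (cases "v = u")
        case True
        then show ?thesis by (simp add: word_fun_def word_delta_def \<phi>_x)
      next
        case False
        then obtain l where "l < length u" "v ! l \<noteq> u ! l" using v len by (auto simp: list_eq_iff_nth_eq)
        then have "(\<Prod>l<length v. \<phi> (v ! l) (x (u ! l))) = 0"
          using v len by (intro prod_zero) (auto simp: \<phi>_x)
        then show ?thesis using False by (simp add: word_fun_def word_delta_def)
      qed
      then have "word_symm q (word_delta u) w = symm_coord w (pure_tensor V (map x u))"
        by (simp add: word_symm_def symm_coord_def coord_pure[OF c])
      then show ?thesis using B[OF w pure_closed[OF c]] by simp
    qed
    have "p v = (\<Sum>u\<in>?U. p u * word_delta u v)" if "v \<in> ?U" for v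
    proof -
      have "(\<Sum>u\<in>?U. p u * word_delta u v) = (\<Sum>u\<in>?U. if u = v then p u else 0)"
        by (intro sum.cong) (auto simp: word_delta_def)
      then show ?thesis using fin that by simp
    qed
    then have "word_symm q p w = (\<Sum>\<sigma>\<in>?P. \<Sum>u\<in>?U. p u * (braid_coeff q w \<sigma> * word_delta u (permute_list \<sigma> w)))"
      unfolding word_symm_def by (intro sum.cong) (auto simp: sum_distrib_left mult.left_commute)
    also have "\<dots> = (\<Sum>u\<in>?U. p u * word_symm q (word_delta u) w)"
      unfolding word_symm_def sum_distrib_left by (rule sum.swap)
    finally show ?thesis using 0 by simp
  qed
  then show ?thesis by blast
qed

end


section \<open>Coordinates of an induced module\<close>

context yd_setup
begin

lemma Z_group: "subgroup Z G"
proof (rule G.subgroupI)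
  show "Z \<subseteq> carrier G" by (auto simp: centralizer_def)
  show "Z \<noteq> {}" using g by (auto simp: centralizer_def intro!: exI[of _ \<one>])
  fix a assume a: "a \<in> Z"
  then have a': "a \<in> carrier G" "a \<otimes> g = g \<otimes> a" by (auto simp: centralizer_def)
  have "inv a \<otimes> g = inv a \<otimes> (g \<otimes> a) \<otimes> inv a" using a'(1) g by (simp add: G.m_assoc)
  also have "\<dots> = g \<otimes> inv a" unfolding a'(2)[symmetric] using a'(1) g by (simp add: G.m_assoc[symmetric])
  finally show "inv a \<in> Z" using a' by (simp add: centralizer_def)
  fix b assume "b \<in> Z"
  then have b: "b \<in> carrier G" "b \<otimes> g = g \<otimes> b" by (auto simp: centralizer_def)
  have "a \<otimes> b \<otimes> g = a \<otimes> (b \<otimes> g)" using a'(1) b(1) g by (rule G.m_assoc)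
  also have "\<dots> = a \<otimes> g \<otimes> b" unfolding b(2) using a'(1) b(1) g by (simp only: G.m_assoc)
  also have "\<dots> = g \<otimes> (a \<otimes> b)" unfolding a'(2) using a'(1) b(1) g by (simp only: G.m_assoc)
  finally show "a \<otimes> b \<in> Z" using a'(1) b(1) by (simp add: centralizer_def)
qed

interpretation Z: subgroup Z G by (rule Z_group)

lemma inv_mult_cancel: "a \<in> carrier G \<Longrightarrow> b \<in> carrier G \<Longrightarrow> inv a \<otimes> b = c \<longleftrightarrow> c \<in> carrier G \<and> b = a \<otimes> c"
  by (auto simp: G.m_assoc[symmetric])

text \<open>In the induced module \<open>t \<otimes> z\<close> equals \<open>chi z\<close> times
  \<open>t\<close>, so the sum collects what the whole coset of \<open>t\<close> contributes to the
  basis vector of \<open>t\<close>.\<close>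

definition coset_coeff :: "'g \<Rightarrow> ('g \<Rightarrow>\<^sub>0 'k) \<Rightarrow> 'k"
  where "coset_coeff t p = (\<Sum>z\<in>Z. chi z * lk p (t \<otimes> z))"

lemma coset_coeff_linear: "linear_map A scalar_module (coset_coeff t)"
  by (auto simp: linear_map_def Asimps coset_coeff_def lookup_add lookup_smult distrib_left sum.distrib
      sum_distrib_left mult.left_commute)

lemma coset_coeff_single:
  assumes "t \<in> carrier G" "m \<in> carrier G"
  shows "coset_coeff t (sg m c) = (if inv t \<otimes> m \<in> Z then chi (inv t \<otimes> m) * c else 0)"
proof -
  have "coset_coeff t (sg m c) = (\<Sum>z\<in>Z. if z = inv t \<otimes> m then chi z * c else 0)"
    unfolding coset_coeff_def
  proof (rule sum.cong[OF refl])
    fix z assume z: "z \<in> Z"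
    then have "z = inv t \<otimes> m \<longleftrightarrow> m = t \<otimes> z" using inv_mult_cancel[OF assms, of z] by auto
    then show "chi z * lk (sg m c) (t \<otimes> z) = (if z = inv t \<otimes> m then chi z * c else 0)"
      by (simp add: lookup_single when_def)
  qed
  also have "\<dots> = (if inv t \<otimes> m \<in> Z then chi (inv t \<otimes> m) * c else 0)"
    using finite_subset[OF Z.subset fin] by simp
  finally show ?thesis .
qed

definition coset_coord :: "'g \<Rightarrow> ('g \<Rightarrow>\<^sub>0 'k) set \<Rightarrow> 'k"
  where "coset_coord t = q.factor (coset_coeff t)"

end

locale yd_character = yd_setup G g chi
  for G :: "('g, 'b) monoid_scheme" (structure) and g :: 'g and chi :: "'g \<Rightarrow> 'k::field" +
  assumes chi_mult: "y \<in> centralizer G g \<Longrightarrow> z \<in> centralizer G g \<Longrightarrow> chi (y \<otimes> z) = chi y * chi z"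
    and chi_one: "chi \<one> = 1"
begin

interpretation Z: subgroup Z G by (rule Z_group)

text \<open>Both terms of a relation lie in the same coset, and their weighted coefficients agree
  because \<open>chi\<close> is multiplicative.\<close>

lemma coset_coeff_R:
  assumes t: "t \<in> carrier G" and p: "p \<in> R" shows "coset_coeff t p = 0"
proof (rule linear_functional_kernel_span[OF module_monoid_algebra coset_coeff_linear gensA])
  show "p \<in> lin_span A gens" using p by (simp add: induced_relations_def)
  fix s assume "s \<in> gens"
  then obtain h z where s: "s = sg (h \<otimes> z) 1 - sg h (chi z)" and h: "h \<in> carrier G" and z: "z \<in> Z" by blast
  have d: "coset_coeff t (p - r) = coset_coeff t p - coset_coeff t r" for p r
    by (simp add: coset_coeff_def lookup_minus right_diff_distrib sum_subtractf)
  have a: "inv t \<otimes> (h \<otimes> z) = inv t \<otimes> h \<otimes> z" using t h z by (simp add: G.m_assoc)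
  have "inv t \<otimes> h \<otimes> z \<in> Z \<longleftrightarrow> inv t \<otimes> h \<in> Z"
  proof
    assume "inv t \<otimes> h \<otimes> z \<in> Z"
    then have "inv t \<otimes> h \<otimes> z \<otimes> inv z \<in> Z" using z by blast
    then show "inv t \<otimes> h \<in> Z" using t h z by (simp add: G.m_assoc)
  qed (use z in blast)
  then show "coset_coeff t s = 0"
    unfolding s d using t h z chi_mult[of "inv t \<otimes> h" z] by (simp add: coset_coeff_single a)
qed

lemma coset_coord:
  assumes "t \<in> carrier G"
  shows coset_coord_coset: "\<And>p. p \<in> carrier A \<Longrightarrow> coset_coord t (R +>\<^bsub>A\<^esub> p) = coset_coeff t p"
    and coset_coord_linear: "linear_map V scalar_module (coset_coord t)"
proof -
  have z: "coset_coeff t p = \<zero>\<^bsub>scalar_module\<^esub>" if "p \<in> R" for p using coset_coeff_R[OF assms that] by simp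
  show "coset_coord t (R +>\<^bsub>A\<^esub> p) = coset_coeff t p" if "p \<in> carrier A" for p
    unfolding coset_coord_def
    by (rule q.factor_coset[OF module_scalar_module coset_coeff_linear _ that]) (rule z)
  have "linear_map q.Q scalar_module (coset_coord t)"
    unfolding coset_coord_def by (rule q.factor_linear[OF module_scalar_module coset_coeff_linear]) (rule z)
  then show "linear_map V scalar_module (coset_coord t)"
    using Vsame by (simp add: linear_map_def same_vs_def)
qed

lemma coset_coord_el:
  "t \<in> carrier G \<Longrightarrow> m \<in> carrier G \<Longrightarrow>
    coset_coord t (el m) = (if inv t \<otimes> m \<in> Z then chi (inv t \<otimes> m) else 0)"
  by (simp add: coset_coord_coset sgA coset_coeff_single)

lemma V_coset: assumes "v \<in> carrier V" obtains p where "p \<in> carrier A" "v = R +>\<^bsub>A\<^esub> p"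
  using assms Vsame q.quot_ex[of v] by (auto simp: same_vs_def)

lemma coset_coeff_cong:
  assumes p: "p \<in> carrier A" and f: "linear_map A A f"
    and s: "\<And>m c. m \<in> carrier G \<Longrightarrow> coset_coeff t (f (sg m c)) = d * coset_coeff t' (sg m c)"
  shows "coset_coeff t (f p) = d * coset_coeff t' p"
  using p
proof (induction rule: monoid_algebra_induct)
  case zero
  have "f 0 = 0" using linear_map_zero[OF module_monoid_algebra module_monoid_algebra f] by (simp add: Asimps)
  then show ?case by (simp add: coset_coeff_def)
next
  case (add p r)
  have "f (p + r) = f p + f r" using f add by (simp add: linear_map_def Asimps(3))
  then show ?case using add by (simp add: coset_coeff_def lookup_add distrib_left sum.distrib)
qed (rule s)

lemma coset_coord_act:
  assumes t: "t \<in> carrier G" and a: "a \<in> carrier G" and v: "v \<in> carrier V"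
  shows "coset_coord t (act V a v) = coset_coord (inv a \<otimes> t) v"
proof -
  obtain p where p: "p \<in> carrier A" "v = R +>\<^bsub>A\<^esub> p" using v by (rule V_coset)
  have "coset_coeff t (lm a p) = 1 * coset_coeff (inv a \<otimes> t) p"
    using t a
    by (intro coset_coeff_cong[OF p(1) lm_linear[OF a]])
      (simp add: lm_single coset_coeff_single G.inv_mult_group G.m_assoc)
  then show ?thesis
    using t a p linear_map_closed[OF lm_linear[OF a] p(1)] by (simp add: act_coset coset_coord_coset)
qed

text \<open>Another representative of the coset scales the basis vector by \<open>chi z\<close>, and
  so its coordinate by the inverse.\<close>

lemma coset_coord_mult:
  assumes t: "t \<in> carrier G" and z: "z \<in> Z" and v: "v \<in> carrier V"
  shows "coset_coord (t \<otimes> z) v = chi (inv z) * coset_coord t v"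
proof -
  obtain p where p: "p \<in> carrier A" "v = R +>\<^bsub>A\<^esub> p" using v by (rule V_coset)
  have zG: "z \<in> carrier G" by (rule Z.mem_carrier[OF z])
  have "coset_coeff (t \<otimes> z) ((\<lambda>p. p) p) = chi (inv z) * coset_coeff t p"
  proof (rule coset_coeff_cong[OF p(1)])
    show "linear_map A A (\<lambda>p. p)" by (simp add: linear_map_def)
    fix m c assume m: "m \<in> carrier G"
    have e: "inv (t \<otimes> z) \<otimes> m = inv z \<otimes> (inv t \<otimes> m)" using t zG m by (simp add: G.inv_mult_group G.m_assoc)
    have "inv z \<otimes> (inv t \<otimes> m) \<in> Z \<longleftrightarrow> inv t \<otimes> m \<in> Z"
    proof
      assume "inv z \<otimes> (inv t \<otimes> m) \<in> Z"
      then have "z \<otimes> (inv z \<otimes> (inv t \<otimes> m)) \<in> Z" using z by blast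
      then show "inv t \<otimes> m \<in> Z" using t zG m by (simp add: G.m_assoc[symmetric])
    qed (use z in blast)
    then show "coset_coeff (t \<otimes> z) (sg m c) = chi (inv z) * coset_coeff t (sg m c)"
      using t zG z m chi_mult[of "inv z" "inv t \<otimes> m"] by (simp add: coset_coeff_single e)
  qed
  then show ?thesis using t zG p by (simp add: coset_coord_coset)
qed

text \<open>Elements of one coset have the same degree because \<open>Z\<close> centralizes
  \<open>g\<close>; a vector of another degree therefore has no component at the coset of
  \<open>t\<close>.\<close>

lemma coset_coord_homog:
  assumes t: "t \<in> carrier G" and h: "h \<noteq> t \<otimes> g \<otimes> inv t" and v: "v \<in> homog V h"
  shows "coset_coord t v = 0"
proof (rule linear_functional_kernel_span[OF q.module_quot _ elQ])
  show "linear_map q.Q scalar_module (coset_coord t)"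
    using coset_coord_linear[OF t] Vsame by (simp add: linear_map_def same_vs_def)
  show "v \<in> lin_span q.Q (el ` cls h)" using v by (simp add: homog_eq)
  fix s assume "s \<in> el ` cls h"
  then obtain m where m: "m \<in> carrier G" "h = m \<otimes> g \<otimes> inv m" "s = el m" by blast
  define z where "z = inv t \<otimes> m"
  have zG: "z \<in> carrier G" unfolding z_def using t m(1) by (intro G.m_closed G.inv_closed)
  have mz: "m = t \<otimes> z" unfolding z_def using t m(1)
    by (simp only: G.m_assoc[symmetric] G.inv_closed G.r_inv G.l_one)
  have "z \<notin> Z"
  proof
    assume "z \<in> Z"
    then have z: "z \<otimes> g = g \<otimes> z" unfolding centralizer_def by blast
    have "m \<otimes> g \<otimes> inv m = t \<otimes> (z \<otimes> g) \<otimes> inv z \<otimes> inv t"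
      unfolding mz using zG t g
      by (simp only: G.inv_mult_group G.m_assoc G.m_closed G.inv_closed)
    also have "\<dots> = t \<otimes> g \<otimes> inv t"
      unfolding z using zG t g by (simp only: G.m_assoc G.m_closed G.inv_closed G.r_inv G.r_one)
    finally show False using h m(2) by (simp only: simp_thms)
  qed
  then have "inv t \<otimes> m \<notin> Z" unfolding z_def .
  then show "coset_coord t s = 0" unfolding m(3) coset_coord_el[OF t m(1)] by (simp only: if_False)
qed

text \<open>Since \<open>gs j\<close> commutes with \<open>gs i\<close>, moving it past
  \<open>x i\<close> leaves an element of the centralizer of \<open>g\<close> on the right, which
  acts by \<open>chi\<close>. Injectivity of \<open>gs\<close> puts the basis vectors into distinct
  degrees, so the coordinates are dual to them.\<close>

theorem diagonal_part_induced:
  assumes x: "\<And>i. x i \<in> carrier G" and gs: "\<And>i. gs i = x i \<otimes> g \<otimes> inv (x i)"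
    and inj: "inj gs" and comm: "\<And>i j. gs i \<otimes> gs j = gs j \<otimes> gs i"
  shows "diagonal_part G V gs (\<lambda>i. el (x i)) (\<lambda>i. coset_coord (x i)) (\<lambda>j i. chi (inv (x i) \<otimes> gs j \<otimes> x i))"
proof (intro diagonal_part.intro diagonal_part_axioms.intro)
  show "yetter_drinfeld G V" by (rule yd)
  have cancel: "t \<otimes> (inv t \<otimes> y) = y" "inv t \<otimes> (t \<otimes> y) = y" if "t \<in> carrier G" "y \<in> carrier G" for t y
    using that by (simp_all add: G.m_assoc[symmetric])
  have conj_mult: "(inv t \<otimes> a \<otimes> t) \<otimes> (inv t \<otimes> b \<otimes> t) = inv t \<otimes> (a \<otimes> b) \<otimes> t"
    if "t \<in> carrier G" "a \<in> carrier G" "b \<in> carrier G" for t a b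
    using that by (simp add: G.m_assoc cancel)
  have gc: "gs i \<in> carrier G" for i unfolding gs using x[of i] g by simp
  then show "gs i \<in> carrier G" for i .
  show "el (x i) \<in> carrier V" for i using q.quot_mem[OF sgA[OF x]] Vsame by (simp add: same_vs_def)
  show "linear_map V scalar_module (coset_coord (x i))" for i by (rule coset_coord_linear[OF x])
  show "coset_coord (x i) v = 0" if "h \<in> carrier G" "h \<noteq> gs i" "v \<in> homog V h" for h i v
    by (rule coset_coord_homog[OF x _ that(3)]) (use that(2) in \<open>simp only: gs[symmetric] not_False_eq_True\<close>)
  show "coset_coord (x i) (act V (gs j) v) = chi (inv (x i) \<otimes> gs j \<otimes> x i) * coset_coord (x i) v"
    if v: "v \<in> carrier V" for v i j
  proof -
    let ?y = "inv (x i) \<otimes> gs j \<otimes> x i"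
    note c = x[of i] gc[of i] gc[of j] g
    have h: "inv (x i) \<otimes> gs i \<otimes> x i = g"
      unfolding gs[of i] using c by (simp add: G.m_assoc cancel)
    \<comment> \<open>After conjugation by \<open>x i\<close> this is the commutation of
      \<open>gs j\<close> with \<open>gs i\<close>.\<close>
    have "?y \<otimes> g = ?y \<otimes> (inv (x i) \<otimes> gs i \<otimes> x i)" unfolding h ..
    also have "\<dots> = inv (x i) \<otimes> (gs j \<otimes> gs i) \<otimes> x i" by (rule conj_mult[OF c(1,3,2)])
    also have "gs j \<otimes> gs i = gs i \<otimes> gs j" by (rule comm)
    also have "inv (x i) \<otimes> (gs i \<otimes> gs j) \<otimes> x i = (inv (x i) \<otimes> gs i \<otimes> x i) \<otimes> ?y"
      by (rule conj_mult[OF c(1,2,3), symmetric])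
    also have "\<dots> = g \<otimes> ?y" unfolding h ..
    finally have yg: "?y \<otimes> g = g \<otimes> ?y" .
    have yc: "?y \<in> carrier G" using c by simp
    have y: "?y \<in> Z" unfolding centralizer_def using yc yg by (intro CollectI conjI)
    have e: "inv (gs j) \<otimes> x i = x i \<otimes> inv ?y"
      using c by (simp add: G.inv_mult_group G.m_assoc cancel)
    have "coset_coord (x i) (act V (gs j) v) = coset_coord (x i \<otimes> inv ?y) v"
      unfolding e[symmetric] by (rule coset_coord_act[OF x gc v])
    also have "\<dots> = chi (inv (inv ?y)) * coset_coord (x i) v"
      by (rule coset_coord_mult[OF x Z.m_inv_closed[OF y] v])
    also have "inv (inv ?y) = ?y" by (rule G.inv_inv[OF yc])
    finally show ?thesis .
  qed
  show "coset_coord (x i) (el (x j)) = (if i = j then 1 else 0)" for i j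
  proof (cases "i = j")
    case True
    then show ?thesis using coset_coord_el[OF x x, of j j] by (simp only: G.l_inv[OF x] Z.one_closed chi_one if_True simp_thms)
  next
    case False
    then have "gs i \<noteq> gs j" using inj by (simp add: inj_eq)
    then have "gs j \<noteq> x i \<otimes> g \<otimes> inv (x i)" unfolding gs[symmetric] by (rule not_sym)
    moreover have "x j \<in> cls (gs j)" using x[of j] gs[of j] by (intro CollectI conjI) (assumption, rule sym)
    ultimately have "coset_coord (x i) (el (x j)) = 0" by (intro coset_coord_homog[OF x] homog_el)
    then show ?thesis using False by (simp only: if_False)
  qed
qed

end


text \<open>For \<open>a = 1\<close> the braiding is the flip, and factorials are nonzero in
  characteristic 0. Otherwise the word for \<open>real_root B\<close> has length
  \<open>2 * B + 1\<close>, and the value is a power of a nonzero scalar.\<close>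

lemma word_symm_affine_nonzero:
  fixes a b :: "'k::field_char_0"
  assumes ab: "a * b = 1" and a: "a \<noteq> - 1"
  shows "\<exists>w p. B < length w \<and> word_symm (\<lambda>i j :: bool. if i = j then a else b) p w \<noteq> 0"
proof (cases "a = 1")
  case True
  let ?w = "replicate (Suc B) True"
  have "word_symm (\<lambda>i j :: bool. if i = j then a else b) (word_delta ?w) ?w \<noteq> 0"
    using word_symm_delta_replicate[of "\<lambda>i j. if i = j then a else b" True "Suc B"] True by (simp del: replicate_Suc fact_Suc)
  then show ?thesis by (intro exI[of _ ?w] exI[of _ "word_delta ?w"]) simp
next
  case False
  interpret affine_rank_two a b "\<lambda>i j. if i = j then a else b"
    by unfold_locales (use ab in auto)
  have a2: "a * a \<noteq> 1" using a False by (simp add: square_eq_1_iff)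
  \<comment> \<open>Clearing denominators shows that each factor of the scalar is
    \<open>a * a - 1\<close> up to a sign and a power of \<open>a\<close>.\<close>
  have "(1 - b * b) * (a * a) = a * a - 1" "(b - a) * a = 1 - a * a"
    using ab by (simp_all add: algebra_simps)
  then have "(1 - b * b) * (b - a) \<noteq> 0" using a2 by auto
  moreover have "length (concat (replicate B [True, False])) = 2 * B" by (induction B) auto
  ultimately show ?thesis
    using word_symm_real_root[of B]
    by (intro exI[of _ "True # concat (replicate B [True, False])"] exI[of _ "real_root B"]) simp
qed

section \<open>Diagonal matrices in \<open>SL(2)\<close>\<close>

lemma c7_mult: "c7 (y * z) = c7 y ** c7 (z :: 'f::field)"
  by (simp add: c7_def vec_eq_iff forall_2 matrix_matrix_mult_def sum_2)

lemma c7_one: "c7 1 = mat 1"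
  by (simp add: c7_def vec_eq_iff forall_2 mat_def)

lemma c7_SL2: "y \<noteq> 0 \<Longrightarrow> c7 y \<in> carrier SL2"
  by (simp add: SL2_def c7_def det_2)

lemma c7_SL2_inverse: "y \<noteq> 0 \<Longrightarrow> inv\<^bsub>SL2\<^esub> (c7 y) = c7 (inverse y :: 'f::field)"
proof -
  interpret group "SL2 :: ('f ^ 2 ^ 2) monoid" by (rule SL2_group)
  assume y: "y \<noteq> 0"
  have "c7 (inverse y) \<otimes>\<^bsub>SL2\<^esub> c7 y = \<one>\<^bsub>SL2\<^esub>" using y by (simp add: SL2_def c7_one flip: c7_mult)
  from inv_equality[OF this c7_SL2[OF y] c7_SL2] show ?thesis using y by simp
qed

lemma c7_centralizer: "y \<noteq> 0 \<Longrightarrow> c7 y \<in> centralizer SL2 (c7 x)"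
  using c7_SL2[of y] by (simp add: centralizer_def) (simp add: SL2_def mult.commute flip: c7_mult)

lemma units_of_scalars: "carrier (units_of (scalars :: 'k::field ring)) = {y. y \<noteq> 0}"
  "mult (units_of (scalars :: 'k ring)) = (*)" "one (units_of (scalars :: 'k ring)) = 1"
proof -
  show "carrier (units_of (scalars :: 'k ring)) = {y. y \<noteq> 0}"
    by (auto simp: units_of_def Units_def) (metis field_class.field_inverse mult.commute)
qed (simp_all add: units_of_def)

lemma group_units_of_scalars: "group (units_of (scalars :: 'k::field ring))"
proof -
  interpret cring "scalars :: 'k ring" by (rule cring_from_type_algebra)
  show ?thesis by (rule units_group)
qed

theorem proposition3p4:
  fixes q :: nat
    and x :: "'f::{field, finite}"
    and chi :: "'f ^ 2 ^ 2 \<Rightarrow> 'k::{alg_closed_field, field_char_0}"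
    and gs xs :: "2 \<Rightarrow> 'f ^ 2 ^ 2"
  assumes "primepow q" and "odd q" and "q > 3" and "CARD('f) = q"
    and "x \<noteq> 0" and "x \<noteq> 1" and "x \<noteq> - 1"
    and "chi \<in> hom (SL2\<lparr>carrier := centralizer SL2 (c7 x)\<rparr>) (units_of scalars)"
    and "gs 1 = c7 x" and "gs 2 = c7 (inverse x)"
    and "\<forall>i. xs i \<in> carrier SL2 \<and> gs i = xs i \<otimes>\<^bsub>SL2\<^esub> c7 x \<otimes>\<^bsub>SL2\<^esub> inv\<^bsub>SL2\<^esub> (xs i)"
    and "finite_dimensional
      (nichols_algebra (yd_induced SL2 (c7 x) chi) (yd_braiding SL2 (yd_induced SL2 (c7 x) chi)))"
  shows "braiding_matrix SL2 chi gs xs = vector [vector [- 1, - 1], vector [- 1, - 1]] \<and>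
    even (group.ord (units_of scalars) x)"
proof -
  let ?Z = "centralizer SL2 (c7 x)" and ?a = "chi (c7 x)"
  interpret SL2: group "SL2 :: ('f ^ 2 ^ 2) monoid" by (rule SL2_group)
  have chi: "chi y \<noteq> 0" "chi (y \<otimes>\<^bsub>SL2\<^esub> z) = chi y * chi z" if "y \<in> ?Z" "z \<in> ?Z" for y z
    using assms(8) that by (auto simp: hom_def units_of_scalars)
  have Z: "c7 y \<in> ?Z" if "y \<noteq> 0" for y using that by (rule c7_centralizer)
  have chi_c7: "chi (c7 (y * z)) = chi (c7 y) * chi (c7 z)" if "y \<noteq> 0" "z \<noteq> 0" for y z
    using chi(2)[OF Z[OF that(1)] Z[OF that(2)]] by (simp add: SL2_def c7_mult)
  \<comment> \<open>The value is idempotent and nonzero.\<close>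
  have chi_1: "chi (c7 1) = 1" using chi_c7[of 1 1] chi(1)[OF Z Z, of 1 1] by simp
  have ab: "?a * chi (c7 (inverse x)) = 1" using chi_c7[of x "inverse x"] chi_1 assms(5) by simp
  let ?b = "chi (c7 (inverse x))"
  have one: "c7 1 = \<one>\<^bsub>SL2\<^esub>" by (simp add: SL2_def c7_one)
  interpret yd_character SL2 "c7 x" chi
    by unfold_locales (use chi chi_1 c7_SL2[OF assms(5)] in \<open>auto simp: one\<close>)
  have xs: "xs i \<in> carrier SL2" "gs i = xs i \<otimes>\<^bsub>SL2\<^esub> c7 x \<otimes>\<^bsub>SL2\<^esub> inv\<^bsub>SL2\<^esub> (xs i)" for i
    using assms(11) by blast+
  have gs: "gs i = (if i = 1 then c7 x else c7 (inverse x))" for i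
    using assms(9,10) exhaust_2[of i] by auto
  have gsc: "gs i \<in> carrier SL2" for i using c7_SL2[of x] c7_SL2[of "inverse x"] assms(5) by (simp add: gs)
  have conj: "inv\<^bsub>SL2\<^esub> (xs i) \<otimes>\<^bsub>SL2\<^esub> gs i \<otimes>\<^bsub>SL2\<^esub> xs i = c7 x" for i
  proof -
    note c = xs(1)[of i] c7_SL2[OF assms(5)]
    have "inv\<^bsub>SL2\<^esub> (xs i) \<otimes>\<^bsub>SL2\<^esub> (xs i \<otimes>\<^bsub>SL2\<^esub> c7 x \<otimes>\<^bsub>SL2\<^esub> inv\<^bsub>SL2\<^esub> (xs i)) \<otimes>\<^bsub>SL2\<^esub> xs i = c7 x"
      using c by (simp add: SL2.m_assoc) (simp add: SL2.m_assoc[symmetric])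
    then show ?thesis unfolding xs(2)[of i, symmetric] .
  qed
  \<comment> \<open>The other element of \<open>T\<close> is the inverse of \<open>gs i\<close>, and
    conjugation respects inverses.\<close>
  have conj': "inv\<^bsub>SL2\<^esub> (xs i) \<otimes>\<^bsub>SL2\<^esub> gs j \<otimes>\<^bsub>SL2\<^esub> xs i = c7 (inverse x)" if "i \<noteq> j" for i j
  proof -
    have "gs j = inv\<^bsub>SL2\<^esub> (gs i)"
      using that exhaust_2[of i] exhaust_2[of j] assms(5) by (auto simp: gs c7_SL2_inverse)
    then have "inv\<^bsub>SL2\<^esub> (xs i) \<otimes>\<^bsub>SL2\<^esub> gs j \<otimes>\<^bsub>SL2\<^esub> xs i =
        inv\<^bsub>SL2\<^esub> (inv\<^bsub>SL2\<^esub> (xs i) \<otimes>\<^bsub>SL2\<^esub> gs i \<otimes>\<^bsub>SL2\<^esub> xs i)"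
      using xs(1)[of i] gsc[of i] by (simp add: SL2.inv_mult_group SL2.m_assoc)
    then show ?thesis unfolding conj c7_SL2_inverse[OF assms(5)] .
  qed
  have q: "chi (inv\<^bsub>SL2\<^esub> (xs i) \<otimes>\<^bsub>SL2\<^esub> gs j \<otimes>\<^bsub>SL2\<^esub> xs i) = (if j = i then ?a else ?b)" for i j
    using conj[of i] conj'[of i j] by auto
  have "x \<noteq> inverse x"
    using assms(5-7) by (metis field_class.field_inverse left_inverse power2_eq_1_iff power2_eq_square)
  then have ne: "gs 1 \<noteq> gs 2" using assms(9,10) by (auto simp: c7_def vec_eq_iff forall_2)
  have a: "?a = - 1"
  proof (rule ccontr)
    assume na: "?a \<noteq> - 1"
    \<comment> \<open>Reindexes the two elements of \<open>T\<close> by \<open>bool\<close>, the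
      index type of the rank two calculation.\<close>
    let ?i = "\<lambda>c. if c then 1 else 2 :: 2"
    have i: "(if ?i d = ?i c then ?a else ?b) = (if d = c then ?a else ?b)" for c d
      by (cases c; cases d) simp_all
    have "diagonal_part SL2 (yd_induced SL2 (c7 x) chi) (\<lambda>c. gs (?i c))
      (\<lambda>c. induced_relations SL2 ?Z chi +>\<^bsub>monoid_algebra SL2\<^esub> Poly_Mapping.single (xs (?i c)) 1)
      (\<lambda>c. coset_coord (xs (?i c)))
      (\<lambda>d c. chi (inv\<^bsub>SL2\<^esub> (xs (?i c)) \<otimes>\<^bsub>SL2\<^esub> gs (?i d) \<otimes>\<^bsub>SL2\<^esub> xs (?i c)))"
    proof (rule diagonal_part_induced)
      show "inj (\<lambda>c. gs (?i c))" using ne by (auto simp: inj_def)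
      show "gs (?i c) \<otimes>\<^bsub>SL2\<^esub> gs (?i d) = gs (?i d) \<otimes>\<^bsub>SL2\<^esub> gs (?i c)" for c d
        by (simp add: gs SL2_def mult.commute flip: c7_mult)
    qed (rule xs)+
    then have "diagonal_part SL2 (yd_induced SL2 (c7 x) chi) (\<lambda>c. gs (?i c))
      (\<lambda>c. induced_relations SL2 ?Z chi +>\<^bsub>monoid_algebra SL2\<^esub> Poly_Mapping.single (xs (?i c)) 1)
      (\<lambda>c. coset_coord (xs (?i c))) (\<lambda>c d. if c = d then ?a else ?b)"
      unfolding q i .
    from diagonal_part.word_symm_finite_dimensional[OF this assms(12)]
    show False using word_symm_affine_nonzero[OF ab na] by meson
  qed
  have b: "?b = - 1" using ab unfolding a by (simp add: minus_equation_iff)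
  have "braiding_matrix SL2 chi gs xs = vector [vector [- 1, - 1], vector [- 1, - 1]]"
    by (simp add: braiding_matrix_def q vec_eq_iff forall_2 a b)
  moreover have "even (group.ord (units_of scalars) x)"
  proof -
    interpret U: group "units_of (scalars :: 'f ring)" by (rule group_units_of_scalars)
    have pow: "x [^]\<^bsub>units_of scalars\<^esub> n = x ^ n" for n :: nat
      by (induction n) (simp_all add: units_of_scalars mult.commute)
    \<comment> \<open>Through \<open>c7\<close> the character sends powers of \<open>x\<close> to
      powers of -1. At the order of \<open>x\<close> the value is 1, and 1 differs from -1 in
      characteristic 0.\<close>
    have chi_pow: "chi (c7 (x ^ n)) = (- 1) ^ n" for n
      using assms(5) by (induction n) (simp_all add: chi_1 chi_c7 a)
    have "x ^ U.ord x = 1" using U.pow_ord_eq_1[of x] assms(5) by (simp add: pow units_of_scalars)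
    then have "(- 1 :: 'k) ^ U.ord x = 1" using chi_pow[of "U.ord x"] chi_1 by simp
    then show ?thesis by (metis neg_one_odd_power one_neq_neg_one)
  qed
  ultimately show ?thesis by blast
qed

end
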